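(* The function $$2\frac{\partial_2(\theta_q)}{\theta_q}-(\ell_q^2+\ell_q)=2\frac{\delta_q(\theta_q)}{\theta_q}+\ell_q^2-\ell_q$$ is an elliptic function, i.e. belongs to $C_E$, and the Galois $\partial_2$-group $Gal^{\partial_2}(\mathcal{M}_{qx})$ of the $q$-difference equation $y(qx)=qx\,y(x)$ satisfies $$Gal^{\partial_2}(\mathcal{M}_{qx})\subset\left\{c:\ \frac{\partial_2(c)}{c}=0\right\}.$$
   Context: Let $k$ be a field of characteristic zero, $K$ a finite extension of $k(q)$, $|\ |$ an extension to $K$ of the $q^{-1}$-adic absolute value on $k(q)$ (so $|q|>1$), $C$ the smallest complete and algebraically closed valued extension of $(K,|\ |)$, $C^*=C\smallsetminus\{0\}$, $\mathcal{M}er(C^* )$ the field of meromorphic functions on $C^*$, $\sigma_q:f(x)\mapsto f(qx)$, and $C_E=\mathcal{M}er(C^* )^{\sigma_q}$ the field of elliptic functions. Let $\delta_x=x\frac{d}{dx}$, and $\delta_q$ the extension of $q\frac{d}{dq}$ to $C$ (by continuity) and to $\mathcal{M}er(C^* )$ with $\delta_q(x)=0$. Let $\theta_q(x)=\sum_{n\in\mathbb{Z}}q^{-n(n-1)/2}x^n$ (so $\theta_q(qx)=qx\,\theta_q(x)$), $\ell_q=\delta_x(\theta_q)/\theta_q$, and $\partial_2=\delta=\ell_q\delta_x+\delta_q$, which commutes with $\sigma_q$. One has $[\delta_x,\delta]=\delta_x(\ell_q)\delta_x$ with $\delta_x(\ell_q)\in C_E$. Let $\widetilde C_E$ be a $(\delta_x,\delta)$-closure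 of $C_E$ (a differential closure in the class of fields with two derivations satisfying this commutation relation), with $\sigma_q$ acting as the identity, and $\widetilde C_E(x,\ell_q)$ the field of fractions of $\widetilde C_E\otimes_{C_E}C_E(x,\ell_q)$. $Gal^{\partial_2}(\mathcal{M}_{qx})$ is defined as follows: let $\mathcal{R}$ be a ring extension of $\widetilde C_E(x,\ell_q)$ with commuting extensions of $\sigma_q$ and $\partial_2$, having no nontrivial ideal stable under $\sigma_q$ and $\partial_2$, and generated as a $\partial_2$-ring by an invertible element $z$ with $\sigma_q(z)=qx\,z$ and by $z^{-1}$; let $L$ be its total ring of fractions. The group consists of the automorphisms $\varphi$ of $L$ over $\widetilde C_E(x,\ell_q)$ commuting with $\sigma_q$ and $\partial_2$, identified with the elements $c=\varphi(z)/z\in\widetilde C_E^{\,*}=GL_1(\widetilde C_E)$. *)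

theory Defs
  imports
    "HOL-Analysis.Analysis"
    "HOL-Computational_Algebra.Computational_Algebra"
    "HOL-Algebra.Generated_Fields"
begin

section \<open>Rings carried by subsets of a type, and derivations\<close>

definition ring_on :: "'a::comm_ring_1 set \<Rightarrow> 'a ring" where
  "ring_on S = \<lparr>carrier = S, monoid.mult = (*), one = 1, ring.zero = 0, add = (+)\<rparr>"

abbreviation full_ring :: "'a::comm_ring_1 ring" where
  "full_ring \<equiv> ring_on UNIV"

definition derivation :: "('a, 'b) ring_scheme \<Rightarrow> ('a \<Rightarrow> 'a) \<Rightarrow> bool" where
  "derivation R d \<longleftrightarrow>
     d \<in> carrier R \<rightarrow> carrier R \<and>
     (\<forall>a\<in>carrier R. \<forall>b\<in>carrier R. d (a \<oplus>\<^bsub>R\<^esub> b) = d a \<oplus>\<^bsub>R\<^esub> d b) \<and>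
     (\<forall>a\<in>carrier R. \<forall>b\<in>carrier R.
        d (a \<otimes>\<^bsub>R\<^esub> b) = (d a \<otimes>\<^bsub>R\<^esub> b) \<oplus>\<^bsub>R\<^esub> (a \<otimes>\<^bsub>R\<^esub> d b))"


section \<open>The valued field \<open>C\<close>\<close>

text \<open>
  A field with a non-archimedean absolute value \<open>vabs\<close> and the metric it induces. That
  \<open>vabs\<close> is nonnegative and vanishes exactly at \<open>0\<close> follows from the metric axioms. (The library's
  \<open>norm\<close> is tied to real vector spaces, which these fields are not.)
\<close>

class nonarch_field = field + metric_space +
  fixes vabs :: "'a \<Rightarrow> real"
  assumes dist_vabs: "dist x y = vabs (x - y)"
    and vabs_mult: "vabs (x * y) = vabs x * vabs y"
    and vabs_add: "vabs (x + y) \<le> max (vabs x) (vabs y)"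

lemma vabs_eq_0_iff: "vabs x = 0 \<longleftrightarrow> x = 0" for x :: "'a::nonarch_field"
  using dist_vabs[of x 0] dist_eq_0_iff[of x 0] by (metis diff_zero)

lemma vabs_nonneg: "0 \<le> vabs x" for x :: "'a::nonarch_field"
  using dist_vabs[of x 0] by (metis diff_zero zero_le_dist)

lemma vabs_minus: "vabs (- x) = vabs x" for x :: "'a::nonarch_field"
  using dist_vabs[of x 0] dist_vabs[of 0 x] dist_commute[of x 0] by simp

instance nonarch_field \<subseteq> topological_ab_group_add
proof
  fix a b :: 'a
  show "LIM x (nhds a \<times>\<^sub>F nhds b). fst x + snd x :> nhds (a + b)"
  proof (rule tendstoI)
    fix r :: real assume r: "0 < r"
    have "eventually (\<lambda>p. dist (fst p) a < r \<and> dist (snd p) b < r) (nhds a \<times>\<^sub>F nhds b)"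
      unfolding eventually_prod_filter
      using r by (intro exI[of _ "\<lambda>x. dist x a < r"] exI[of _ "\<lambda>x. dist x b < r"])
        (auto simp: eventually_nhds_metric)
    then show "eventually (\<lambda>p. dist (fst p + snd p) (a + b) < r) (nhds a \<times>\<^sub>F nhds b)"
    proof (rule eventually_mono)
      fix p :: "'a \<times> 'a" assume p: "dist (fst p) a < r \<and> dist (snd p) b < r"
      have "vabs ((fst p - a) + (snd p - b)) < r"
        using vabs_add[of "fst p - a" "snd p - b"] p by (auto simp: dist_vabs intro: le_less_trans)
      then show "dist (fst p + snd p) (a + b) < r"
        by (simp add: dist_vabs add_diff_add)
    qed
  qed
  show "(uminus \<longlongrightarrow> - a) (nhds a)"
  proof (rule tendstoI)
    fix r :: real assume r: "0 < r"
    have "dist (- x) (- a) = dist x a" for x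
      using vabs_minus[of "x - a"] by (simp add: dist_vabs)
    then show "eventually (\<lambda>x. dist (- x) (- a) < r) (nhds a)"
      using r by (auto simp: eventually_nhds_metric)
  qed
qed

definition alg_closed_subfield :: "'c::field set \<Rightarrow> bool" where
  "alg_closed_subfield S \<longleftrightarrow>
     subfield S full_ring \<and>
     (\<forall>p. (\<forall>n. poly.coeff p n \<in> S) \<and> Polynomial.degree p > 0 \<longrightarrow> (\<exists>x\<in>S. poly p x = 0))"

text \<open>
  \<open>\<iota>\<close> embeds \<open>k(q)\<close> (the fraction field of \<open>k[q]\<close>) into \<open>C\<close>, and \<open>K\<close> is realised as a subfield
  of \<open>C\<close> carrying the restricted absolute value.
\<close>

locale valued_ground_field =
  fixes \<iota> :: "'k::field_char_0 poly fract \<Rightarrow> 'c::{alg_closed_field,nonarch_field,complete_space}"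
    and K :: "'c set"
  assumes hom: "\<iota> \<in> ring_hom full_ring full_ring"
    and vabs_q: "1 < vabs (\<iota> (Fract [:0, 1:] 1))"
    and q_inverse_adic: "a \<noteq> 0 \<Longrightarrow> b \<noteq> 0 \<Longrightarrow>
      vabs (\<iota> (Fract a b)) =
        vabs (\<iota> (Fract [:0, 1:] 1)) powi (int (Polynomial.degree a) - int (Polynomial.degree b))"
    and K_subfield: "subfield K full_ring" "range \<iota> \<subseteq> K"
    and K_finite: "\<exists>B. finite B \<and> B \<subseteq> K \<and> (\<forall>y\<in>K. \<exists>f. y = (\<Sum>b\<in>B. \<iota> (f b) * b))"
    and smallest: "alg_closed_subfield S \<Longrightarrow> K \<subseteq> S \<Longrightarrow> complete S \<Longrightarrow> S = UNIV"


section \<open>Meromorphic functions on \<open>C\<^sup>*\<close>\<close>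

definition laurent_expansion :: "(int \<Rightarrow> 'c) \<Rightarrow> ('c::nonarch_field \<Rightarrow> 'c) \<Rightarrow> bool" where
  "laurent_expansion a f \<longleftrightarrow> (\<forall>x. x \<noteq> 0 \<longrightarrow> ((\<lambda>n. a n * x powi n) has_sum f x) UNIV)"

text \<open>The value of the function at \<open>0\<close> is irrelevant.\<close>

definition analytic_on_punctured :: "('c::nonarch_field \<Rightarrow> 'c) \<Rightarrow> bool" where
  "analytic_on_punctured f \<longleftrightarrow> (\<exists>a. laurent_expansion a f)"

text \<open>
  The type \<open>'m\<close> is the field of fractions of the ring of analytic functions on \<open>C\<^sup>*\<close>, and
  \<open>mk f\<close> is the class of the analytic function \<open>f\<close>.
\<close>

locale meromorphic_functions =
  fixes mk :: "('c::nonarch_field \<Rightarrow> 'c) \<Rightarrow> 'm::field"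
  assumes mk_eq_iff: "analytic_on_punctured f \<Longrightarrow> analytic_on_punctured g \<Longrightarrow>
      mk f = mk g \<longleftrightarrow> (\<forall>x. x \<noteq> 0 \<longrightarrow> f x = g x)"
    and mk_one: "mk (\<lambda>x. 1) = 1"
    and mk_add: "analytic_on_punctured f \<Longrightarrow> analytic_on_punctured g \<Longrightarrow>
      mk (\<lambda>x. f x + g x) = mk f + mk g"
    and mk_mult: "analytic_on_punctured f \<Longrightarrow> analytic_on_punctured g \<Longrightarrow>
      mk (\<lambda>x. f x * g x) = mk f * mk g"
    and fraction: "\<exists>f g. analytic_on_punctured f \<and> analytic_on_punctured g \<and>
      mk g \<noteq> 0 \<and> m = mk f / mk g"

text \<open>
  The derivation \<open>dqC\<close> of \<open>C\<close> is the continuous extension of \<open>q d/dq\<close> on \<open>k(q)\<close>; the formula is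
  the quotient rule. The operators \<open>dx\<close> and \<open>dq\<close> on meromorphic functions are the derivations
  acting termwise on Laurent series, by \<open>x\<^sup>n \<mapsto> n x\<^sup>n\<close> and by \<open>dqC\<close> on the coefficients.
  All these objects are uniquely determined.
\<close>

locale q_setting = valued_ground_field \<iota> K + meromorphic_functions mk
  for \<iota> :: "'k::field_char_0 poly fract \<Rightarrow> 'c::{alg_closed_field,nonarch_field,complete_space}"
    and K :: "'c set"
    and mk :: "('c \<Rightarrow> 'c) \<Rightarrow> 'm::field" +
  fixes q :: 'c
    and dqC :: "'c \<Rightarrow> 'c"
    and \<sigma> dx dq :: "'m \<Rightarrow> 'm"
  assumes q_def: "q = \<iota> (Fract [:0, 1:] 1)"
    and dqC: "derivation full_ring dqC" "continuous_on UNIV dqC"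
      "b \<noteq> 0 \<Longrightarrow> dqC (\<iota> (Fract a b)) =
         \<iota> (Fract ([:0, 1:] * (pderiv a * b - a * pderiv b)) (b * b))"
    and \<sigma>: "\<sigma> \<in> ring_hom full_ring full_ring"
      "analytic_on_punctured f \<Longrightarrow> \<sigma> (mk f) = mk (\<lambda>x. f (q * x))"
    and dx: "derivation full_ring dx"
      "laurent_expansion u f \<Longrightarrow>
         dx (mk f) = mk (\<lambda>x. \<Sum>\<^sub>\<infinity>n. (of_int n * u n) * x powi n)"
    and dq: "derivation full_ring dq"
      "laurent_expansion u f \<Longrightarrow>
         dq (mk f) = mk (\<lambda>x. \<Sum>\<^sub>\<infinity>n. dqC (u n) * x powi n)"

definition theta_fun :: "'c::nonarch_field \<Rightarrow> 'c \<Rightarrow> 'c" where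
  "theta_fun q x = (\<Sum>\<^sub>\<infinity>n::int. q powi (- (n * (n - 1) div 2)) * x powi n)"


section \<open>Fields with two derivations satisfying a commutation relation\<close>

text \<open>
  Structures for the class of fields with derivations \<open>der1\<close>, \<open>der2\<close> such that
  \<open>[der1, der2] = com \<cdot> der1\<close>, where \<open>com\<close> is a distinguished element.
\<close>

record 'a diff2_ring = "'a ring" +
  der1 :: "'a \<Rightarrow> 'a"
  der2 :: "'a \<Rightarrow> 'a"
  com :: 'a

definition diff2_field :: "'a diff2_ring \<Rightarrow> bool" where
  "diff2_field R \<longleftrightarrow> field R \<and> derivation R (der1 R) \<and> derivation R (der2 R) \<and>
     com R \<in> carrier R \<and>
     (\<forall>a\<in>carrier R. der1 R (der2 R a) \<ominus>\<^bsub>R\<^esub> der2 R (der1 R a) = com R \<otimes>\<^bsub>R\<^esub> der1 R a)"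

definition diff2_hom :: "'a diff2_ring \<Rightarrow> 'b diff2_ring \<Rightarrow> ('a \<Rightarrow> 'b) set" where
  "diff2_hom R S = {h \<in> ring_hom R S. h (com R) = com S \<and>
     (\<forall>a\<in>carrier R. h (der1 R a) = der1 S (h a) \<and> h (der2 R a) = der2 S (h a))}"

definition diff2_on ::
  "'a::comm_ring_1 set \<Rightarrow> ('a \<Rightarrow> 'a) \<Rightarrow> ('a \<Rightarrow> 'a) \<Rightarrow> 'a \<Rightarrow> 'a diff2_ring" where
  "diff2_on S d1 d2 c =
     \<lparr>carrier = S, monoid.mult = (*), one = 1, ring.zero = 0, add = (+),
      der1 = d1, der2 = d2, com = c\<rparr>"

text \<open>Differential polynomials with parameters, as terms of the language.\<close>

datatype (dt_params: 'a) dterm =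
    DConst 'a
  | DVar nat
  | DAdd "'a dterm" "'a dterm"
  | DMult "'a dterm" "'a dterm"
  | DDer1 "'a dterm"
  | DDer2 "'a dterm"

primrec dt_eval :: "'b diff2_ring \<Rightarrow> ('a \<Rightarrow> 'b) \<Rightarrow> (nat \<Rightarrow> 'b) \<Rightarrow> 'a dterm \<Rightarrow> 'b" where
  "dt_eval S h v (DConst a) = h a"
| "dt_eval S h v (DVar n) = v n"
| "dt_eval S h v (DAdd s t) = dt_eval S h v s \<oplus>\<^bsub>S\<^esub> dt_eval S h v t"
| "dt_eval S h v (DMult s t) = dt_eval S h v s \<otimes>\<^bsub>S\<^esub> dt_eval S h v t"
| "dt_eval S h v (DDer1 t) = der1 S (dt_eval S h v t)"
| "dt_eval S h v (DDer2 t) = der2 S (dt_eval S h v t)"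

definition dt_solvable ::
  "'b diff2_ring \<Rightarrow> ('a \<Rightarrow> 'b) \<Rightarrow> 'a dterm set \<Rightarrow> 'a dterm set \<Rightarrow> bool" where
  "dt_solvable S h P Q \<longleftrightarrow> (\<exists>v. range v \<subseteq> carrier S \<and>
     (\<forall>t\<in>P. dt_eval S h v t = \<zero>\<^bsub>S\<^esub>) \<and> (\<forall>t\<in>Q. dt_eval S h v t \<noteq> \<zero>\<^bsub>S\<^esub>))"

text \<open>
  A differentially closed field is one that is existentially closed in the class: every finite
  system of equations and inequations over \<open>R\<close> that is solvable in some extension \<open>h: R \<rightarrow> S\<close> is
  solvable in \<open>R\<close>. For infinite \<open>R\<close> (in particular in characteristic \<open>0\<close>) it loses nothing to
  take \<open>S\<close> with the same underlying type, since an extension generated by \<open>R\<close> and finitely many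
  elements has the cardinality of \<open>R\<close>.
\<close>

definition diff2_closed :: "'a diff2_ring \<Rightarrow> bool" where
  "diff2_closed R \<longleftrightarrow> diff2_field R \<and>
     (\<forall>(S::'a diff2_ring) h P Q.
        diff2_field S \<and> h \<in> diff2_hom R S \<and> finite P \<and> finite Q \<and>
        (\<forall>t\<in>P \<union> Q. dt_params t \<subseteq> carrier R) \<and> dt_solvable S h P Q
        \<longrightarrow> dt_solvable R id P Q)"

text \<open>
  A differential closure \<open>e: R \<rightarrow> F\<close> is a differentially closed extension that embeds over \<open>R\<close> into
  every differentially closed extension \<open>g: R \<rightarrow> S\<close>. By the downward Loewenheim-Skolem theorem
  it suffices, for infinite \<open>R\<close>, to let \<open>S\<close> range over structures on the type of \<open>F\<close>.
\<close>

definition diff2_closure :: "'a diff2_ring \<Rightarrow> ('a \<Rightarrow> 'b) \<Rightarrow> 'b diff2_ring \<Rightarrow> bool" where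
  "diff2_closure R e F \<longleftrightarrow> e \<in> diff2_hom R F \<and> diff2_closed F \<and>
     (\<forall>(S::'b diff2_ring) g. diff2_closed S \<and> g \<in> diff2_hom R S \<longrightarrow>
        (\<exists>h\<in>diff2_hom F S. \<forall>a\<in>carrier R. h (e a) = g a))"


section \<open>Extension of the field of constants\<close>

text \<open>
  For \<open>e: E \<rightarrow> F\<close> and \<open>E \<subseteq> G\<close>, the lists of pairs in \<open>F \<times> G\<close> represent elements of the tensor
  product of \<open>F\<close> and \<open>G\<close> over \<open>E\<close> as sums of pure tensors; \<open>tensor_eq E e G\<close> is equality there.
\<close>

inductive tensor_eq ::
  "'m set \<Rightarrow> ('m \<Rightarrow> 'f) \<Rightarrow> 'm set \<Rightarrow>
     ('f::comm_ring_1 \<times> 'm::comm_ring_1) list \<Rightarrow> ('f \<times> 'm) list \<Rightarrow> bool"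
  for E e G where
  refl: "tensor_eq E e G xs xs"
| sym: "tensor_eq E e G xs ys \<Longrightarrow> tensor_eq E e G ys xs"
| trans: "tensor_eq E e G xs ys \<Longrightarrow> tensor_eq E e G ys zs \<Longrightarrow> tensor_eq E e G xs zs"
| append: "tensor_eq E e G xs ys \<Longrightarrow> tensor_eq E e G us vs \<Longrightarrow>
    tensor_eq E e G (xs @ us) (ys @ vs)"
| commute: "tensor_eq E e G (xs @ ys) (ys @ xs)"
| zero: "b \<in> G \<Longrightarrow> tensor_eq E e G [(0, b)] []"
| add_left: "b \<in> G \<Longrightarrow> tensor_eq E e G [(a + a', b)] [(a, b), (a', b)]"
| add_right: "b \<in> G \<Longrightarrow> b' \<in> G \<Longrightarrow> tensor_eq E e G [(a, b + b')] [(a, b), (a, b')]"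
| scalar: "s \<in> E \<Longrightarrow> b \<in> G \<Longrightarrow> tensor_eq E e G [(e s * a, b)] [(a, s * b)]"

definition tensor_value ::
  "('f \<Rightarrow> 'b) \<Rightarrow> ('m \<Rightarrow> 'b) \<Rightarrow> ('f \<times> 'm) list \<Rightarrow> 'b::comm_ring_1" where
  "tensor_value i j xs = (\<Sum>(a, b)\<leftarrow>xs. i a * j b)"

text \<open>
  The type \<open>'b\<close> is the field of fractions of that tensor product, with canonical maps \<open>i\<close>, \<open>j\<close>.
  It carries the operators induced by \<open>\<sigma>\<close>, \<open>d\<close> on \<open>G\<close> and by the identity, \<open>D\<close> on \<open>F\<close>.
\<close>

locale constants_extension =
  fixes E G :: "'m::field set"
    and \<sigma> d :: "'m \<Rightarrow> 'm"
    and e :: "'m \<Rightarrow> 'f::field"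
    and D :: "'f \<Rightarrow> 'f"
    and i :: "'f \<Rightarrow> 'b::field"
    and j :: "'m \<Rightarrow> 'b"
    and \<sigma>B dB :: "'b \<Rightarrow> 'b"
  assumes i_hom: "i \<in> ring_hom full_ring full_ring"
    and j_hom: "j \<in> ring_hom (ring_on G) full_ring"
    and compatible: "s \<in> E \<Longrightarrow> i (e s) = j s"
    and injective: "set xs \<subseteq> UNIV \<times> G \<Longrightarrow> tensor_value i j xs = 0 \<Longrightarrow> tensor_eq E e G xs []"
    and fraction: "\<exists>xs ys. set xs \<subseteq> UNIV \<times> G \<and> set ys \<subseteq> UNIV \<times> G \<and>
      tensor_value i j ys \<noteq> 0 \<and> y = tensor_value i j xs / tensor_value i j ys"
    and \<sigma>B_hom: "\<sigma>B \<in> ring_hom full_ring full_ring"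
    and \<sigma>B_i: "\<sigma>B (i a) = i a"
    and \<sigma>B_j: "g \<in> G \<Longrightarrow> \<sigma>B (j g) = j (\<sigma> g)"
    and dB_derivation: "derivation full_ring dB"
    and dB_i: "dB (i a) = i (D a)"
    and dB_j: "g \<in> G \<Longrightarrow> dB (j g) = j (d g)"


section \<open>Picard-Vessiot extensions and Galois groups in rank one\<close>

definition total_ring_of_fractions :: "'l::comm_ring_1 set \<Rightarrow> bool" where
  "total_ring_of_fractions R \<longleftrightarrow> subring R full_ring \<and>
     (\<forall>b\<in>R. (\<forall>a\<in>R. a * b = 0 \<longrightarrow> a = 0) \<longrightarrow> b dvd 1) \<and>
     (\<forall>y. \<exists>a\<in>R. \<exists>b\<in>R. b dvd 1 \<and> y * b = a)"

text \<open>
  \<open>'l\<close> is the total ring of fractions of \<open>R\<close>, an extension, via \<open>\<eta>\<close>, of the base field \<open>'b\<close>; \<open>R\<close> is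
  a Picard-Vessiot ring for the equation \<open>\<sigma>(y) = a y\<close>, with solution \<open>z\<close> and \<open>zi\<close> inverse to \<open>z\<close>.
\<close>

locale rank_one_picard_vessiot =
  fixes \<sigma>B dB :: "'b::field \<Rightarrow> 'b"
    and a :: 'b
    and \<eta> :: "'b \<Rightarrow> 'l::comm_ring_1"
    and R :: "'l set"
    and \<sigma>L dL :: "'l \<Rightarrow> 'l"
    and z zi :: 'l
  assumes \<eta>_hom: "\<eta> \<in> ring_hom full_ring full_ring"
    and fractions: "total_ring_of_fractions R"
    and \<sigma>L_hom: "\<sigma>L \<in> ring_hom full_ring full_ring"
    and dL_derivation: "derivation full_ring dL"
    and \<sigma>L_dL: "\<sigma>L (dL y) = dL (\<sigma>L y)"
    and \<sigma>L_\<eta>: "\<sigma>L (\<eta> b) = \<eta> (\<sigma>B b)"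
    and dL_\<eta>: "dL (\<eta> b) = \<eta> (dB b)"
    and R_stable: "\<sigma>L ` R \<subseteq> R" "dL ` R \<subseteq> R"
    and z_inverse: "z * zi = 1"
    and z_solution: "\<sigma>L z = \<eta> a * z"
    and R_generated:
      "R = \<Inter>{S. subring S full_ring \<and> range \<eta> \<union> {z, zi} \<subseteq> S \<and> dL ` S \<subseteq> S}"
    and R_simple: "ideal I (ring_on R) \<Longrightarrow> \<sigma>L ` I \<subseteq> I \<Longrightarrow> dL ` I \<subseteq> I \<Longrightarrow> I = {0} \<or> I = R"

definition difference_differential_automorphisms ::
  "('b \<Rightarrow> 'l) \<Rightarrow> ('l \<Rightarrow> 'l) \<Rightarrow> ('l \<Rightarrow> 'l) \<Rightarrow> ('l::comm_ring_1 \<Rightarrow> 'l) set" where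
  "difference_differential_automorphisms \<eta> \<sigma>L dL =
     {\<phi> \<in> ring_iso full_ring full_ring.
        (\<forall>b. \<phi> (\<eta> b) = \<eta> b) \<and> (\<forall>y. \<phi> (\<sigma>L y) = \<sigma>L (\<phi> y)) \<and> (\<forall>y. \<phi> (dL y) = dL (\<phi> y))}"

text \<open>The group, identified with the elements \<open>\<phi>(z)/z\<close>.\<close>

definition rank_one_galois_group ::
  "('b \<Rightarrow> 'l) \<Rightarrow> ('l \<Rightarrow> 'l) \<Rightarrow> ('l \<Rightarrow> 'l) \<Rightarrow> 'l \<Rightarrow> 'l \<Rightarrow> 'l::comm_ring_1 set" where
  "rank_one_galois_group \<eta> \<sigma>L dL z zi =
     {\<phi> z * zi | \<phi>. \<phi> \<in> difference_differential_automorphisms \<eta> \<sigma>L dL}"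

end

theory Submission
  imports Defs
begin

text \<open>
  The function \<open>\<theta>\<close> satisfies \<open>\<theta>(q x) = q x \<theta>(x)\<close>, and \<open>\<delta>\<^sub>q \<sigma> = \<sigma> (\<delta>\<^sub>q + \<delta>\<^sub>x)\<close> on it, because
  \<open>\<delta>\<^sub>q(q\<^sup>n) = n q\<^sup>n\<close>. Hence \<open>\<sigma>(\<ell>) = \<ell> + 1\<close> for \<open>\<ell> = \<delta>\<^sub>x(\<theta>)/\<theta>\<close>, and \<open>\<delta> = \<ell> \<delta>\<^sub>x + \<delta>\<^sub>q\<close> commutes with \<open>\<sigma>\<close>. The
  logarithmic derivative \<open>y = \<delta>(z)/z\<close> of any solution \<open>z\<close> of \<open>\<sigma>(z) = q x z\<close> therefore satisfies
  \<open>\<sigma>(y) = y + \<ell> + 1\<close>. So does \<open>(\<ell>\<^sup>2 + \<ell>)/2\<close>, and \<open>w = 2 y - (\<ell>\<^sup>2 + \<ell>)\<close> is invariant under \<open>\<sigma>\<close>. For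
  \<open>z = \<theta>\<close> this says that \<open>w\<close> is elliptic.

  Let now \<open>z\<close> generate a Picard-Vessiot ring \<open>R\<close>, and let \<open>F\<close> be the differentially closed field of
  constants. If \<open>w \<in> F\<close>, then \<open>y\<close> lies in the base field, every automorphism \<open>\<phi>\<close> fixes it, and
  \<open>c = \<phi>(z)/z\<close> satisfies \<open>\<delta>(c)/c = \<phi>(y) - y = 0\<close>. It remains to see that \<open>w\<close> and \<open>c\<close> belong to \<open>F\<close>.

  The ring \<open>R\<close> is spanned by the elements \<open>b z\<^sup>n\<close>, with \<open>b\<close> in the base field and \<open>n \<in> \<int>\<close>, over the
  ring \<open>W\<close> that \<open>F\<close>, \<open>w\<close> and the derivatives of \<open>w\<close> generate. The equation \<open>\<sigma>(b) (q x)\<^sup>n = b\<close> has no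
  solutions \<open>b \<noteq> 0\<close> in the base field except for \<open>n = 0\<close> and \<open>b \<in> F\<close> (lemma
  \<open>eigenvector_in_constants\<close>). It follows, by shortening sums, that an invariant that is a
  combination of the \<open>b z\<^sup>n\<close> with coefficients in an \<open>F\<close>-space of invariants belongs to this space
  (lemma \<open>invariant_in_span\<close>). One consequence is that \<open>W\<close> has no differential
  ideals except \<open>0\<close> and \<open>W\<close>, because \<open>R\<close> has none that are stable under \<open>\<sigma>\<close>. Another one is that \<open>c \<in> F\<close> as soon as
  \<open>w \<in> F\<close>: then \<open>\<delta>(c) = 0\<close>, so the denominators of \<open>c\<close> form an ideal of \<open>R\<close> that is stable under
  \<open>\<sigma>\<close> and \<open>\<delta>\<close>, hence contains \<open>1\<close>.

  A differential ring without proper nonzero differential ideals that one element generates over a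
  field closed under solving differential equations is that field (lemma \<open>generator_in_base\<close>): a relation of
  least order and degree for the generator has a solution in the field, and this solution satisfies
  all relations of the generator. Here, however, \<open>F\<close> is closed in the class of fields with the two
  derivations \<open>\<delta>\<^sub>x\<close> and \<open>\<delta>\<close>. To apply this to equations in \<open>\<delta>\<close> alone, an extension field of \<open>F\<close>
  with an extension of \<open>\<delta>\<close> has to be enlarged to one that also carries an extension of \<open>\<delta>\<^sub>x\<close>
  satisfying the commutation relation. The lemma \<open>two_derivation_extension\<close> does this with power
  series in two variables \<open>s\<close> and \<open>t\<close>, on which \<open>\<delta>\<close> is \<open>d/ds\<close> and \<open>\<delta>\<^sub>x\<close> is a multiple of \<open>d/dt\<close>.
\<close>

unbundle no vec_syntax
hide_const (open) Module.smult

section \<open>Ring homomorphisms and derivations\<close>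

text \<open>
  Homomorphisms and derivations of rings that are whole types. As locales they make their laws
  available to the simplifier.
\<close>
locale ring_map =
  fixes h :: "'a::comm_ring_1 \<Rightarrow> 'b::comm_ring_1"
  assumes one [simp]: "h 1 = 1"
    and add [simp]: "h (x + y) = h x + h y"
    and mult [simp]: "h (x * y) = h x * h y"
begin

lemma zero [simp]: "h 0 = 0"
  using add[of 0 0] by simp

lemma minus [simp]: "h (- x) = - h x"
  using add[of x "- x"] by (simp add: eq_neg_iff_add_eq_0 add.commute)

lemma diff [simp]: "h (x - y) = h x - h y"
  using add[of x "- y"] by simp

lemma of_nat [simp]: "h (of_nat n) = of_nat n"
  by (induction n) simp_all

lemma numeral [simp]: "h (numeral n) = numeral n"
  using of_nat[of "numeral n"] by simp

lemma power [simp]: "h (x ^ n) = h x ^ n"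
  by (induction n) simp_all

lemma sum: "h (sum f A) = (\<Sum>a\<in>A. h (f a))"
  by (induction A rule: infinite_finite_induct) simp_all

end

lemma ring_map_iff: "h \<in> ring_hom full_ring full_ring \<longleftrightarrow> ring_map h"
  by (auto simp: ring_hom_def ring_on_def ring_map_def)

lemma ring_map_comp: "ring_map f \<Longrightarrow> ring_map g \<Longrightarrow> ring_map (\<lambda>x. f (g x))"
  by (simp add: ring_map_def)

lemma ring_map_eq_0_iff: "h x = 0 \<longleftrightarrow> x = 0" if "ring_map h" for h :: "'a::field \<Rightarrow> 'b::comm_ring_1"
proof -
  interpret ring_map h by fact
  show ?thesis
    using mult[of x "inverse x"] by (cases "x = 0") auto
qed

lemma ring_map_inverse: "h (inverse x) = inverse (h x)" if "ring_map h" for h :: "'a::field \<Rightarrow> 'b::field"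
proof -
  interpret ring_map h by fact
  show ?thesis
  proof (cases "x = 0")
    case False
    then have "h x * h (inverse x) = 1" by (simp flip: mult)
    then show ?thesis by (simp add: inverse_unique)
  qed simp
qed

lemma ring_map_divide: "h (x / y) = h x / h y" if "ring_map h" for h :: "'a::field \<Rightarrow> 'b::field"
  using that by (simp add: divide_inverse ring_map.mult ring_map_inverse)

locale ring_deriv =
  fixes d :: "'a::comm_ring_1 \<Rightarrow> 'a"
  assumes add [simp]: "d (x + y) = d x + d y"
    and mult [simp]: "d (x * y) = d x * y + x * d y"
begin

lemma zero [simp]: "d 0 = 0"
  using add[of 0 0] by simp

lemma one [simp]: "d 1 = 0"
  using mult[of 1 1] by simp

lemma minus [simp]: "d (- x) = - d x"
  using add[of x "- x"] by (simp add: eq_neg_iff_add_eq_0 add.commute)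

lemma of_nat [simp]: "d (of_nat n) = 0"
  by (induction n) simp_all

lemma power: "d (x ^ Suc n) = of_nat (Suc n) * x ^ n * d x"
  by (induction n) (simp_all add: algebra_simps)

lemma sum: "d (sum f A) = (\<Sum>a\<in>A. d (f a))"
  by (induction A rule: infinite_finite_induct) simp_all

lemma inverse_unit: "x * y = 1 \<Longrightarrow> d y = - d x * y * y"
proof -
  assume xy: "x * y = 1"
  have "d x * y + x * d y = 0" using mult[of x y] xy by simp
  then have "y * (d x * y + x * d y) = 0" by simp
  moreover have "y * (d x * y + x * d y) = d x * y * y + (x * y) * d y"
    by (simp add: algebra_simps)
  ultimately show ?thesis using xy by (simp add: eq_neg_iff_add_eq_0 add.commute)
qed

end

lemma infinite_range_of_nat:
  assumes char_0: "\<And>n. of_nat (Suc n) \<noteq> (0::'a::comm_ring_1)"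
  shows "infinite (range (of_nat :: nat \<Rightarrow> 'a))"
proof -
  have "inj (of_nat :: nat \<Rightarrow> 'a)"
  proof (rule linorder_injI)
    fix m n :: nat assume "m < n"
    then obtain k where "n = m + Suc k" using less_imp_Suc_add by auto
    then show "of_nat m \<noteq> (of_nat n :: 'a)"
      using char_0[of k] of_nat_add[of m "Suc k", where ?'a = 'a] by (metis add_cancel_right_right)
  qed
  then show ?thesis using finite_imageD infinite_UNIV_nat by blast
qed

lemma deriv_iff: "derivation full_ring d \<longleftrightarrow> ring_deriv d"
  by (auto simp: derivation_def ring_on_def ring_deriv_def)

section \<open>Differential polynomials in one variable\<close>

text \<open>
  Differential polynomials in one unknown, with \<open>PVar n\<close> for its \<open>n\<close>-th derivative. The expressions
  are not identified modulo the laws of rings, since only their values matter.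
\<close>
datatype 'a dpoly = PConst 'a | PVar nat | PAdd "'a dpoly" "'a dpoly" | PMult "'a dpoly" "'a dpoly"

primrec peval :: "('a \<Rightarrow> 'r::comm_ring_1) \<Rightarrow> (nat \<Rightarrow> 'r) \<Rightarrow> 'a dpoly \<Rightarrow> 'r" where
  "peval h y (PConst a) = h a"
| "peval h y (PVar n) = y n"
| "peval h y (PAdd s t) = peval h y s + peval h y t"
| "peval h y (PMult s t) = peval h y s * peval h y t"

primrec dvars :: "'a dpoly \<Rightarrow> nat set" where
  "dvars (PConst a) = {}"
| "dvars (PVar n) = {n}"
| "dvars (PAdd s t) = dvars s \<union> dvars t"
| "dvars (PMult s t) = dvars s \<union> dvars t"

primrec pdiff :: "('a \<Rightarrow> 'a) \<Rightarrow> 'a dpoly \<Rightarrow> 'a dpoly" where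
  "pdiff D (PConst a) = PConst (D a)"
| "pdiff D (PVar n) = PVar (Suc n)"
| "pdiff D (PAdd s t) = PAdd (pdiff D s) (pdiff D t)"
| "pdiff D (PMult s t) = PAdd (PMult (pdiff D s) t) (PMult s (pdiff D t))"

lemma peval_pdiff:
  assumes "ring_deriv d" "\<And>a. d (h a) = h (D a)" "\<And>n. d (y n) = y (Suc n)"
  shows "peval h y (pdiff D t) = d (peval h y t)"
proof -
  interpret ring_deriv d by fact
  show ?thesis by (induction t) (simp_all add: assms(2,3))
qed

lemma dvars_pdiff: "dvars t \<subseteq> {..<n} \<Longrightarrow> dvars (pdiff D t) \<subseteq> {..<Suc n}"
  by (induction t) auto

text \<open>A list of expressions gives the coefficients of a polynomial in \<open>PVar n\<close>.\<close>
primrec horner :: "nat \<Rightarrow> 'a::zero dpoly list \<Rightarrow> 'a dpoly" where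
  "horner n [] = PConst 0"
| "horner n (t # ts) = PAdd t (PMult (PVar n) (horner n ts))"

lemma dvars_horner: "(\<And>t. t \<in> set ts \<Longrightarrow> dvars t \<subseteq> {..<n}) \<Longrightarrow> dvars (horner n ts) \<subseteq> {..<Suc n}"
  by (induction ts) (fastforce simp: less_Suc_eq)+

fun ladd :: "'a dpoly list \<Rightarrow> 'a dpoly list \<Rightarrow> 'a dpoly list" where
  "ladd [] us = us"
| "ladd ts [] = ts"
| "ladd (t # ts) (u # us) = PAdd t u # ladd ts us"

lemma length_ladd: "length (ladd ts us) = max (length ts) (length us)"
  by (induction ts us rule: ladd.induct) auto

primrec lmul :: "'a::zero dpoly list \<Rightarrow> 'a dpoly list \<Rightarrow> 'a dpoly list" where
  "lmul [] us = []"
| "lmul (t # ts) us = ladd (map (PMult t) us) (PConst 0 # lmul ts us)"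

primrec coeff_list :: "nat \<Rightarrow> 'a::comm_ring_1 dpoly \<Rightarrow> 'a dpoly list" where
  "coeff_list n (PConst a) = [PConst a]"
| "coeff_list n (PVar i) = (if i < n then [PVar i] else [PConst 0, PConst 1])"
| "coeff_list n (PAdd s t) = ladd (coeff_list n s) (coeff_list n t)"
| "coeff_list n (PMult s t) = lmul (coeff_list n s) (coeff_list n t)"

text \<open>The formal derivative of \<open>X^k (t\<^sub>0 + t\<^sub>1 X + \<dots>)\<close>, divided by \<open>X^(k - 1)\<close>.\<close>

primrec lderiv :: "nat \<Rightarrow> 'a::semiring_1 dpoly list \<Rightarrow> 'a dpoly list" where
  "lderiv k [] = []"
| "lderiv k (t # ts) = PMult (PConst (of_nat k)) t # lderiv (Suc k) ts"

lemma length_lderiv [simp]: "length (lderiv k ts) = length ts"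
  by (induction ts arbitrary: k) simp_all

lemma lderiv_append: "lderiv k (ts @ us) = lderiv k ts @ lderiv (k + length ts) us"
  by (induction ts arbitrary: k) simp_all

lemma dvars_lderiv: "t \<in> set (lderiv k ts) \<Longrightarrow> \<exists>u\<in>set ts. dvars t = dvars u"
  by (induction ts arbitrary: k) auto

lemma dvars_ladd: "t \<in> set (ladd ts us) \<Longrightarrow> (\<And>t. t \<in> set ts \<union> set us \<Longrightarrow> dvars t \<subseteq> V) \<Longrightarrow> dvars t \<subseteq> V"
  by (induction ts us arbitrary: t rule: ladd.induct) (auto, blast+)

lemma dvars_lmul:
  "t \<in> set (lmul ts us) \<Longrightarrow> (\<And>t. t \<in> set ts \<union> set us \<Longrightarrow> dvars t \<subseteq> V) \<Longrightarrow> dvars t \<subseteq> V"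
proof (induction ts arbitrary: t)
  case (Cons a ts)
  have "dvars s \<subseteq> V" if "s \<in> set (map (PMult a) us) \<union> set (PConst 0 # lmul ts us)" for s
  proof -
    from that consider u where "u \<in> set us" "s = PMult a u" | "s = PConst 0" | "s \<in> set (lmul ts us)"
      by auto
    then show ?thesis
    proof cases
      case 1
      then show ?thesis using Cons.prems(2)[of a] Cons.prems(2)[of u] by simp
    next
      case 3
      then show ?thesis using Cons.IH Cons.prems(2) by simp
    qed simp
  qed
  then show ?case using Cons.prems(1) dvars_ladd by (metis lmul.simps(2))
qed simp

lemma dvars_coeff_list: "dvars t \<subseteq> {..<Suc n} \<Longrightarrow> u \<in> set (coeff_list n t) \<Longrightarrow> dvars u \<subseteq> {..<n}"
proof (induction t arbitrary: u)
  case (PAdd s t)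
  then show ?case using dvars_ladd[of u "coeff_list n s" "coeff_list n t" "{..<n}"] by auto
next
  case (PMult s t)
  then show ?case using dvars_lmul[of u "coeff_list n s" "coeff_list n t" "{..<n}"] by auto
qed (auto split: if_splits)

context ring_map
begin

lemma horner_append:
  "peval h y (horner n (ts @ us)) = peval h y (horner n ts) + y n ^ length ts * peval h y (horner n us)"
  by (induction ts) (simp_all add: algebra_simps)

lemma horner_eq_0:
  "(\<And>t. t \<in> set ts \<Longrightarrow> peval h y t = 0) \<Longrightarrow> peval h y (horner n ts) = 0"
  by (induction ts) simp_all

lemma horner_ladd: "peval h y (horner n (ladd ts us)) = peval h y (horner n ts) + peval h y (horner n us)"
  by (induction ts us rule: ladd.induct) (simp_all add: algebra_simps)

lemma horner_map_Mul: "peval h y (horner n (map (PMult t) ts)) = peval h y t * peval h y (horner n ts)"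
  by (induction ts) (simp_all add: algebra_simps)

lemma horner_lmul: "peval h y (horner n (lmul ts us)) = peval h y (horner n ts) * peval h y (horner n us)"
  by (induction ts) (simp_all add: horner_ladd horner_map_Mul algebra_simps)

lemma horner_coeff_list: "dvars t \<subseteq> {..<Suc n} \<Longrightarrow> peval h y (horner n (coeff_list n t)) = peval h y t"
  by (induction t) (auto simp: horner_ladd horner_lmul less_Suc_eq)

lemma horner_replicate: "peval h y (horner n (replicate m (PConst 0))) = 0"
  by (rule horner_eq_0) auto

end

text \<open>
  The chain rule. The factor of the new variable \<open>y (Suc n)\<close> is the separant, the derivative of the
  polynomial with respect to its variable of highest order.
\<close>
lemma deriv_horner:
  assumes "ring_deriv d" "ring_map h" "\<And>a. d (h a) = h (D a)" "\<And>n. d (y n) = y (Suc n)"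
  shows "d (peval h y (horner n (t # ts))) =
    peval h y (horner n (map (pdiff D) (t # ts))) + y (Suc n) * peval h y (horner n (lderiv 1 ts))"
proof -
  interpret ring_deriv d by fact
  interpret h: ring_map h by fact
  note pdiff = peval_pdiff[where d = d and h = h and D = D and y = y, OF assms(1,3,4)]
  have *: "d (y n ^ Suc k * peval h y (horner n us)) =
     y n ^ Suc k * peval h y (horner n (map (pdiff D) us))
     + y n ^ k * y (Suc n) * peval h y (horner n (lderiv (Suc k) us))" for k us
  proof (induction us arbitrary: k)
    case (Cons u us)
    have "d (y n ^ Suc k * peval h y (horner n (u # us))) =
      d (y n ^ Suc k) * peval h y u + y n ^ Suc k * d (peval h y u)
        + d (y n ^ Suc (Suc k) * peval h y (horner n us))"
    proof -
      have "y n ^ Suc k * peval h y (horner n (u # us)) =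
          y n ^ Suc k * peval h y u + y n ^ Suc (Suc k) * peval h y (horner n us)"
        by (simp add: algebra_simps)
      then show ?thesis by (simp only: add mult[of "y n ^ Suc k" "peval h y u"])
    qed
    also have "\<dots> = y n ^ Suc k * peval h y (horner n (map (pdiff D) (u # us)))
     + y n ^ k * y (Suc n) * peval h y (horner n (lderiv (Suc k) (u # us)))"
      unfolding Cons.IH power assms(4) using pdiff[of u]
      by (simp add: algebra_simps)
    finally show ?case .
  qed simp
  show ?thesis
    using *[of 0 ts] pdiff[of t] by (simp add: algebra_simps)
qed

section \<open>Simple differential extensions of a differentially closed field\<close>

lemma ring_map_ident: "ring_map (\<lambda>a. a)"
  by standard auto

lemmas horner_ident =
  ring_map.horner_append[OF ring_map_ident] ring_map.horner_ladd[OF ring_map_ident]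
  ring_map.horner_map_Mul[OF ring_map_ident] ring_map.horner_replicate[OF ring_map_ident]

locale simple_differential_extension = \<epsilon>: ring_map \<epsilon> + D: ring_deriv D + d: ring_deriv d
  for \<epsilon> :: "'f::field \<Rightarrow> 'l::comm_ring_1"
    and D :: "'f \<Rightarrow> 'f"
    and d :: "'l \<Rightarrow> 'l" +
  fixes w :: 'l
  assumes char_0: "of_nat (Suc n) \<noteq> (0::'f)"
    and d_\<epsilon>: "d (\<epsilon> a) = \<epsilon> (D a)"
    and simple: "0 \<in> J \<Longrightarrow> J \<subseteq> range (peval \<epsilon> (\<lambda>n. (d ^^ n) w)) \<Longrightarrow>
      (\<And>a b. a \<in> J \<Longrightarrow> b \<in> J \<Longrightarrow> a + b \<in> J) \<Longrightarrow>
      (\<And>a t. a \<in> J \<Longrightarrow> peval \<epsilon> (\<lambda>n. (d ^^ n) w) t * a \<in> J) \<Longrightarrow>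
      (\<And>a. a \<in> J \<Longrightarrow> d a \<in> J) \<Longrightarrow> 1 \<notin> J \<Longrightarrow> J = {0}"
begin

abbreviation evw :: "'f dpoly \<Rightarrow> 'l" where
  "evw \<equiv> peval \<epsilon> (\<lambda>n. (d ^^ n) w)"

abbreviation evf :: "'f \<Rightarrow> 'f dpoly \<Rightarrow> 'f" where
  "evf v \<equiv> peval (\<lambda>a. a) (\<lambda>n. (D ^^ n) v)"

lemma evw_pdiff: "evw (pdiff D t) = d (evw t)"
  by (rule peval_pdiff) (simp_all add: d_\<epsilon> d.ring_deriv_axioms)

lemma evf_pdiff: "evf v (pdiff D t) = D (evf v t)"
  by (rule peval_pdiff) (simp_all add: D.ring_deriv_axioms)

text \<open>The values at \<open>w\<close> of the expressions with property \<open>P\<close> form a proper differential ideal.\<close>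
lemma differential_relations_vanish:
  assumes P: "P (PConst 0)" "\<And>s t. P s \<Longrightarrow> P t \<Longrightarrow> P (PAdd s t)" "\<And>s t. P t \<Longrightarrow> P (PMult s t)"
    "\<And>t. P t \<Longrightarrow> P (pdiff D t)" "\<And>t. P t \<Longrightarrow> evw t \<noteq> 1"
    and t: "P t"
  shows "evw t = 0"
proof -
  define J where "J = {evw t |t. P t}"
  have I: "evw t \<in> J" if "P t" for t using that unfolding J_def by blast
  have "J = {0}"
  proof (rule simple)
    show "0 \<in> J" using I[OF P(1)] by simp
    show "a + b \<in> J" if "a \<in> J" "b \<in> J" for a b
    proof -
      from that obtain s t where "a = evw s" "b = evw t" "P s" "P t" unfolding J_def by blast
      then show ?thesis using I[OF P(2)[of s t]] by simp
    qed
    show "evw s * a \<in> J" if "a \<in> J" for a s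
    proof -
      from that obtain t where "a = evw t" "P t" unfolding J_def by blast
      then show ?thesis using I[OF P(3)[of t s]] by simp
    qed
    show "d a \<in> J" if "a \<in> J" for a
    proof -
      from that obtain t where "a = evw t" "P t" unfolding J_def by blast
      then show ?thesis using I[OF P(4)[of t]] by (simp add: evw_pdiff)
    qed
    show "1 \<notin> J" using P(5) unfolding J_def by force
  qed (auto simp: J_def)
  then show ?thesis using I[OF t] by simp
qed

text \<open>
  If every relation of \<open>w\<close> holds at a point \<open>v\<close> of the base, the expressions that vanish at \<open>v\<close>
  give a proper ideal, so they vanish at \<open>w\<close>; one of them is \<open>PVar 0 - v\<close>.
\<close>
lemma specialization:
  assumes "\<And>t. evw t = 0 \<Longrightarrow> evf v t = 0"
  shows "w = \<epsilon> v"
proof -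
  have "evw (PAdd (PVar 0) (PConst (- v))) = 0"
  proof (rule differential_relations_vanish[where P = "\<lambda>t. evf v t = 0"])
    show "evw t \<noteq> 1" if "evf v t = 0" for t
      using assms[of "PAdd t (PConst (- 1))"] that by auto
  qed (simp_all add: evf_pdiff)
  then show ?thesis by simp
qed

text \<open>
  Algebraic independence of \<open>w\<close> and its derivatives of order below \<open>n\<close>. To vanish at every \<open>v\<close>
  replaces being the zero polynomial, which has no meaning for expressions.
\<close>
definition independent :: "nat \<Rightarrow> bool" where
  "independent n \<longleftrightarrow> (\<forall>t. dvars t \<subseteq> {..<n} \<longrightarrow> evw t = 0 \<longrightarrow> (\<forall>v. evf v t = 0))"

definition relation :: "nat \<Rightarrow> 'f dpoly list \<Rightarrow> bool" where
  "relation n ts \<longleftrightarrow> (\<forall>t\<in>set ts. dvars t \<subseteq> {..<n}) \<and> evw (horner n ts) = 0"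

definition nontrivial :: "'f dpoly list \<Rightarrow> bool" where
  "nontrivial ts \<longleftrightarrow> (\<exists>t\<in>set ts. evw t \<noteq> 0)"

text \<open>
  Division by a relation of minimal degree: multiplied by the leading coefficient \<open>c\<close>, a relation
  becomes shorter, and one that is shorter than the minimal one has trivial coefficients.
\<close>

lemma relation_transfer:
  assumes ind: "independent n"
    and rel: "relation n (bs @ [c])"
    and min: "\<And>us. relation n us \<Longrightarrow> nontrivial us \<Longrightarrow> length (bs @ [c]) \<le> length us"
    and v: "evf v (horner n (bs @ [c])) = 0" "evf v c \<noteq> 0"
  shows "relation n us \<Longrightarrow> evf v (horner n us) = 0"
proof (induction "length us" arbitrary: us rule: less_induct)
  case less
  show ?case
  proof (cases "length us \<le> length bs")
    case True
    then have "\<not> nontrivial us" using min[OF less.prems] by auto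
    then have "evf v t = 0" if "t \<in> set us" for t
      using that less.prems ind unfolding nontrivial_def relation_def independent_def by blast
    then show ?thesis by (rule ring_map.horner_eq_0[OF ring_map_ident])
  next
    case False
    then obtain us' u where us: "us = us' @ [u]"
      by (cases us rule: rev_cases) auto
    define m where "m = length us' - length bs"
    have m: "length us' = m + length bs" using False us by (simp add: m_def)
    define r where "r = map (PMult u) bs"
    define xs where "xs = ladd (map (PMult c) us')
      (map (PMult (PConst (- 1))) (replicate m (PConst 0) @ r))"
    have len: "length xs < length us"
      unfolding xs_def r_def length_ladd us length_map length_append length_replicate
      using m by simp
    have W: "evw (horner n xs) = evw c * evw (horner n us)
        - (d ^^ n) w ^ m * evw u * evw (horner n (bs @ [c]))"
      unfolding xs_def us \<epsilon>.horner_ladd \<epsilon>.horner_append \<epsilon>.horner_map_Mul r_def \<epsilon>.horner_replicate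
      by (simp add: m power_add algebra_simps)
    have F: "evf v (horner n xs) = evf v c * evf v (horner n us)
        - (D ^^ n) v ^ m * evf v u * evf v (horner n (bs @ [c]))"
      unfolding xs_def us r_def horner_ident
      by (simp add: m power_add algebra_simps)
    have "relation n xs"
      unfolding relation_def
    proof (intro conjI ballI)
      show "evw (horner n xs) = 0"
        using W less.prems rel unfolding relation_def by simp
      fix t assume "t \<in> set xs"
      then show "dvars t \<subseteq> {..<n}"
        unfolding xs_def
      proof (rule dvars_ladd)
        fix s
        assume "s \<in> set (map (PMult c) us') \<union> set (map (PMult (PConst (- 1))) (replicate m (PConst 0) @ r))"
        then show "dvars s \<subseteq> {..<n}"
          using less.prems rel unfolding relation_def us r_def by (auto simp: subset_iff)
      qed
    qed
    then have "evf v (horner n xs) = 0" using less.hyps len by blast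
    then show ?thesis using F v by simp
  qed
qed

text \<open>
  After multiplication by a power of the separant \<open>S\<close>, every differential polynomial has
  order at most \<open>n\<close>.
\<close>

lemma reduce_order:
  fixes P :: "'f dpoly list"
  assumes "\<forall>t\<in>set (p # P). dvars t \<subseteq> {..<n}"
    and "evw (horner n (p # P)) = 0"
    and "evf v (horner n (p # P)) = 0"
    and S: "S = horner n (lderiv 1 P)"
  shows "\<exists>N u. dvars u \<subseteq> {..<Suc n} \<and> evw u = evw S ^ N * evw t \<and> evf v u = evf v S ^ N * evf v t"
proof -
  have S_vars: "dvars S \<subseteq> {..<Suc n}"
  proof (unfold S, rule dvars_horner)
    fix t assume "t \<in> set (lderiv 1 P)"
    then show "dvars t \<subseteq> {..<n}" using dvars_lderiv assms(1) by fastforce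
  qed
  define T where "T = PMult (PConst (- 1)) (horner n (map (pdiff D) (p # P)))"
  have T_vars: "dvars T \<subseteq> {..<Suc n}"
  proof -
    have *: "dvars (horner n ts) \<subseteq> {..<Suc n}" if "\<forall>t\<in>set ts. dvars t \<subseteq> {..<Suc n}"
      for ts :: "'f dpoly list"
      using that by (induction ts) auto
    have "\<forall>t\<in>set (map (pdiff D) (p # P)). dvars t \<subseteq> {..<Suc n}"
      using assms(1) dvars_pdiff by (metis (mono_tags, lifting) imageE list.set_map)
    from *[OF this] show ?thesis by (simp add: T_def)
  qed
  have T: "evw T = (d ^^ Suc n) w * evw S" "evf v T = (D ^^ Suc n) v * evf v S"
  proof -
    have "0 = d (evw (horner n (p # P)))" by (simp only: assms(2) d.zero)
    also have "\<dots> = evw (horner n (map (pdiff D) (p # P))) + (d ^^ Suc n) w * evw (horner n (lderiv 1 P))"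
      by (rule deriv_horner) (simp_all add: d.ring_deriv_axioms \<epsilon>.ring_map_axioms d_\<epsilon>)
    finally show "evw T = (d ^^ Suc n) w * evw S"
      unfolding T_def S by (simp del: horner.simps list.map add: neg_eq_iff_add_eq_0)
    have "0 = D (evf v (horner n (p # P)))" by (simp only: assms(3) D.zero)
    also have "\<dots> = evf v (horner n (map (pdiff D) (p # P))) + (D ^^ Suc n) v * evf v (horner n (lderiv 1 P))"
      by (rule deriv_horner) (simp_all add: D.ring_deriv_axioms ring_map_ident)
    finally show "evf v T = (D ^^ Suc n) v * evf v S"
      unfolding T_def S by (simp del: horner.simps list.map add: neg_eq_iff_add_eq_0)
  qed
  have step: "\<exists>u'. dvars u' \<subseteq> {..<Suc n} \<and> evw u' = evw S * d (evw u)
      \<and> evf v u' = evf v S * D (evf v u)" if "dvars u \<subseteq> {..<Suc n}" for u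
    using that
  proof (induction u)
    case (PConst a)
    show ?case by (rule exI[of _ "PMult S (PConst (D a))"]) (use S_vars in \<open>simp add: d_\<epsilon>\<close>)
  next
    case (PVar i)
    then consider "i < n" | "i = n" by (auto simp: less_Suc_eq)
    then show ?case
    proof cases
      case 1
      show ?thesis by (rule exI[of _ "PMult S (PVar (Suc i))"]) (use 1 S_vars in simp)
    next
      case 2
      show ?thesis
        by (rule exI[of _ T]) (use 2 T_vars T in \<open>simp add: mult.commute\<close>)
    qed
  next
    case (PAdd s t)
    then obtain s' t' where
      "dvars s' \<subseteq> {..<Suc n}" "evw s' = evw S * d (evw s)" "evf v s' = evf v S * D (evf v s)"
      "dvars t' \<subseteq> {..<Suc n}" "evw t' = evw S * d (evw t)" "evf v t' = evf v S * D (evf v t)"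
      by auto
    then show ?case
      by (intro exI[of _ "PAdd s' t'"]) (simp add: algebra_simps)
  next
    case (PMult s t)
    then obtain s' t' where
      "dvars s' \<subseteq> {..<Suc n}" "evw s' = evw S * d (evw s)" "evf v s' = evf v S * D (evf v s)"
      "dvars t' \<subseteq> {..<Suc n}" "evw t' = evw S * d (evw t)" "evf v t' = evf v S * D (evf v t)"
      by auto
    then show ?case using PMult.prems
      by (intro exI[of _ "PAdd (PMult s' t) (PMult s t')"]) (simp add: algebra_simps)
  qed
  have var: "\<exists>N u. dvars u \<subseteq> {..<Suc n} \<and> evw u = evw S ^ N * (d ^^ i) w
      \<and> evf v u = evf v S ^ N * (D ^^ i) v" for i
  proof (induction i)
    case 0
    show ?case by (intro exI[of _ 0] exI[of _ "PVar 0"]) simp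
  next
    case (Suc i)
    then obtain N u where u: "dvars u \<subseteq> {..<Suc n}" "evw u = evw S ^ N * (d ^^ i) w"
      "evf v u = evf v S ^ N * (D ^^ i) v" by blast
    obtain u' where u': "dvars u' \<subseteq> {..<Suc n}" "evw u' = evw S * d (evw u)"
      "evf v u' = evf v S * D (evf v u)" using step[OF u(1)] by blast
    obtain s where s: "dvars s \<subseteq> {..<Suc n}" "evw s = evw S * d (evw S)"
      "evf v s = evf v S * D (evf v S)" using step[OF S_vars] by blast
    show ?case
    proof (cases N)
      case 0
      then show ?thesis using u' u by (intro exI[of _ 1] exI[of _ u']) simp
    next
      case N: (Suc M)
      define r where "r = PAdd (PMult S u') (PMult (PConst (- of_nat N)) (PMult s u))"
      have "evw r = evw S ^ (N + 2) * (d ^^ Suc i) w"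
        unfolding r_def by (simp add: u(2) u'(2) s(2) N d.power algebra_simps del: of_nat_Suc power_Suc)
           (simp add: algebra_simps)
      moreover have "evf v r = evf v S ^ (N + 2) * (D ^^ Suc i) v"
        unfolding r_def by (simp add: u(3) u'(3) s(3) N D.power algebra_simps del: of_nat_Suc power_Suc)
           (simp add: algebra_simps)
      moreover have "dvars r \<subseteq> {..<Suc n}"
        using u(1) u'(1) s(1) S_vars by (simp add: r_def)
      ultimately show ?thesis by blast
    qed
  qed
  show ?thesis
  proof (induction t)
    case (PConst a)
    show ?case by (intro exI[of _ 0] exI[of _ "PConst a"]) simp
  next
    case (PVar i)
    show ?case using var[of i] by simp
  next
    case (PAdd s t)
    then obtain N M s' t' where *:
      "dvars s' \<subseteq> {..<Suc n}" "evw s' = evw S ^ N * evw s" "evf v s' = evf v S ^ N * evf v s"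
      "dvars t' \<subseteq> {..<Suc n}" "evw t' = evw S ^ M * evw t" "evf v t' = evf v S ^ M * evf v t"
      by auto
    define pow where "pow k = (PMult S ^^ k)" for k
    have pow: "evw (pow k u) = evw S ^ k * evw u" "evf v (pow k u) = evf v S ^ k * evf v u"
      "dvars u \<subseteq> {..<Suc n} \<Longrightarrow> dvars (pow k u) \<subseteq> {..<Suc n}" for k u
      by (induction k) (use S_vars in \<open>simp_all add: pow_def algebra_simps\<close>)
    show ?case
      by (rule exI[of _ "N + M"], rule exI[of _ "PAdd (pow M s') (pow N t')"])
        (use * in \<open>simp add: pow power_add algebra_simps\<close>)
  next
    case (PMult s t)
    then obtain N M s' t' where *:
      "dvars s' \<subseteq> {..<Suc n}" "evw s' = evw S ^ N * evw s" "evf v s' = evf v S ^ N * evf v s"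
      "dvars t' \<subseteq> {..<Suc n}" "evw t' = evw S ^ M * evw t" "evf v t' = evf v S ^ M * evf v t"
      by auto
    show ?case
      by (rule exI[of _ "N + M"], rule exI[of _ "PMult s' t'"])
        (use * in \<open>simp add: power_add algebra_simps\<close>)
  qed
qed

text \<open>
  Let \<open>n\<close> be the order of the relation of least order of \<open>w\<close>, and take one of least degree in the
  \<open>n\<close>-th derivative. A point \<open>v\<close> at which it holds, while its separant and its leading coefficient
  do not vanish, satisfies all relations of \<open>w\<close>: multiplied by a power of the separant, a relation
  has order at most \<open>n\<close>, and multiplied by a power of the leading coefficient it is divisible by
  the chosen one.
\<close>
theorem generator_in_base:
  assumes closed: "\<And>p s c. evw p = 0 \<Longrightarrow> evw s \<noteq> 0 \<Longrightarrow> evw c \<noteq> 0 \<Longrightarrow>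
    \<exists>v. evf v p = 0 \<and> evf v s \<noteq> 0 \<and> evf v c \<noteq> 0"
  shows "w \<in> range \<epsilon>"
proof (cases "\<forall>n. independent n")
  case True
  have "evf 0 t = 0" if "evw t = 0" for t
  proof -
    have "finite (dvars t)" by (induction t) auto
    then obtain n where "\<forall>k\<in>dvars t. k < n" by (metis finite_nat_set_iff_bounded)
    then have "dvars t \<subseteq> {..<n}" by auto
    then show ?thesis using True that unfolding independent_def by blast
  qed
  then show ?thesis using specialization by blast
next
  case False
  have "independent 0"
    unfolding independent_def
  proof (intro allI impI)
    fix t v assume "dvars t \<subseteq> {..<0::nat}" "evw t = 0"
    moreover have "dvars t \<subseteq> {..<0} \<Longrightarrow> evw t = \<epsilon> (evf v t)" by (induction t) simp_all
    ultimately show "evf v t = 0"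
      using ring_map_eq_0_iff[OF \<epsilon>.ring_map_axioms] by simp
  qed
  moreover obtain m where "\<not> independent m" using False by blast
  ultimately obtain n where n: "independent n" "\<not> independent (Suc n)"
    by (metis nat_induct)
  then obtain t v where t: "dvars t \<subseteq> {..<Suc n}" "evw t = 0" "evf v t \<noteq> 0"
    unfolding independent_def by blast
  have "relation n (coeff_list n t)"
    using t dvars_coeff_list[OF t(1)] \<epsilon>.horner_coeff_list[OF t(1)] by (simp add: relation_def)
  moreover have "nontrivial (coeff_list n t)"
  proof (rule ccontr)
    assume "\<not> nontrivial (coeff_list n t)"
    then have "evf v u = 0" if "u \<in> set (coeff_list n t)" for u
      using that n(1) dvars_coeff_list[OF t(1)] unfolding independent_def nontrivial_def by blast
    then show False using ring_map.horner_eq_0[OF ring_map_ident] ring_map.horner_coeff_list[OF ring_map_ident t(1)] t(3) by metis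
  qed
  ultimately obtain ts where ts: "relation n ts" "nontrivial ts"
    and min: "\<And>us. relation n us \<Longrightarrow> nontrivial us \<Longrightarrow> length ts \<le> length us"
    using exists_least_iff[of "\<lambda>k. \<exists>ts. relation n ts \<and> nontrivial ts \<and> length ts = k"]
    by (metis leI)
  then obtain bs c where bs: "ts = bs @ [c]"
    unfolding nontrivial_def by (cases ts rule: rev_cases) auto
  have c: "evw c \<noteq> 0"
  proof
    assume "evw c = 0"
    then have "relation n bs" "nontrivial bs"
      using ts unfolding bs relation_def nontrivial_def by (auto simp: \<epsilon>.horner_append)
    then show False using min[of bs] by (simp add: bs)
  qed
  obtain p P where P: "ts = p # P" by (cases ts) (auto simp: bs)
  define S where "S = horner n (lderiv 1 P)"
  have "P \<noteq> []"
    using c ts(1) P bs by (auto simp: relation_def)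
  then obtain P' where P': "P = P' @ [c]" "bs = p # P'"
    using P bs by (cases P rule: rev_cases) auto
  have S: "evw S \<noteq> 0"
  proof
    assume "evw S = 0"
    then have "relation n (lderiv 1 P)"
      using ts(1) dvars_lderiv[of _ 1 P] unfolding relation_def S_def P by fastforce
    moreover have "nontrivial (lderiv 1 P)"
    proof -
      have "evw (PMult (PConst (of_nat (Suc (length P')))) c) \<noteq> 0"
      proof
        assume "evw (PMult (PConst (of_nat (Suc (length P')))) c) = 0"
        then have "\<epsilon> (inverse (of_nat (Suc (length P')))) * (\<epsilon> (of_nat (Suc (length P'))) * evw c) = 0"
          by simp
        then have "\<epsilon> (inverse (of_nat (Suc (length P'))) * of_nat (Suc (length P'))) * evw c = 0"
          by (simp only: \<epsilon>.mult mult.assoc)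
        then show False using c char_0[of "length P'"] by (simp del: of_nat_Suc)
      qed
      then show ?thesis unfolding nontrivial_def P' lderiv_append by auto
    qed
    ultimately show False using min[of "lderiv 1 P"] by (simp add: P)
  qed
  obtain v where v: "evf v (horner n ts) = 0" "evf v S \<noteq> 0" "evf v c \<noteq> 0"
    using closed[of "horner n ts" S c] ts(1) S c unfolding relation_def by blast
  have "evf v t = 0" if "evw t = 0" for t
  proof -
    obtain N u where u: "dvars u \<subseteq> {..<Suc n}" "evw u = evw S ^ N * evw t" "evf v u = evf v S ^ N * evf v t"
      using reduce_order[of p P n v S t] ts(1) v(1) unfolding relation_def P S_def by blast
    have "relation n (coeff_list n u)"
      using that dvars_coeff_list[OF u(1)] u(2) \<epsilon>.horner_coeff_list[OF u(1)] by (simp add: relation_def)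
    then have "evf v (horner n (coeff_list n u)) = 0"
      using relation_transfer[OF n(1), of bs c v] ts(1) min v unfolding bs by blast
    then show ?thesis using u(3) v(2) ring_map.horner_coeff_list[OF ring_map_ident u(1)] by simp
  qed
  then show ?thesis using specialization by blast
qed

end

section \<open>A residue field of a ring\<close>

definition proper_ideal :: "'a::comm_ring_1 set \<Rightarrow> bool" where
  "proper_ideal I \<longleftrightarrow> 0 \<in> I \<and> 1 \<notin> I \<and> (\<forall>x\<in>I. \<forall>y\<in>I. x + y \<in> I) \<and> (\<forall>x\<in>I. \<forall>a. a * x \<in> I)"

definition some_maximal_ideal :: "'a::comm_ring_1 set" where
  "some_maximal_ideal = (SOME M. proper_ideal M \<and> (\<forall>N. proper_ideal N \<longrightarrow> M \<subseteq> N \<longrightarrow> N = M))"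

lemma some_maximal_ideal:
  fixes N :: "'a::comm_ring_1 set"
  shows "proper_ideal (some_maximal_ideal :: 'a set)"
    and "proper_ideal N \<Longrightarrow> some_maximal_ideal \<subseteq> N \<Longrightarrow> N = some_maximal_ideal"
proof -
  have "\<exists>M\<in>Collect proper_ideal. \<forall>X\<in>Collect proper_ideal. M \<subseteq> X \<longrightarrow> X = M"
  proof (rule subset_Zorn_nonempty)
    have "proper_ideal {0}" by (simp add: proper_ideal_def)
    then show "Collect proper_ideal \<noteq> {}" by auto
    fix \<C> assume C: "\<C> \<noteq> {}" "subset.chain (Collect proper_ideal) \<C>"
    then have ideals: "I \<in> \<C> \<Longrightarrow> proper_ideal I" for I by (auto simp: subset.chain_def)
    have "x + y \<in> \<Union>\<C>" if "x \<in> \<Union>\<C>" "y \<in> \<Union>\<C>" for x y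
    proof -
      from that obtain I J where IJ: "I \<in> \<C>" "x \<in> I" "J \<in> \<C>" "y \<in> J" by blast
      then have "I \<subseteq> J \<or> J \<subseteq> I" using C(2) by (auto simp: subset_chain_def)
      then show ?thesis using IJ ideals unfolding proper_ideal_def by blast
    qed
    then show "\<Union>\<C> \<in> Collect proper_ideal"
      using C(1) ideals unfolding proper_ideal_def by blast
  qed
  then have "\<exists>M::'a set. proper_ideal M \<and> (\<forall>N. proper_ideal N \<longrightarrow> M \<subseteq> N \<longrightarrow> N = M)" by blast
  from someI_ex[OF this] show
    "proper_ideal (some_maximal_ideal :: 'a set)"
    "proper_ideal N \<Longrightarrow> some_maximal_ideal \<subseteq> N \<Longrightarrow> N = some_maximal_ideal"
    unfolding some_maximal_ideal_def by blast+
qed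

lemma some_maximal_ideal_closed:
  "0 \<in> some_maximal_ideal" "1 \<notin> some_maximal_ideal"
  "x \<in> some_maximal_ideal \<Longrightarrow> y \<in> some_maximal_ideal \<Longrightarrow> x + y \<in> some_maximal_ideal"
  "x \<in> some_maximal_ideal \<Longrightarrow> a * x \<in> some_maximal_ideal"
  using some_maximal_ideal(1) unfolding proper_ideal_def by blast+

lemma some_maximal_ideal_diff:
  "x \<in> some_maximal_ideal \<Longrightarrow> y \<in> some_maximal_ideal \<Longrightarrow> x - y \<in> some_maximal_ideal"
  using some_maximal_ideal_closed(3)[of x "- y"] some_maximal_ideal_closed(4)[of y "- 1"] by simp

lemma some_maximal_ideal_inverse:
  assumes "x \<notin> some_maximal_ideal"
  shows "\<exists>y. x * y - 1 \<in> some_maximal_ideal"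
proof (rule ccontr)
  assume neg: "\<nexists>y. x * y - 1 \<in> some_maximal_ideal"
  define N where "N = {m + x * y |m y. m \<in> some_maximal_ideal}"
  have "proper_ideal N"
    unfolding proper_ideal_def
  proof (intro conjI ballI allI)
    show "0 \<in> N"
      unfolding N_def by (rule CollectI, rule exI[of _ 0], rule exI[of _ 0])
        (simp add: some_maximal_ideal_closed)
    show "1 \<notin> N"
    proof
      assume "1 \<in> N"
      then obtain m y where m: "m \<in> some_maximal_ideal" "1 = m + x * y" unfolding N_def by blast
      then have "x * y - 1 = (- 1) * m" by (simp add: algebra_simps)
      then show False using neg some_maximal_ideal_closed(4)[OF m(1)] by metis
    qed
    fix a assume "a \<in> N"
    then obtain m y where a: "m \<in> some_maximal_ideal" "a = m + x * y" unfolding N_def by blast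
    show "b * a \<in> N" for b
      unfolding N_def a(2)
      by (rule CollectI, rule exI[of _ "b * m"], rule exI[of _ "b * y"])
        (simp add: a some_maximal_ideal_closed algebra_simps)
    fix b assume "b \<in> N"
    then obtain m' y' where b: "m' \<in> some_maximal_ideal" "b = m' + x * y'" unfolding N_def by blast
    show "a + b \<in> N"
      unfolding N_def a(2) b(2)
      by (rule CollectI, rule exI[of _ "m + m'"], rule exI[of _ "y + y'"])
        (simp add: a b some_maximal_ideal_closed algebra_simps)
  qed
  moreover have "some_maximal_ideal \<subseteq> N"
    unfolding N_def by (intro subsetI CollectI, rule exI, rule exI[of _ 0]) simp
  ultimately have "N = some_maximal_ideal" by (rule some_maximal_ideal(2))
  moreover have "x \<in> N"
    unfolding N_def by (rule CollectI, rule exI[of _ 0], rule exI[of _ 1])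
      (simp add: some_maximal_ideal_closed)
  ultimately show False using assms by simp
qed

definition residue_rel :: "'a::comm_ring_1 \<Rightarrow> 'a \<Rightarrow> bool" where
  "residue_rel x y \<longleftrightarrow> x - y \<in> some_maximal_ideal"

text \<open>
  One maximal ideal is chosen for each ring type, so that the residue field is a type constructor
  with values in the class of fields. The ring that is embedded into a field below is a subring
  of a type that need not be an integral domain, and has to be mapped to a field first.
\<close>
quotient_type (overloaded) 'a residue = "'a::comm_ring_1" / residue_rel
proof (rule equivpI)
  show "reflp (residue_rel :: 'a \<Rightarrow> _)"
    by (simp add: reflp_def residue_rel_def some_maximal_ideal_closed)
  show "symp (residue_rel :: 'a \<Rightarrow> _)"
    unfolding symp_def residue_rel_def
    using some_maximal_ideal_diff[OF some_maximal_ideal_closed(1)] by fastforce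
  show "transp (residue_rel :: 'a \<Rightarrow> _)"
    unfolding transp_def residue_rel_def using some_maximal_ideal_closed(3) by fastforce
qed

instantiation residue :: (comm_ring_1) field
begin

lift_definition zero_residue :: "'a residue" is 0 .
lift_definition one_residue :: "'a residue" is 1 .
lift_definition uminus_residue :: "'a residue \<Rightarrow> 'a residue" is uminus
  unfolding residue_rel_def using some_maximal_ideal_closed(4)[of _ "- 1"] by fastforce
lift_definition plus_residue :: "'a residue \<Rightarrow> 'a residue \<Rightarrow> 'a residue" is "(+)"
  unfolding residue_rel_def using some_maximal_ideal_closed(3) by (fastforce simp: add_diff_add)
lift_definition minus_residue :: "'a residue \<Rightarrow> 'a residue \<Rightarrow> 'a residue" is "(-)"
  unfolding residue_rel_def using some_maximal_ideal_diff by (fastforce simp: algebra_simps)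
lift_definition times_residue :: "'a residue \<Rightarrow> 'a residue \<Rightarrow> 'a residue" is "(*)"
proof -
  fix a b c d :: 'a
  assume "residue_rel a b" "residue_rel c d"
  then have "c * (a - b) + b * (c - d) \<in> some_maximal_ideal"
    unfolding residue_rel_def by (intro some_maximal_ideal_closed)
  then show "residue_rel (a * c) (b * d)"
    unfolding residue_rel_def by (simp add: algebra_simps)
qed

definition inverse_residue :: "'a residue \<Rightarrow> 'a residue" where
  "inverse_residue x = (if x = 0 then 0 else SOME y. y * x = 1)"

definition divide_residue :: "'a residue \<Rightarrow> 'a residue \<Rightarrow> 'a residue" where
  "divide_residue x y = x * inverse y"

instance
proof
  fix a b c :: "'a residue"
  show "a * b * c = a * (b * c)"
    by transfer (simp add: residue_rel_def some_maximal_ideal_closed algebra_simps)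
  show "a * b = b * a"
    by transfer (simp add: residue_rel_def some_maximal_ideal_closed algebra_simps)
  show "1 * a = a"
    by transfer (simp add: residue_rel_def some_maximal_ideal_closed)
  show "a + b + c = a + (b + c)"
    by transfer (simp add: residue_rel_def some_maximal_ideal_closed algebra_simps)
  show "a + b = b + a"
    by transfer (simp add: residue_rel_def some_maximal_ideal_closed algebra_simps)
  show "0 + a = a"
    by transfer (simp add: residue_rel_def some_maximal_ideal_closed)
  show "- a + a = 0"
    by transfer (simp add: residue_rel_def some_maximal_ideal_closed)
  show "a - b = a + - b"
    by transfer (simp add: residue_rel_def some_maximal_ideal_closed)
  show "(a + b) * c = a * c + b * c"
    by transfer (simp add: residue_rel_def some_maximal_ideal_closed algebra_simps)
  show "(0::'a residue) \<noteq> 1"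
    by transfer (use some_maximal_ideal_closed(2) some_maximal_ideal_diff[OF some_maximal_ideal_closed(1)]
      in \<open>fastforce simp: residue_rel_def\<close>)
  show "a div b = a * inverse b" by (simp add: divide_residue_def)
  show "inverse (0::'a residue) = 0" by (simp add: inverse_residue_def)
  show "inverse a * a = 1" if "a \<noteq> 0"
  proof -
    have "\<exists>y. y * a = 1"
      using that
    proof transfer
      fix a :: 'a
      assume "\<not> residue_rel a 0"
      then show "\<exists>y. residue_rel (y * a) 1"
        using some_maximal_ideal_inverse[of a] by (simp add: residue_rel_def mult.commute)
    qed
    from someI_ex[OF this] that show ?thesis by (simp add: inverse_residue_def)
  qed
qed

end

lemma ring_map_residue: "ring_map abs_residue"
  by standard (simp_all add: one_residue.abs_eq plus_residue.abs_eq times_residue.abs_eq)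

section \<open>Taylor series\<close>

definition rational_algebra :: "'a::comm_ring_1 itself \<Rightarrow> bool" where
  "rational_algebra _ \<longleftrightarrow> (\<forall>n. of_nat (Suc n) dvd (1::'a))"

definition inv_Suc :: "nat \<Rightarrow> 'a::comm_ring_1" where
  "inv_Suc n = (SOME u. of_nat (Suc n) * u = 1)"

lemma inv_Suc: "of_nat (Suc n) * inv_Suc n = (1::'a::comm_ring_1)" if "rational_algebra TYPE('a)"
  using that someI_ex[of "\<lambda>u::'a. of_nat (Suc n) * u = 1"]
  unfolding rational_algebra_def inv_Suc_def dvd_def by metis

lemma of_nat_Suc_cancel: "x = y"
  if "rational_algebra TYPE('a)" "of_nat (Suc n) * x = of_nat (Suc n) * (y::'a::comm_ring_1)"
proof -
  have "x = inv_Suc n * (of_nat (Suc n) * x)" for x :: 'a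
    using inv_Suc[OF that(1), of n] by (metis mult.assoc mult.commute mult_1)
  then show ?thesis using that(2) by metis
qed

lemma rational_algebra_fps: "rational_algebra TYPE('a fps)"
  if "rational_algebra TYPE('a::comm_ring_1)"
proof -
  have "of_nat (Suc n) * fps_const (inv_Suc n) = (1::'a fps)" for n
    using inv_Suc[OF that, of n] by (simp add: fps_of_nat[symmetric] del: of_nat_Suc)
  then show ?thesis unfolding rational_algebra_def dvd_def by metis
qed

lemma rational_algebra_field:
  "rational_algebra TYPE('a) \<longleftrightarrow> (\<forall>n. of_nat (Suc n) \<noteq> (0::'a::field))"
  by (simp add: rational_algebra_def dvd_field_iff)

lemma rational_algebra_ring_map:
  assumes "rational_algebra TYPE('a)" "ring_map (h :: 'a::comm_ring_1 \<Rightarrow> 'b::comm_ring_1)"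
  shows "rational_algebra TYPE('b)"
proof -
  interpret ring_map h by fact
  have "of_nat (Suc n) * h (inv_Suc n) = 1" for n
    using inv_Suc[OF assms(1), of n] by (metis mult of_nat one)
  then show ?thesis unfolding rational_algebra_def dvd_def by metis
qed

text \<open>
  Two solutions of the same differential equation with the same initial value are equal. The
  derivatives of one pair may involve other pairs, hence the family \<open>P\<close>.
\<close>
lemma fps_eqI_deriv:
  fixes P :: "('a::comm_ring_1 fps \<times> 'a fps) set"
  assumes "rational_algebra TYPE('a)"
    and "(f, g) \<in> P"
    and "\<And>f g. (f, g) \<in> P \<Longrightarrow> f $ 0 = g $ 0"
    and "\<And>f g n. (f, g) \<in> P \<Longrightarrow> (\<And>f g. (f, g) \<in> P \<Longrightarrow> \<forall>i\<le>n. f $ i = g $ i) \<Longrightarrow>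
      fps_deriv f $ n = fps_deriv g $ n"
  shows "f = g"
proof -
  have "\<forall>(f, g)\<in>P. \<forall>i\<le>n. f $ i = g $ i" for n
  proof (induction n)
    case 0
    show ?case using assms(3) by auto
  next
    case (Suc n)
    have "f $ Suc n = g $ Suc n" if "(f, g) \<in> P" for f g
    proof (rule of_nat_Suc_cancel[OF assms(1)])
      show "of_nat (Suc n) * f $ Suc n = of_nat (Suc n) * g $ Suc n"
        using assms(4)[OF that, of n] Suc by fastforce
    qed
    then show ?case using Suc by (auto simp: le_Suc_eq)
  qed
  then show ?thesis using assms(2) by (intro fps_ext) blast
qed

definition taylor :: "('r \<Rightarrow> 'a::comm_ring_1) \<Rightarrow> ('r \<Rightarrow> 'r) \<Rightarrow> 'r \<Rightarrow> 'a fps" where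
  "taylor h d a = Abs_fps (\<lambda>n. (\<Prod>k<n. inv_Suc k) * h ((d ^^ n) a))"

lemma taylor_nth_0 [simp]: "taylor h d a $ 0 = h a"
  by (simp add: taylor_def)

lemma taylor_deriv: "fps_deriv (taylor h d a) = taylor h d (d a)"
  if "rational_algebra TYPE('a)" for h :: "'r \<Rightarrow> 'a::comm_ring_1"
proof (rule fps_ext)
  fix n
  have "fps_deriv (taylor h d a) $ n =
      (of_nat (Suc n) * inv_Suc n) * ((\<Prod>k<n. inv_Suc k) * h ((d ^^ Suc n) a))"
    by (simp add: taylor_def algebra_simps)
  then show "fps_deriv (taylor h d a) $ n = taylor h d (d a) $ n"
    unfolding inv_Suc[OF that] by (simp add: taylor_def funpow_swap1)
qed

text \<open>
  By the Leibniz rule the series of \<open>a b\<close> and the product of the series of \<open>a\<close> and \<open>b\<close> solve the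
  same differential equation. This takes the place of a computation with binomial coefficients.
\<close>
lemma ring_map_taylor:
  fixes h :: "'r::comm_ring_1 \<Rightarrow> 'a::comm_ring_1"
  assumes "rational_algebra TYPE('a)" "ring_map h" "ring_deriv d"
  shows "ring_map (taylor h d)"
proof -
  interpret ring_map h by fact
  interpret d: ring_deriv d by fact
  have iter: "(d ^^ n) (a + b) = (d ^^ n) a + (d ^^ n) b" "(d ^^ n) 0 = 0" for n a b
    by (induction n) simp_all
  have iter_one: "(d ^^ Suc n) 1 = 0" for n
    by (simp add: funpow_swap1 iter)
  have add: "taylor h d (a + b) = taylor h d a + taylor h d b" for a b
    by (rule fps_ext) (simp add: taylor_def iter algebra_simps)
  have "taylor h d 1 $ n = 1 $ n" for n
    by (cases n) (simp_all add: taylor_def iter_one del: funpow.simps)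
  then have one: "taylor h d 1 = 1" by (rule fps_ext)
  have mult: "taylor h d (a * b) = taylor h d a * taylor h d b" for a b
  proof (rule fps_eqI_deriv[OF assms(1), where P = "{(taylor h d (a * b), taylor h d a * taylor h d b) |a b. True}"])
    fix f g n
    assume "(f, g) \<in> {(taylor h d (a * b), taylor h d a * taylor h d b) |a b. True}"
    then obtain a b where fg: "f = taylor h d (a * b)" "g = taylor h d a * taylor h d b" by blast
    assume "\<And>f g. (f, g) \<in> {(taylor h d (a * b), taylor h d a * taylor h d b) |a b. True} \<Longrightarrow>
      \<forall>i\<le>n. f $ i = g $ i"
    then have IH: "taylor h d (a * b) $ n = (taylor h d a * taylor h d b) $ n" for a b by blast
    show "fps_deriv f $ n = fps_deriv g $ n"
      unfolding fg by (simp add: taylor_deriv[OF assms(1)] add IH del: fps_deriv_nth)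
  qed auto
  show ?thesis by standard (rule one add mult)+
qed

section \<open>Extending a derivation to a larger field\<close>

text \<open>
  Graphs of derivations that are defined on a subring and take values in the whole field; Zorn's
  lemma applies to their inclusion. Since a maximal one is defined everywhere, closure under
  inverses does not have to be maintained.
\<close>
definition deriv_graph :: "('k::field \<times> 'k) set \<Rightarrow> bool" where
  "deriv_graph G \<longleftrightarrow> (1, 0) \<in> G \<and>
     (\<forall>a a' b b'. (a, a') \<in> G \<longrightarrow> (b, b') \<in> G \<longrightarrow> (a + b, a' + b') \<in> G \<and>
        (a * b, a' * b + a * b') \<in> G \<and> (- a, - a') \<in> G) \<and>
     (\<forall>b. (0, b) \<in> G \<longrightarrow> b = 0)"

lemma deriv_graphD:
  assumes "deriv_graph G"
  shows "(1, 0) \<in> G" "(0, 0) \<in> G"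
    "(a, a') \<in> G \<Longrightarrow> (b, b') \<in> G \<Longrightarrow> (a + b, a' + b') \<in> G"
    "(a, a') \<in> G \<Longrightarrow> (b, b') \<in> G \<Longrightarrow> (a * b, a' * b + a * b') \<in> G"
    "(a, a') \<in> G \<Longrightarrow> (- a, - a') \<in> G"
    "(0, b) \<in> G \<Longrightarrow> b = 0"
    "(a, a') \<in> G \<Longrightarrow> (a, b') \<in> G \<Longrightarrow> a' = b'"
proof -
  note G = assms[unfolded deriv_graph_def]
  show 1: "(1, 0) \<in> G" and add: "(a, a') \<in> G \<Longrightarrow> (b, b') \<in> G \<Longrightarrow> (a + b, a' + b') \<in> G"
    and "(a, a') \<in> G \<Longrightarrow> (b, b') \<in> G \<Longrightarrow> (a * b, a' * b + a * b') \<in> G"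
    and neg: "(a, a') \<in> G \<Longrightarrow> (- a, - a') \<in> G"
    and zero: "(0, b) \<in> G \<Longrightarrow> b = 0" for a a' b b'
    using G by blast+
  show "(0, 0) \<in> G" using add[OF 1 neg[OF 1]] by simp
  show "a' = b'" if "(a, a') \<in> G" "(a, b') \<in> G"
    using zero add[OF that(1) neg[OF that(2)]] by fastforce
qed

lemma deriv_graph_sum:
  assumes "deriv_graph G" "\<And>i. i \<in> I \<Longrightarrow> (f i, g i) \<in> G"
  shows "(sum f I, sum g I) \<in> G"
  using assms(2)
  by (induction I rule: infinite_finite_induct) (auto intro: deriv_graphD[OF assms(1)])

text \<open>
  The graph of a derivation that is extended to \<open>G[a]\<close> with value \<open>e\<close> at \<open>a\<close>; a pair \<open>(P, P')\<close>
  represents a polynomial and the polynomial of the derivatives of its coefficients.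
\<close>

definition poly_pair :: "('k::field \<times> 'k) set \<Rightarrow> 'k poly \<Rightarrow> 'k poly \<Rightarrow> bool" where
  "poly_pair G P P' \<longleftrightarrow> (\<forall>k. (poly.coeff P k, poly.coeff P' k) \<in> G)"

definition adjoin :: "('k::field \<times> 'k) set \<Rightarrow> 'k \<Rightarrow> 'k \<Rightarrow> ('k \<times> 'k) set" where
  "adjoin G a e = {(poly P a, poly P' a + poly (pderiv P) a * e) |P P'. poly_pair G P P'}"

lemma poly_pair_mult:
  assumes "deriv_graph G" "poly_pair G P P'" "poly_pair G Q Q'"
  shows "poly_pair G (P * Q) (P' * Q + P * Q')"
  unfolding poly_pair_def
proof
  fix k
  have "(\<Sum>i\<le>k. poly.coeff P i * poly.coeff Q (k - i),
      \<Sum>i\<le>k. poly.coeff P' i * poly.coeff Q (k - i) + poly.coeff P i * poly.coeff Q' (k - i)) \<in> G"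
    using assms(2,3) unfolding poly_pair_def
    by (intro deriv_graph_sum[OF assms(1)] deriv_graphD(4)[OF assms(1)]) auto
  then show "(poly.coeff (P * Q) k, poly.coeff (P' * Q + P * Q') k) \<in> G"
    by (simp add: coeff_mult sum.distrib)
qed

lemma poly_pair_add:
  "deriv_graph G \<Longrightarrow> poly_pair G P P' \<Longrightarrow> poly_pair G Q Q' \<Longrightarrow> poly_pair G (P + Q) (P' + Q')"
  unfolding poly_pair_def by (auto intro: deriv_graphD(3))

lemma poly_pair_minus: "deriv_graph G \<Longrightarrow> poly_pair G P P' \<Longrightarrow> poly_pair G (- P) (- P')"
  unfolding poly_pair_def by (auto intro: deriv_graphD(5))

lemma poly_pair_monom:
  "deriv_graph G \<Longrightarrow> (c, c') \<in> G \<Longrightarrow> poly_pair G (Polynomial.monom c n) (Polynomial.monom c' n)"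
  unfolding poly_pair_def by (auto intro: deriv_graphD(2))

text \<open>
  If \<open>a\<close> satisfies no polynomial relation over the domain of the derivation, any value \<open>e\<close>
  will do; otherwise \<open>e\<close> is forced by a relation \<open>P\<close> of minimal degree, whose derivative does not
  vanish at \<open>a\<close> in characteristic \<open>0\<close>.
\<close>

lemma deriv_graph_extend:
  fixes a :: "'k::field"
  assumes G: "deriv_graph G" and char_0: "\<And>n. of_nat (Suc n) \<noteq> (0::'k)"
  shows "\<exists>e. \<forall>Q Q'. poly_pair G Q Q' \<longrightarrow> poly Q a = 0 \<longrightarrow> poly Q' a + poly (pderiv Q) a * e = 0"
proof (cases "\<exists>P P'. poly_pair G P P' \<and> P \<noteq> 0 \<and> poly P a = 0")
  case False
  have "Q' = 0" if "poly_pair G 0 Q'" for Q'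
    using that deriv_graphD(6)[OF G] unfolding poly_pair_def by (auto simp: poly_eq_iff)
  then have "poly Q' a + poly (pderiv Q) a * 0 = 0" if "poly_pair G Q Q'" "poly Q a = 0" for Q Q'
    using False that by fastforce
  then show ?thesis by blast
next
  case True
  define rel where "rel P P' \<longleftrightarrow> poly_pair G P P' \<and> P \<noteq> 0 \<and> poly P a = 0" for P P'
  obtain P P' where P: "rel P P'" and min: "\<And>Q Q'. rel Q Q' \<Longrightarrow> degree P \<le> degree Q"
    using True exists_least_iff[of "\<lambda>k. \<exists>P P'. rel P P' \<and> degree P = k"]
    unfolding rel_def by (metis leI)
  have nz: "degree P \<noteq> 0"
  proof
    assume "degree P = 0"
    then obtain c where "P = [:c:]" by (metis degree_eq_zeroE)
    then show False using P by (auto simp: rel_def)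
  qed
  have pd: "poly (pderiv P) a \<noteq> 0"
  proof
    assume "poly (pderiv P) a = 0"
    moreover have "pderiv P \<noteq> 0"
    proof
      assume "pderiv P = 0"
      moreover have "poly.coeff (pderiv P) (degree P - 1) = of_nat (degree P) * lead_coeff P"
        using nz by (simp add: coeff_pderiv)
      ultimately show False using P nz char_0[of "degree P - 1"] by (simp add: rel_def)
    qed
    moreover have "\<exists>R. poly_pair G (pderiv P) R"
    proof -
      have "(of_nat n, 0) \<in> G" for n
        using deriv_graph_sum[OF G, of "{..<n}" "\<lambda>_. 1" "\<lambda>_. 0"] deriv_graphD(1)[OF G] by simp
      then have "(of_nat n * c, of_nat n * c') \<in> G" if "(c, c') \<in> G" for n c c'
        using deriv_graphD(4)[OF G _ that, of "of_nat n" 0] by simp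
      then have "poly_pair G (pderiv P) (pderiv P')"
        using P unfolding rel_def poly_pair_def coeff_pderiv by blast
      then show ?thesis by blast
    qed
    moreover have "degree (pderiv P) \<le> degree P - 1"
      by (rule degree_le) (auto simp: coeff_pderiv coeff_eq_0)
    ultimately show False
      using min[of "pderiv P"] nz unfolding rel_def by fastforce
  qed
  define e where "e = - poly P' a / poly (pderiv P) a"
  have e: "poly P' a + poly (pderiv P) a * e = 0"
    using pd by (simp add: e_def)
  have "poly Q' a + poly (pderiv Q) a * e = 0" if "poly_pair G Q Q'" "poly Q a = 0" for Q Q'
    using that
  proof (induction "degree Q" arbitrary: Q Q' rule: less_induct)
    case less
    show ?case
    proof (cases "Q = 0")
      case True
      then have "Q' = 0"
        using less.prems(1) deriv_graphD(6)[OF G] unfolding poly_pair_def by (auto simp: poly_eq_iff)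
      then show ?thesis using True by simp
    next
      case False
      then have le: "degree P \<le> degree Q" using min less.prems unfolding rel_def by blast
      define m where "m = degree Q - degree P"
      define c c' where "c = lead_coeff P" and "c' = poly.coeff P' (degree P)"
      define b b' where "b = lead_coeff Q" and "b' = poly.coeff Q' (degree Q)"
      have cb: "(c, c') \<in> G" "(b, b') \<in> G" "c \<noteq> 0"
        using P less.prems by (auto simp: rel_def poly_pair_def c_def c'_def b_def b'_def)
      define M N where "M = Polynomial.monom c 0" and "N = Polynomial.monom b m"
      define M' N' where "M' = Polynomial.monom c' 0" and "N' = Polynomial.monom b' m"
      have MN: "poly_pair G M M'" "poly_pair G N N'"
        using cb by (auto simp: M_def N_def M'_def N'_def intro: poly_pair_monom[OF G])
      define R R' where "R = M * Q + - (N * P)" and "R' = (M' * Q + M * Q') + - (N' * P + N * P')"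
      have R: "poly_pair G R R'"
        unfolding R_def R'_def using P less.prems MN
        by (intro poly_pair_add[OF G] poly_pair_minus[OF G] poly_pair_mult[OF G]) (auto simp: rel_def)
      have R0: "poly R a = 0"
        using P less.prems by (simp add: R_def rel_def)
      have "degree R < degree Q \<or> R = 0"
      proof -
        have "degree R \<le> degree Q"
          unfolding R_def
        proof (rule degree_add_le)
          show "degree (M * Q) \<le> degree Q" by (simp add: M_def monom_0)
          show "degree (- (N * P)) \<le> degree Q"
            using degree_mult_le[of N P] degree_monom_le[of b m] le by (simp add: N_def m_def)
        qed
        moreover have "poly.coeff R (degree Q) = 0"
        proof -
          have "poly.coeff (N * P) (degree Q) = b * c"
            using coeff_monom_mult[of b m P "degree Q"] le by (simp add: N_def m_def c_def)
          then show ?thesis by (simp add: R_def M_def monom_0 b_def)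
        qed
        ultimately show ?thesis by (metis leading_coeff_0_iff le_neq_implies_less)
      qed
      then have "poly R' a + poly (pderiv R) a * e = 0"
      proof
        assume "R = 0"
        then have "R' = 0"
          using R deriv_graphD(6)[OF G] unfolding poly_pair_def by (auto simp: poly_eq_iff)
        then show ?thesis using \<open>R = 0\<close> by simp
      qed (use less.hyps R R0 in blast)
      moreover have "poly R' a + poly (pderiv R) a * e =
          c * (poly Q' a + poly (pderiv Q) a * e) - poly N a * (poly P' a + poly (pderiv P) a * e)"
      proof -
        have "poly P a = 0" "pderiv M = 0" "poly M a = c"
          using P by (simp_all add: rel_def M_def monom_0)
        then show ?thesis
          using less.prems by (simp add: R_def R'_def pderiv_mult pderiv_add pderiv_diff pderiv_minus algebra_simps)
      qed
      ultimately show ?thesis using e cb(3) by simp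
    qed
  qed
  then show ?thesis by blast
qed

lemma deriv_graph_adjoin:
  assumes G: "deriv_graph G"
    and e: "\<And>Q Q'. poly_pair G Q Q' \<Longrightarrow> poly Q a = 0 \<Longrightarrow> poly Q' a + poly (pderiv Q) a * e = 0"
  shows "deriv_graph (adjoin G a e)" "G \<subseteq> adjoin G a e" "(a, e) \<in> adjoin G a e"
proof -
  have I: "(poly P a, poly P' a + poly (pderiv P) a * e) \<in> adjoin G a e" if "poly_pair G P P'" for P P'
    using that unfolding adjoin_def by blast
  show sub: "G \<subseteq> adjoin G a e"
  proof
    fix p assume "p \<in> G"
    then obtain c c' where p: "p = (c, c')" "(c, c') \<in> G" by (cases p) auto
    show "p \<in> adjoin G a e"
      using I[OF poly_pair_monom[OF G p(2), of 0]] by (simp add: p(1) monom_0)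
  qed
  show "(a, e) \<in> adjoin G a e"
    using I[OF poly_pair_monom[OF G deriv_graphD(1)[OF G], of 1]]
    by (simp add: poly_monom pderiv_monom)
  show "deriv_graph (adjoin G a e)"
    unfolding deriv_graph_def
  proof (intro conjI allI impI)
    show "(1, 0) \<in> adjoin G a e" using sub deriv_graphD(1)[OF G] by blast
    show "b = 0" if "(0, b) \<in> adjoin G a e" for b
      using that e unfolding adjoin_def by force
    fix x x' y y' assume "(x, x') \<in> adjoin G a e" "(y, y') \<in> adjoin G a e"
    then obtain P P' Q Q' where *: "poly_pair G P P'" "poly_pair G Q Q'"
      "x = poly P a" "x' = poly P' a + poly (pderiv P) a * e"
      "y = poly Q a" "y' = poly Q' a + poly (pderiv Q) a * e"
      unfolding adjoin_def by blast
    show "(x + y, x' + y') \<in> adjoin G a e"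
      using I[OF poly_pair_add[OF G *(1,2)]] by (simp add: * pderiv_add algebra_simps)
    show "(x * y, x' * y + x * y') \<in> adjoin G a e"
      using I[OF poly_pair_mult[OF G *(1,2)]] by (simp add: * pderiv_mult algebra_simps)
    show "(- x, - x') \<in> adjoin G a e"
      using I[OF poly_pair_minus[OF G *(1)]] by (simp add: * pderiv_minus algebra_simps)
  qed
qed

theorem derivation_extension:
  fixes h :: "'f::field \<Rightarrow> 'k::field"
  assumes "ring_map h" "ring_deriv D" and char_0: "\<And>n. of_nat (Suc n) \<noteq> (0::'k)"
  shows "\<exists>E. ring_deriv E \<and> (\<forall>a. E (h a) = h (D a))"
proof -
  interpret ring_map h by fact
  interpret D: ring_deriv D by fact
  define G0 where "G0 = {(h a, h (D a)) |a. True}"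
  have I0: "(h a, h (D a)) \<in> G0" for a unfolding G0_def by blast
  have G0: "deriv_graph G0"
    unfolding deriv_graph_def
  proof (intro conjI allI impI)
    show "(1, 0) \<in> G0" using I0[of 1] by simp
    show "b = 0" if "(0, b) \<in> G0" for b
      using that ring_map_eq_0_iff[OF assms(1)] unfolding G0_def by fastforce
    fix x x' y y' assume "(x, x') \<in> G0" "(y, y') \<in> G0"
    then obtain a b where ab: "x = h a" "x' = h (D a)" "y = h b" "y' = h (D b)"
      unfolding G0_def by blast
    show "(x + y, x' + y') \<in> G0" "(x * y, x' * y + x * y') \<in> G0" "(- x, - x') \<in> G0"
      using I0[of "a + b"] I0[of "a * b"] I0[of "- a"] by (simp_all add: ab)
  qed
  define A where "A = {G. deriv_graph G \<and> G0 \<subseteq> G}"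
  have "\<exists>M\<in>A. \<forall>X\<in>A. M \<subseteq> X \<longrightarrow> X = M"
  proof (rule subset_Zorn_nonempty)
    show "A \<noteq> {}" using G0 by (auto simp: A_def)
    fix \<C> assume C: "\<C> \<noteq> {}" "subset.chain A \<C>"
    then have gr: "I \<in> \<C> \<Longrightarrow> deriv_graph I" "I \<in> \<C> \<Longrightarrow> G0 \<subseteq> I" for I
      by (auto simp: subset_chain_def A_def)
    have common: "\<exists>I\<in>\<C>. p \<in> I \<and> r \<in> I" if "p \<in> \<Union>\<C>" "r \<in> \<Union>\<C>" for p r
      using that C(2) unfolding subset_chain_def by blast
    have "deriv_graph (\<Union>\<C>)"
      unfolding deriv_graph_def
    proof (intro conjI allI impI)
      show "(1, 0) \<in> \<Union>\<C>" using C(1) gr deriv_graphD(1) by blast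
      show "b = 0" if "(0, b) \<in> \<Union>\<C>" for b using that gr deriv_graphD(6) by blast
      fix x x' y y' assume "(x, x') \<in> \<Union>\<C>" "(y, y') \<in> \<Union>\<C>"
      then obtain I where "I \<in> \<C>" "(x, x') \<in> I" "(y, y') \<in> I" using common by blast
      then show "(x + y, x' + y') \<in> \<Union>\<C>" "(x * y, x' * y + x * y') \<in> \<Union>\<C>" "(- x, - x') \<in> \<Union>\<C>"
        using gr(1) deriv_graphD(3-5) by blast+
    qed
    then show "\<Union>\<C> \<in> A" using C(1) gr(2) by (auto simp: A_def)
  qed
  then obtain M where MA: "M \<in> A" and maxA: "\<forall>X\<in>A. M \<subseteq> X \<longrightarrow> X = M" by blast
  have M: "deriv_graph M" "G0 \<subseteq> M" using MA by (simp_all add: A_def)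
  have max: "X = M" if "deriv_graph X" "M \<subseteq> X" for X
  proof -
    have "X \<in> A" using that M(2) by (simp add: A_def)
    then show ?thesis using maxA that(2) by simp
  qed
  have total: "\<exists>e. (a, e) \<in> M" for a
  proof -
    obtain e where e: "\<And>Q Q'. poly_pair M Q Q' \<Longrightarrow> poly Q a = 0 \<Longrightarrow> poly Q' a + poly (pderiv Q) a * e = 0"
      using deriv_graph_extend[OF M(1) char_0] by blast
    show ?thesis
      using max[OF deriv_graph_adjoin(1,2)[OF M(1) e]] deriv_graph_adjoin(3)[OF M(1) e] by blast
  qed
  define E where "E a = (SOME e. (a, e) \<in> M)" for a
  have E: "(a, E a) \<in> M" for a
    unfolding E_def using someI_ex[OF total] .
  have E_eq: "E a = e" if "(a, e) \<in> M" for a e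
    using deriv_graphD(7)[OF M(1) E that] .
  have "ring_deriv E"
    by standard (auto intro!: E_eq deriv_graphD(3,4)[OF M(1)] E)
  moreover have "E (h a) = h (D a)" for a
    using E_eq M(2) I0 by blast
  ultimately show ?thesis by blast
qed

section \<open>Extensions with two derivations\<close>

definition fps_map :: "('a \<Rightarrow> 'b) \<Rightarrow> 'a fps \<Rightarrow> 'b fps" where
  "fps_map d f = Abs_fps (\<lambda>n. d (f $ n))"

lemma fps_map_nth [simp]: "fps_map d f $ n = d (f $ n)"
  by (simp add: fps_map_def)

lemma deriv_fps_map: "ring_deriv (fps_map d)" if "ring_deriv d"
proof -
  interpret ring_deriv d by fact
  show ?thesis
    by standard (simp_all add: fps_eq_iff fps_mult_nth sum sum.distrib)
qed

lemma fps_deriv_fps_map: "fps_deriv (fps_map d f) = fps_map d (fps_deriv f)" if "ring_deriv d"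
proof -
  interpret ring_deriv d by fact
  show ?thesis by (simp add: fps_eq_iff del: of_nat_Suc)
qed

lemma deriv_fps_deriv: "ring_deriv (fps_deriv :: 'a::comm_ring_1 fps \<Rightarrow> _)"
  by standard (simp_all add: algebra_simps)

text \<open>The coefficients of \<open>u\<close> are computed recursively; \<open>pre n\<close> lists the first \<open>n + 1\<close> of them.\<close>
lemma linear_ode_solution:
  fixes H :: "'a::comm_ring_1 fps"
  assumes "rational_algebra TYPE('a)"
  shows "\<exists>u. u $ 0 = 1 \<and> fps_deriv u = - H * u"
proof -
  define step where "step xs = inv_Suc (length xs - 1) *
     (\<Sum>i<length xs. - (H $ i) * xs ! (length xs - 1 - i))" for xs
  define pre where "pre n = ((\<lambda>xs. xs @ [step xs]) ^^ n) [1]" for n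
  define u where "u = Abs_fps (\<lambda>n. pre n ! n)"
  have pre: "pre 0 = [1]" "pre (Suc n) = pre n @ [step (pre n)]" for n
    by (simp_all add: pre_def)
  have len: "length (pre n) = Suc n" for n
    by (induction n) (simp_all add: pre)
  have nth: "pre (n + k) ! i = pre n ! i" if "i \<le> n" for n k i
    using that by (induction k) (simp_all add: pre nth_append len)
  have nth': "pre n ! i = u $ i" if "i \<le> n" for n i
    using nth[of i i "n - i"] that by (simp add: u_def)
  have "fps_deriv u $ n = (- H * u) $ n" for n
  proof -
    have "u $ Suc n = step (pre n)"
      by (simp add: u_def pre nth_append len)
    also have "\<dots> = inv_Suc n * (\<Sum>i<Suc n. - (H $ i) * u $ (n - i))"
      unfolding step_def len by (simp add: nth' del: sum.lessThan_Suc)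
    also have "(\<Sum>i<Suc n. - (H $ i) * u $ (n - i)) = (- H * u) $ n"
      by (simp add: fps_mult_nth lessThan_Suc_atMost atMost_atLeast0 sum_negf)
    finally have "fps_deriv u $ n = (of_nat (Suc n) * inv_Suc n) * (- H * u) $ n"
      by (simp add: mult.assoc)
    then show ?thesis unfolding inv_Suc[OF assms] by simp
  qed
  then have "fps_deriv u = - H * u" by (rule fps_ext)
  moreover have "u $ 0 = 1" by (simp add: u_def pre)
  ultimately show ?thesis by blast
qed

text \<open>
  The field \<open>'k\<close> has a derivation \<open>E\<close> that extends \<open>D1\<close>, but nothing makes it satisfy the commutation
  relation with \<open>DK\<close>. Expand an element as a Taylor series in \<open>t\<close> along \<open>E\<close> and the result as a Taylor
  series in \<open>s\<close> along \<open>DK\<close>. Then \<open>DK\<close> becomes \<open>d/ds\<close>, and \<open>u d/dt\<close> satisfies the commutation relation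
  with it if \<open>du/ds = - c u\<close>. With the initial value \<open>u = 1\<close>, it extends \<open>D1\<close>: on the base, \<open>u d/dt\<close> and
  \<open>D1\<close> agree at \<open>s = 0\<close>, and by the commutation relation of the base they solve the same linear
  differential equation in \<open>s\<close>.
\<close>
theorem two_derivation_extension:
  fixes \<rho> :: "'f::field \<Rightarrow> 'k::field"
  assumes \<rho>: "ring_map \<rho>" and D1: "ring_deriv D1" and D2: "ring_deriv D2" and DK: "ring_deriv DK"
    and com: "\<And>a. D1 (D2 a) - D2 (D1 a) = c * D1 a"
    and DK_\<rho>: "\<And>a. DK (\<rho> a) = \<rho> (D2 a)"
    and char_0: "\<And>n. of_nat (Suc n) \<noteq> (0::'k)"
  shows "\<exists>(\<tau> :: 'k \<Rightarrow> 'k fps fps) \<Delta>1 \<Delta>2. ring_map \<tau> \<and> ring_deriv \<Delta>1 \<and> ring_deriv \<Delta>2 \<and>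
    (\<forall>a. \<Delta>2 (\<tau> a) = \<tau> (DK a)) \<and> (\<forall>a. \<Delta>1 (\<tau> (\<rho> a)) = \<tau> (\<rho> (D1 a))) \<and>
    (\<forall>x. \<Delta>1 (\<Delta>2 x) - \<Delta>2 (\<Delta>1 x) = \<tau> (\<rho> c) * \<Delta>1 x)"
proof -
  interpret \<rho>: ring_map \<rho> by fact
  have Q: "rational_algebra TYPE('k)" using char_0 by (simp add: rational_algebra_field)
  note QF = rational_algebra_fps[OF Q]
  obtain E where E: "ring_deriv E" "\<And>a. E (\<rho> a) = \<rho> (D1 a)"
    using derivation_extension[OF \<rho> D1 char_0] by blast
  define T where "T = taylor (\<lambda>a::'k. a) E"
  have T: "ring_map T" unfolding T_def by (rule ring_map_taylor[OF Q ring_map_ident E(1)])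
  define \<tau> where "\<tau> = taylor T DK"
  have \<tau>: "ring_map \<tau>" unfolding \<tau>_def by (rule ring_map_taylor[OF QF T DK])
  interpret \<tau>: ring_map \<tau> by fact
  have ds: "fps_deriv (\<tau> a) = \<tau> (DK a)" for a
    unfolding \<tau>_def by (rule taylor_deriv[OF QF])
  define dt where "dt = (fps_map fps_deriv :: 'k fps fps \<Rightarrow> _)"
  have dt: "ring_deriv dt" unfolding dt_def by (rule deriv_fps_map[OF deriv_fps_deriv])
  interpret dt: ring_deriv dt by fact
  have dt_ds: "fps_deriv (dt x) = dt (fps_deriv x)" for x
    unfolding dt_def by (rule fps_deriv_fps_map[OF deriv_fps_deriv])
  obtain u where u: "u $ 0 = 1" "fps_deriv u = - \<tau> (\<rho> c) * u"
    using linear_ode_solution[OF QF] by blast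
  define \<Delta>1 where "\<Delta>1 x = u * dt x" for x
  have "\<Delta>1 (\<tau> (\<rho> a)) = \<tau> (\<rho> (D1 a))" for a
  proof (rule fps_eqI_deriv[OF QF, where P = "{(\<Delta>1 (\<tau> (\<rho> a)), \<tau> (\<rho> (D1 a))) |a. True}"])
    fix f g assume "(f, g) \<in> {(\<Delta>1 (\<tau> (\<rho> a)), \<tau> (\<rho> (D1 a))) |a. True}"
    then obtain a where fg: "f = \<Delta>1 (\<tau> (\<rho> a))" "g = \<tau> (\<rho> (D1 a))" by blast
    have "f $ 0 = fps_deriv (T (\<rho> a))"
      by (simp add: fg \<Delta>1_def u(1) dt_def \<tau>_def)
    also have "\<dots> = T (\<rho> (D1 a))"
      unfolding T_def by (simp add: taylor_deriv[OF Q] E(2))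
    finally show "f $ 0 = g $ 0" by (simp add: fg \<tau>_def)
    fix n
    assume IH: "\<And>f g. (f, g) \<in> {(\<Delta>1 (\<tau> (\<rho> a)), \<tau> (\<rho> (D1 a))) |a. True} \<Longrightarrow>
      \<forall>i\<le>n. f $ i = g $ i"
    have "\<forall>i\<le>n. f $ i = g $ i" using IH[of f g] fg by blast
    then have eq: "(F * f) $ n = (F * g) $ n" for F
      by (simp add: fps_mult_nth)
    have "\<rho> (D2 (D1 a)) = \<rho> (D1 (D2 a)) - \<rho> c * \<rho> (D1 a)"
      using com[of a] by (metis \<rho>.diff \<rho>.mult diff_diff_eq2 diff_add_cancel add.commute add_diff_cancel_left')
    then have "fps_deriv g = \<tau> (\<rho> (D1 (D2 a))) - \<tau> (\<rho> c) * g"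
      by (simp add: fg ds DK_\<rho>)
    moreover have "fps_deriv f = \<Delta>1 (\<tau> (\<rho> (D2 a))) - \<tau> (\<rho> c) * f"
      by (simp add: fg \<Delta>1_def u(2) dt_ds ds DK_\<rho> algebra_simps)
    moreover have "\<Delta>1 (\<tau> (\<rho> (D2 a))) $ n = \<tau> (\<rho> (D1 (D2 a))) $ n"
      using IH[of "\<Delta>1 (\<tau> (\<rho> (D2 a)))" "\<tau> (\<rho> (D1 (D2 a)))"] by blast
    ultimately show "fps_deriv f $ n = fps_deriv g $ n"
      by (simp add: eq del: fps_deriv_nth)
  qed blast
  note on_base = this
  have "ring_deriv \<Delta>1"
    by standard (simp_all add: \<Delta>1_def algebra_simps)
  moreover have "\<Delta>1 (fps_deriv x) - fps_deriv (\<Delta>1 x) = \<tau> (\<rho> c) * \<Delta>1 x" for x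
    by (simp add: \<Delta>1_def u(2) dt_ds algebra_simps)
  ultimately have "ring_map \<tau> \<and> ring_deriv \<Delta>1 \<and> ring_deriv fps_deriv \<and>
    (\<forall>a. fps_deriv (\<tau> a) = \<tau> (DK a)) \<and> (\<forall>a. \<Delta>1 (\<tau> (\<rho> a)) = \<tau> (\<rho> (D1 a))) \<and>
    (\<forall>x. \<Delta>1 (fps_deriv x) - fps_deriv (\<Delta>1 x) = \<tau> (\<rho> c) * \<Delta>1 x)"
    using \<tau> ds deriv_fps_deriv on_base by simp
  then show ?thesis
    by - (rule exI[of _ \<tau>], rule exI[of _ \<Delta>1], rule exI[of _ fps_deriv])
qed

lemma ring_map_Fract: "ring_map (\<lambda>a::'a::idom. Fract a 1)"
proof
  show "Fract (1::'a) 1 = 1" by (simp only: One_fract_def)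
  show "Fract (a + b) 1 = Fract a 1 + Fract b 1" for a b :: 'a
    using add_fract[of 1 1 a b] by (simp only: mult_1_right mult_1_left one_neq_zero not_False_eq_True simp_thms)
  show "Fract (a * b) 1 = Fract a 1 * Fract b 1" for a b :: 'a
    by (simp only: mult_fract mult_1)
qed

lemma deriv_fract:
  fixes d :: "'a::idom \<Rightarrow> 'a"
  assumes "ring_deriv d"
  shows "\<exists>d'. ring_deriv d' \<and> (\<forall>a. d' (Fract a 1) = Fract (d a) 1)"
proof -
  interpret ring_deriv d by fact
  define q where "q a b = Fract (d a * b - a * d b) (b * b)" for a b
  have wd: "q a b = q a' b'" if "b \<noteq> 0" "b' \<noteq> 0" "a * b' = a' * b" for a b a' b'
  proof -
    have "d a * b' + a * d b' = d a' * b + a' * d b"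
      using arg_cong[OF that(3), of d] by simp
    then have "(d a * b - a * d b) * (b' * b') = (d a' * b' - a' * d b') * (b * b)"
    proof -
      have "(d a * b - a * d b) * (b' * b') - (d a' * b' - a' * d b') * (b * b) =
          b * b' * (d a * b' + a * d b' - (d a' * b + a' * d b))
          - (d b * b' + d b' * b) * (a * b' - a' * b)"
        by (simp add: algebra_simps)
      also have "\<dots> = 0" using \<open>d a * b' + a * d b' = _\<close> that(3) by simp
      finally show ?thesis by simp
    qed
    then show ?thesis using that by (simp add: q_def eq_fract)
  qed
  define d' where "d' x = (SOME y. \<exists>a b. b \<noteq> 0 \<and> x = Fract a b \<and> y = q a b)" for x :: "'a fract"
  have d': "d' (Fract a b) = q a b" if "b \<noteq> 0" for a b
  proof -
    have "\<exists>y a' b'. b' \<noteq> 0 \<and> Fract a b = Fract a' b' \<and> y = q a' b'" using that by blast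
    from someI_ex[OF this] obtain a' b' where "b' \<noteq> 0" "Fract a b = Fract a' b'"
      "d' (Fract a b) = q a' b'" unfolding d'_def by blast
    then show ?thesis using wd[of b b' a a'] that by (simp add: eq_fract)
  qed
  have "ring_deriv d'"
  proof
    fix x y :: "'a fract"
    obtain a b where x: "x = Fract a b" "b \<noteq> 0" by (cases x)
    obtain a' b' where y: "y = Fract a' b'" "b' \<noteq> 0" by (cases y)
    interpret F: ring_map "\<lambda>a::'a. Fract a 1" by (rule ring_map_Fract)
    define f where "f a = Fract a 1" for a :: 'a
    have f: "f (u + v) = f u + f v" "f (u * v) = f u * f v" "f (u - v) = f u - f v" for u v
      unfolding f_def by (rule F.add F.mult F.diff)+
    have Fract: "Fract u v = f u / f v" for u v
      by (simp add: f_def)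
    have f0: "f b \<noteq> 0" "f b' \<noteq> 0"
      using x(2) y(2) eq_fract(1)[of 1 1 b 0] eq_fract(1)[of 1 1 b' 0]
      unfolding f_def Zero_fract_def by simp_all
    have "x + y = Fract (a * b' + a' * b) (b * b')" "x * y = Fract (a * a') (b * b')"
      using x y by (simp_all add: mult.commute)
    then have sum_prod: "d' (x + y) = q (a * b' + a' * b) (b * b')" "d' (x * y) = q (a * a') (b * b')"
      using d' x(2) y(2) by simp_all
    have dx: "d' x = q a b" and dy: "d' y = q a' b'" using d' x y by simp_all
    show "d' (x + y) = d' x + d' y"
      unfolding sum_prod dx dy q_def Fract add mult f using f0
      by (simp add: divide_simps) (simp add: algebra_simps)
    show "d' (x * y) = d' x * y + x * d' y"
      unfolding sum_prod dx dy
      unfolding x(1) y(1) q_def Fract add mult f using f0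
      by (simp add: divide_simps) (simp add: algebra_simps)
  qed
  moreover have "d' (Fract a 1) = Fract (d a) 1" for a
    by (simp add: d' q_def)
  ultimately show ?thesis by blast
qed

lemma deriv_fract_eqI:
  fixes d e :: "'a::idom fract \<Rightarrow> 'a fract"
  assumes "ring_deriv d" "ring_deriv e" "\<And>a. d (Fract a 1) = e (Fract a 1)"
  shows "d x = e x"
proof -
  interpret d: ring_deriv d by fact
  interpret e: ring_deriv e by fact
  obtain a b where x: "x = Fract a b" "b \<noteq> 0" by (cases x)
  then have xb: "x * Fract b 1 = Fract a 1" and b0: "Fract b 1 \<noteq> 0"
    by (simp_all add: eq_fract Zero_fract_def)
  have "d (x * Fract b 1) = e (x * Fract b 1)" unfolding xb by (rule assms(3))
  then have "(d x - e x) * Fract b 1 = 0"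
    by (simp add: assms(3) algebra_simps)
  then show ?thesis using b0 by simp
qed

lemma two_derivations_fract:
  fixes \<Delta>1 \<Delta>2 :: "'a::idom \<Rightarrow> 'a"
  assumes "ring_deriv \<Delta>1" "ring_deriv \<Delta>2" "\<And>x. \<Delta>1 (\<Delta>2 x) - \<Delta>2 (\<Delta>1 x) = c * \<Delta>1 x"
  shows "\<exists>E1 E2. ring_deriv E1 \<and> ring_deriv E2 \<and> (\<forall>a. E1 (Fract a 1) = Fract (\<Delta>1 a) 1) \<and>
    (\<forall>a. E2 (Fract a 1) = Fract (\<Delta>2 a) 1) \<and>
    (\<forall>x. E1 (E2 x) - E2 (E1 x) = Fract c 1 * E1 x)"
proof -
  interpret F: ring_map "\<lambda>a::'a. Fract a 1" by (rule ring_map_Fract)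
  obtain E1 where E1: "ring_deriv E1" "\<And>a. E1 (Fract a 1) = Fract (\<Delta>1 a) 1"
    using deriv_fract[OF assms(1)] by blast
  obtain E2 where E2: "ring_deriv E2" "\<And>a. E2 (Fract a 1) = Fract (\<Delta>2 a) 1"
    using deriv_fract[OF assms(2)] by blast
  interpret E1: ring_deriv E1 by fact
  interpret E2: ring_deriv E2 by fact
  have "E1 (E2 x) - E2 (E1 x) = Fract c 1 * E1 x" for x
  proof (rule deriv_fract_eqI[where d = "\<lambda>x. E1 (E2 x) - E2 (E1 x)"])
    show "ring_deriv (\<lambda>x. E1 (E2 x) - E2 (E1 x))" "ring_deriv (\<lambda>x. Fract c 1 * E1 x)"
      by (standard; simp add: algebra_simps)+
    show "E1 (E2 (Fract a 1)) - E2 (E1 (Fract a 1)) = Fract c 1 * E1 (Fract a 1)" for a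
      unfolding E1(2) E2(2) using F.diff F.mult assms(3) by metis
  qed
  then show ?thesis using E1 E2 by blast
qed

unbundle cardinal_syntax

section \<open>Differentially closed fields\<close>

lemma card_of_Un_le:
  fixes B :: "'f set" and X PVar :: "'u set"
  assumes "infinite B" "|X| \<le>o |B|" "|PVar| \<le>o |B|"
  shows "|X \<union> PVar| \<le>o |B|"
  using assms by (intro card_of_Un_ordLeq_infinite_Field) (auto simp: card_of_card_order_on Field_card_of)

text \<open>
  The closure is the union of countably many stages. Each stage adds the results of countably many
  operations to the one before it, which does not enlarge it beyond \<open>B\<close>.
\<close>
lemma small_closed_subset:
  fixes opr :: "nat \<Rightarrow> 'u \<Rightarrow> 'u \<Rightarrow> 'u" and B :: "'f set"
  assumes B: "infinite B" and A: "|A| \<le>o |B|"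
  shows "\<exists>S. A \<subseteq> S \<and> |S| \<le>o |B| \<and> (\<forall>k. \<forall>x\<in>S. \<forall>y\<in>S. opr k x y \<in> S)"
proof -
  define next_set where "next_set X = X \<union> (\<Union>k. (\<lambda>(x, y). opr k x y) ` (X \<times> X))" for X
  define S where "S = (\<Union>n. (next_set ^^ n) A)"
  have nat: "|UNIV :: nat set| \<le>o |B|" using B by (simp add: infinite_iff_card_of_nat)
  have step: "|next_set X| \<le>o |B|" if X: "|X| \<le>o |B|" for X
  proof -
    have "|X \<times> X| \<le>o |B|" 
      using B X by (intro card_of_Times_ordLeq_infinite_Field) (auto simp: card_of_card_order_on Field_card_of)
    then have "|(\<lambda>(x, y). opr k x y) ` (X \<times> X)| \<le>o |B|" for k
      using card_of_image ordLeq_transitive by blast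
    then have "|\<Union>k. (\<lambda>(x, y). opr k x y) ` (X \<times> X)| \<le>o |B|"
      by (intro card_of_UNION_ordLeq_infinite[OF B nat]) auto
    then show ?thesis
      unfolding next_set_def by (rule card_of_Un_le[OF B X])
  qed
  have level: "|(next_set ^^ n) A| \<le>o |B|" for n
    by (induction n) (simp_all add: A step)
  have mono: "(next_set ^^ n) A \<subseteq> (next_set ^^ (n + m)) A" for n m
    by (induction m) (auto simp: next_set_def)
  have "(next_set ^^ 0) A \<subseteq> S" unfolding S_def by blast
  then have "A \<subseteq> S" by simp
  moreover have "|S| \<le>o |B|"
    unfolding S_def by (rule card_of_UNION_ordLeq_infinite[OF B nat]) (simp add: level)
  moreover have "opr k x y \<in> S" if xy: "x \<in> S" "y \<in> S" for k x y
  proof -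
    obtain n m where "x \<in> (next_set ^^ n) A" "y \<in> (next_set ^^ m) A"
      using xy unfolding S_def by blast
    then have "x \<in> (next_set ^^ (n + m)) A" "y \<in> (next_set ^^ (n + m)) A"
      using mono[of n m] mono[of m n] by (auto simp: add.commute)
    then have "opr k x y \<in> (next_set ^^ Suc (n + m)) A"
      unfolding funpow.simps o_apply next_set_def[of "(next_set ^^ (n + m)) A"] by blast
    then show ?thesis unfolding S_def by blast
  qed
  ultimately show ?thesis by blast
qed

text \<open>
  The closedness of a field with two derivations is tested on structures that live on its own type.
  A small differential subfield \<open>S\<close> of another type is copied to it along an injection \<open>g\<close>.
\<close>
definition transport :: "('u \<Rightarrow> 'f) \<Rightarrow> 'u set \<Rightarrow> ('u::comm_ring_1 \<Rightarrow> 'u) \<Rightarrow> ('u \<Rightarrow> 'u) \<Rightarrow> 'u \<Rightarrow> 'f diff2_ring"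
  where "transport g S d1 d2 c =
    (let g' = inv_into S g in
     \<lparr>carrier = g ` S, monoid.mult = (\<lambda>x y. g (g' x * g' y)), one = g 1, ring.zero = g 0,
      add = (\<lambda>x y. g (g' x + g' y)),
      der1 = (\<lambda>x. g (d1 (g' x))), der2 = (\<lambda>x. g (d2 (g' x))), com = g c\<rparr>)"

locale differential_subfield =
  fixes S :: "'u::field set" and d1 d2 :: "'u \<Rightarrow> 'u" and c :: 'u and g :: "'u \<Rightarrow> 'f"
  assumes closed: "1 \<in> S" "c \<in> S"
    "x \<in> S \<Longrightarrow> y \<in> S \<Longrightarrow> x + y \<in> S" "x \<in> S \<Longrightarrow> y \<in> S \<Longrightarrow> x * y \<in> S"
    "x \<in> S \<Longrightarrow> - x \<in> S" "x \<in> S \<Longrightarrow> inverse x \<in> S" "x \<in> S \<Longrightarrow> d1 x \<in> S" "x \<in> S \<Longrightarrow> d2 x \<in> S"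
    and d1: "ring_deriv d1" and d2: "ring_deriv d2"
    and commutator: "d1 (d2 x) - d2 (d1 x) = c * d1 x"
    and inj: "inj_on g S"
begin

abbreviation "T \<equiv> transport g S d1 d2 c"

lemma zero_closed: "0 \<in> S"
  using closed(3)[OF closed(1) closed(5)[OF closed(1)]] by simp

lemma transport_simps:
  "carrier T = g ` S" "\<one>\<^bsub>T\<^esub> = g 1" "\<zero>\<^bsub>T\<^esub> = g 0" "com T = g c"
  "x \<in> S \<Longrightarrow> y \<in> S \<Longrightarrow> g x \<otimes>\<^bsub>T\<^esub> g y = g (x * y)"
  "x \<in> S \<Longrightarrow> y \<in> S \<Longrightarrow> g x \<oplus>\<^bsub>T\<^esub> g y = g (x + y)"
  "x \<in> S \<Longrightarrow> der1 T (g x) = g (d1 x)"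
  "x \<in> S \<Longrightarrow> der2 T (g x) = g (d2 x)"
  by (simp_all add: transport_def Let_def inv_into_f_f[OF inj])

lemma transport_field: "field T"
proof -
  have "cring T"
  proof (rule cringI)
    show "abelian_group T"
    proof (rule abelian_groupI)
      fix x assume "x \<in> carrier T"
      then obtain a where "a \<in> S" "x = g a" by (auto simp: transport_simps)
      then show "\<exists>y\<in>carrier T. y \<oplus>\<^bsub>T\<^esub> x = \<zero>\<^bsub>T\<^esub>"
        by (intro bexI[of _ "g (- a)"]) (auto simp: transport_simps closed)
    qed (auto simp: transport_simps closed zero_closed algebra_simps)
    show "comm_monoid T"
      by (rule comm_monoidI) (auto simp: transport_simps closed algebra_simps)
  qed (auto simp: transport_simps closed algebra_simps)
  then show ?thesis
  proof (rule cring.cring_fieldI)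
    show "Units T = carrier T - {\<zero>\<^bsub>T\<^esub>}"
    proof (intro equalityI subsetI)
      fix x assume "x \<in> Units T"
      then obtain a b where ab: "a \<in> S" "x = g a" "b \<in> S" "g a \<otimes>\<^bsub>T\<^esub> g b = g 1"
        unfolding Units_def by (auto simp: transport_simps)
      then have "a * b = 1" using inj closed by (simp add: transport_simps inj_on_eq_iff)
      then have "a \<noteq> 0" by auto
      then show "x \<in> carrier T - {\<zero>\<^bsub>T\<^esub>}"
        using ab zero_closed inj by (auto simp: transport_simps inj_on_eq_iff)
    next
      fix x assume "x \<in> carrier T - {\<zero>\<^bsub>T\<^esub>}"
      then obtain a where a: "a \<in> S" "x = g a" "a \<noteq> 0" by (auto simp: transport_simps)
      then show "x \<in> Units T"
        unfolding Units_def
        by (intro CollectI conjI bexI[of _ "g (inverse a)"]) (auto simp: transport_simps closed)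
    qed
  qed
qed

lemma transport_diff2_field: "diff2_field T"
proof -
  interpret T: field T by (rule transport_field)
  interpret d1: ring_deriv d1 by (rule d1)
  interpret d2: ring_deriv d2 by (rule d2)
  have neg: "\<ominus>\<^bsub>T\<^esub> g a = g (- a)" if "a \<in> S" for a
    using that T.minus_equality[of "g (- a)" "g a"] by (auto simp: transport_simps closed)
  show ?thesis
    unfolding diff2_field_def
  proof (intro conjI ballI)
    show "field T" by (rule transport_field)
    show "derivation T (der1 T)" "derivation T (der2 T)"
      unfolding derivation_def by (auto simp: transport_simps closed)
    show "com T \<in> carrier T" by (simp add: transport_simps closed)
    fix x assume "x \<in> carrier T"
    then obtain a where a: "a \<in> S" "x = g a" by (auto simp: transport_simps)
    show "der1 T (der2 T x) \<ominus>\<^bsub>T\<^esub> der2 T (der1 T x) = com T \<otimes>\<^bsub>T\<^esub> der1 T x"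
      using commutator[of a] by (simp add: a a_minus_def transport_simps closed neg)
  qed
qed

end

primrec dterm_of :: "'a dpoly \<Rightarrow> 'a dterm" where
  "dterm_of (PConst a) = DConst a"
| "dterm_of (PVar n) = (DDer2 ^^ n) (DVar 0)"
| "dterm_of (PAdd s t) = DAdd (dterm_of s) (dterm_of t)"
| "dterm_of (PMult s t) = DMult (dterm_of s) (dterm_of t)"

lemma (in differential_subfield) dt_eval_transport:
  assumes "range h \<subseteq> S" "v \<in> S"
  shows "peval h (\<lambda>n. (d2 ^^ n) v) t \<in> S \<and>
    dt_eval T (\<lambda>a. g (h a)) (\<lambda>_. g v) (dterm_of t) = g (peval h (\<lambda>n. (d2 ^^ n) v) t)"
proof (induction t)
  case (PVar n)
  have "(d2 ^^ n) v \<in> S \<and> dt_eval T (\<lambda>a. g (h a)) (\<lambda>_. g v) ((DDer2 ^^ n) (DVar 0)) = g ((d2 ^^ n) v)"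
    by (induction n) (auto simp: assms(2) closed transport_simps)
  then show ?case by simp
qed (use assms in \<open>auto simp: closed transport_simps\<close>)

lemma dt_eval_full:
  "dt_eval (diff2_on UNIV d1 d2 c) id v (dterm_of t) = peval (\<lambda>a. a) (\<lambda>n. (d2 ^^ n) (v 0)) t"
proof (induction t)
  case (PVar n)
  show ?case by (induction n) (simp_all add: diff2_on_def)
qed (simp_all add: diff2_on_def)

lemma diff2_field_full:
  assumes "diff2_field (diff2_on UNIV d1 d2 (c::'f::field))"
  shows "ring_deriv d1" "ring_deriv d2" "d1 (d2 a) - d2 (d1 a) = c * d1 a"
proof -
  let ?R = "diff2_on UNIV d1 d2 c"
  interpret R: field ?R using assms by (simp add: diff2_field_def)
  have "\<ominus>\<^bsub>?R\<^esub> x = - x" for x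
    using R.minus_equality[of "- x" x] by (simp add: diff2_on_def)
  then have "x \<ominus>\<^bsub>?R\<^esub> y = x - y" for x y
    by (simp add: a_minus_def) (simp add: diff2_on_def)
  then show "ring_deriv d1" "ring_deriv d2" "d1 (d2 a) - d2 (d1 a) = c * d1 a"
    using assms unfolding diff2_field_def derivation_def ring_deriv_def
    by (auto simp: diff2_on_def)
qed

text \<open>
  A solution in an extension for \<open>D2\<close> alone becomes, by \<open>two_derivation_extension\<close>, a solution in a
  field with both derivations. The subfield that the base and the solution generate there has the
  cardinality of the base, so closedness for both derivations applies to a copy of it.
\<close>
theorem differentially_closed_reduct:
  fixes \<rho> :: "'f::field \<Rightarrow> 'k::field"
  assumes F: "diff2_closed (diff2_on UNIV D1 D2 c)"
    and \<rho>: "ring_map \<rho>" and DK: "ring_deriv DK" and DK_\<rho>: "\<And>a. DK (\<rho> a) = \<rho> (D2 a)"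
    and char_0: "\<And>n. of_nat (Suc n) \<noteq> (0::'f)"
    and P: "finite P" "\<And>t. t \<in> P \<Longrightarrow> peval \<rho> (\<lambda>n. (DK ^^ n) w) t = 0"
    and Q: "finite Q" "\<And>t. t \<in> Q \<Longrightarrow> peval \<rho> (\<lambda>n. (DK ^^ n) w) t \<noteq> 0"
  shows "\<exists>v. (\<forall>t\<in>P. peval (\<lambda>a. a) (\<lambda>n. (D2 ^^ n) v) t = 0) \<and>
    (\<forall>t\<in>Q. peval (\<lambda>a. a) (\<lambda>n. (D2 ^^ n) v) t \<noteq> 0)"
proof -
  interpret \<rho>: ring_map \<rho> by fact
  let ?F = "diff2_on UNIV D1 D2 c"
  have "diff2_field ?F" using F by (simp add: diff2_closed_def)
  note D = diff2_field_full[OF this]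
  have char_0': "of_nat (Suc n) \<noteq> (0::'k)" for n
    using char_0[of n] ring_map_eq_0_iff[OF \<rho>] by (metis \<rho>.of_nat)
  obtain \<tau> :: "'k \<Rightarrow> 'k fps fps" and \<Delta>1 \<Delta>2 where \<tau>: "ring_map \<tau>" "ring_deriv \<Delta>1" "ring_deriv \<Delta>2"
    "\<And>a. \<Delta>2 (\<tau> a) = \<tau> (DK a)" "\<And>a. \<Delta>1 (\<tau> (\<rho> a)) = \<tau> (\<rho> (D1 a))"
    "\<And>x. \<Delta>1 (\<Delta>2 x) - \<Delta>2 (\<Delta>1 x) = \<tau> (\<rho> c) * \<Delta>1 x"
    using two_derivation_extension[OF \<rho> D(1,2) DK D(3) DK_\<rho> char_0'] by blast
  obtain E1 E2 where E: "ring_deriv E1" "ring_deriv E2" "\<And>a. E1 (Fract a 1) = Fract (\<Delta>1 a) 1"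
    "\<And>a. E2 (Fract a 1) = Fract (\<Delta>2 a) 1"
    "\<And>x. E1 (E2 x) - E2 (E1 x) = Fract (\<tau> (\<rho> c)) 1 * E1 x"
    using two_derivations_fract[OF \<tau>(2,3,6)] by blast
  define \<kappa> where "\<kappa> a = Fract (\<tau> a) 1" for a
  have \<kappa>: "ring_map \<kappa>"
    unfolding \<kappa>_def by (rule ring_map_comp[OF ring_map_Fract \<tau>(1)])
  interpret \<kappa>: ring_map \<kappa> by fact
  define opr where "opr k x y = (if k = 0 then x + y else if k = 1 then x * y else if k = 2 then - x
    else if k = 3 then inverse x else if k = 4 then E1 x else E2 x)"
    for k :: nat and x y :: "'k fps fps fract"
  define A where "A = insert 1 (insert (\<kappa> w) (range (\<lambda>a. \<kappa> (\<rho> a))))"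
  have inf: "infinite (UNIV :: 'f set)"
    using infinite_range_of_nat[OF char_0] finite_subset subset_UNIV by metis
  have "|A| \<le>o |UNIV :: 'f set|"
  proof -
    have "|{1} \<union> ({\<kappa> w} \<union> range (\<lambda>a. \<kappa> (\<rho> a)))| \<le>o |UNIV :: 'f set|"
      by (intro card_of_Un_le[OF inf] card_of_singl_ordLeq card_of_image) simp_all
    then show ?thesis by (simp add: A_def insert_commute)
  qed
  from small_closed_subset[OF inf this, of opr] obtain S where
    S: "A \<subseteq> S" "|S| \<le>o |UNIV :: 'f set|" "\<And>k x y. x \<in> S \<Longrightarrow> y \<in> S \<Longrightarrow> opr k x y \<in> S"
    by blast
  from S(2) obtain g :: "'k fps fps fract \<Rightarrow> 'f" where g: "inj_on g S"
    by (metis card_of_ordLeq)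
  interpret S: differential_subfield S E1 E2 "\<kappa> (\<rho> c)" g
  proof
    show "1 \<in> S" "\<kappa> (\<rho> c) \<in> S" using S(1) by (auto simp: A_def)
    fix x y assume "x \<in> S" "y \<in> S"
    then show "x + y \<in> S" "x * y \<in> S" using S(3)[of x y 0] S(3)[of x y 1] by (simp_all add: opr_def)
  next
    fix x assume "x \<in> S"
    then show "- x \<in> S" "inverse x \<in> S" "E1 x \<in> S" "E2 x \<in> S"
      using S(3)[of x x 2] S(3)[of x x 3] S(3)[of x x 4] S(3)[of x x 5] by (simp_all add: opr_def)
  qed (use E g in \<open>auto simp: ring_deriv_def \<kappa>_def\<close>)
  have range: "range (\<lambda>a. \<kappa> (\<rho> a)) \<subseteq> S" and w: "\<kappa> w \<in> S" using S(1) by (auto simp: A_def)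
  have w_iter: "(E2 ^^ n) (\<kappa> w) = \<kappa> ((DK ^^ n) w)" for n
    by (induction n) (simp_all add: \<kappa>_def E \<tau>)
  have peval_\<kappa>: "peval (\<lambda>a. \<kappa> (\<rho> a)) (\<lambda>n. (E2 ^^ n) (\<kappa> w)) t = \<kappa> (peval \<rho> (\<lambda>n. (DK ^^ n) w) t)" for t
    by (induction t) (simp_all add: w_iter)
  have \<kappa>_0: "\<kappa> x = 0 \<longleftrightarrow> x = 0" for x by (rule ring_map_eq_0_iff[OF \<kappa>])
  have "g x = g 0 \<longleftrightarrow> x = 0" if "x \<in> S" for x
    using that S.zero_closed g by (simp add: inj_on_eq_iff)
  then have ev: "dt_eval S.T (\<lambda>a. g (\<kappa> (\<rho> a))) (\<lambda>_. g (\<kappa> w)) (dterm_of t) = \<zero>\<^bsub>S.T\<^esub> \<longleftrightarrow>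
      peval \<rho> (\<lambda>n. (DK ^^ n) w) t = 0" for t
    using S.dt_eval_transport[OF range w, of t] by (simp add: S.transport_simps peval_\<kappa> \<kappa>_0)
  have "dt_solvable S.T (\<lambda>a. g (\<kappa> (\<rho> a))) (dterm_of ` P) (dterm_of ` Q)"
    unfolding dt_solvable_def
  proof (rule exI[of _ "\<lambda>_. g (\<kappa> w)"], intro conjI)
    show "range (\<lambda>_. g (\<kappa> w)) \<subseteq> carrier S.T" using w by (auto simp: S.transport_simps)
  qed (use P Q in \<open>auto simp: ev\<close>)
  moreover have "(\<lambda>a. g (\<kappa> (\<rho> a))) \<in> diff2_hom ?F S.T"
  proof -
    have m: "\<kappa> (\<rho> a) \<in> S" for a using range by blast
    have "E1 (\<kappa> (\<rho> a)) = \<kappa> (\<rho> (D1 a))" "E2 (\<kappa> (\<rho> a)) = \<kappa> (\<rho> (D2 a))" for a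
      by (simp_all add: \<kappa>_def E \<tau> DK_\<rho>)
    then show ?thesis
      unfolding diff2_hom_def ring_hom_def
      by (auto simp: S.transport_simps m diff2_on_def)
  qed
  ultimately have "dt_solvable ?F id (dterm_of ` P) (dterm_of ` Q)"
    using F S.transport_diff2_field P(1) Q(1) unfolding diff2_closed_def
    by (auto simp: diff2_on_def)
  then show ?thesis
    unfolding dt_solvable_def by (auto simp: dt_eval_full) (auto simp: diff2_on_def)
qed

text \<open>
  Taylor expansion along \<open>d\<close>, with values in a residue field, has a differential ideal as its kernel.
  So it embeds the ring generated by \<open>w\<close> into a differential field of Laurent series, and every
  system that \<open>w\<close> solves has a solution in the base.
\<close>
theorem (in simple_differential_extension) generator_in_differentially_closed_base:
  assumes F: "diff2_closed (diff2_on UNIV D1 D c)"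
  shows "w \<in> range \<epsilon>"
proof (rule generator_in_base)
  fix p s q
  assume p: "evw p = 0" and s: "evw s \<noteq> 0" and q: "evw q \<noteq> 0"
  have "rational_algebra TYPE('f)" using char_0 by (simp add: rational_algebra_field)
  from rational_algebra_ring_map[OF this ring_map_comp[OF ring_map_residue \<epsilon>.ring_map_axioms]]
  have Q: "rational_algebra TYPE('l residue)" .
  define \<tau> where "\<tau> = taylor (abs_residue :: 'l \<Rightarrow> 'l residue) d"
  have \<tau>: "ring_map \<tau>" unfolding \<tau>_def by (rule ring_map_taylor[OF Q ring_map_residue d.ring_deriv_axioms])
  interpret \<tau>: ring_map \<tau> by fact
  define \<kappa> where "\<kappa> a = fps_to_fls (\<tau> a)" for a
  have \<kappa>: "ring_map \<kappa>" by standard (simp_all add: \<kappa>_def fls_times_fps_to_fls)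
  interpret \<kappa>: ring_map \<kappa> by fact
  have \<kappa>_d: "fls_deriv (\<kappa> a) = \<kappa> (d a)" for a
    unfolding \<kappa>_def fls_deriv_fps_to_fls by (simp add: \<tau>_def taylor_deriv[OF Q])
  have \<kappa>_0: "\<kappa> (evw t) = 0 \<longleftrightarrow> evw t = 0" for t
  proof
    assume "\<kappa> (evw t) = 0"
    then show "evw t = 0"
      by (rule differential_relations_vanish[where P = "\<lambda>t. \<kappa> (evw t) = 0", rotated -1])
        (auto simp: evw_pdiff simp flip: \<kappa>_d)
  qed simp
  have iter: "(fls_deriv ^^ n) (\<kappa> w) = \<kappa> ((d ^^ n) w)" for n
    by (induction n) (simp_all add: \<kappa>_d)
  have peval_\<kappa>: "peval (\<lambda>a. \<kappa> (\<epsilon> a)) (\<lambda>n. (fls_deriv ^^ n) (\<kappa> w)) t = \<kappa> (evw t)" for t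
    by (induction t) (simp_all add: iter)
  have "ring_deriv (fls_deriv :: 'l residue fls \<Rightarrow> _)"
    by standard (simp_all add: algebra_simps)
  from differentially_closed_reduct[where \<rho> = "\<lambda>a. \<kappa> (\<epsilon> a)", OF F ring_map_comp[OF \<kappa> \<epsilon>.ring_map_axioms] this,
      where P = "{p}" and Q = "{s, q}" and w = "\<kappa> w"]
  have "\<exists>v. (\<forall>t\<in>{p}. evf v t = 0) \<and> (\<forall>t\<in>{s, q}. evf v t \<noteq> 0)"
    using p s q char_0 by (simp add: peval_\<kappa> \<kappa>_0 \<kappa>_d d_\<epsilon> ball_simps del: of_nat_Suc) metis
  then show "\<exists>v. evf v p = 0 \<and> evf v s \<noteq> 0 \<and> evf v q \<noteq> 0" by simp
qed

unbundle no cardinal_syntax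

section \<open>The base field of rational functions\<close>

lemma (in ring_map) map_poly_ring_map: "ring_map (map_poly h)"
proof
  show "map_poly h 1 = 1" by (simp add: map_poly_1)
  show "map_poly h (p + q) = map_poly h p + map_poly h q" for p q
    by (rule poly_eqI) (simp add: coeff_map_poly)
  show "map_poly h (p * q) = map_poly h p * map_poly h q" for p q
    by (rule poly_eqI) (simp add: coeff_map_poly coeff_mult sum)
qed

lemma ring_map_poly: "ring_map (\<lambda>p. poly p a)" for a :: "'a::comm_ring_1"
  by standard simp_all

lemma (in ring_map) poly_map_poly_ring_map: "ring_map (\<lambda>p. poly (map_poly h p) a)"
  by (rule ring_map_comp[OF ring_map_poly map_poly_ring_map])

lemma (in ring_map) ring_map_poly_eq: "h (poly p a) = poly (map_poly h p) (h a)"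
  by (induction p) (simp_all add: map_poly_pCons)

lemma (in ring_map) map_poly_pcompose: "map_poly h (pcompose p q) = pcompose (map_poly h p) (map_poly h q)"
proof -
  interpret P: ring_map "map_poly h" by (rule map_poly_ring_map)
  show ?thesis by (induction p) (simp_all add: pcompose_pCons map_poly_pCons)
qed

lemma shift_invariant_const:
  fixes f :: "'f::field poly"
  assumes "pcompose f [:1, 1:] = f" and char_0: "\<And>n. of_nat (Suc n) \<noteq> (0::'f)"
  shows "\<exists>c. f = [:c:]"
proof -
  have val: "poly f (of_nat n) = poly f 0" for n
  proof (induction n)
    case (Suc n)
    have "poly f (of_nat (Suc n)) = poly (pcompose f [:1, 1:]) (of_nat n)"
      by (simp add: poly_pcompose)
    then show ?case using Suc by (simp add: assms(1))
  qed simp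
  have "infinite (range (of_nat :: nat \<Rightarrow> 'f))" by (rule infinite_range_of_nat[OF char_0])
  moreover have "range of_nat \<subseteq> {a. poly (f - [:poly f 0:]) a = 0}"
    using val by auto
  ultimately have "f - [:poly f 0:] = 0"
    using poly_roots_finite finite_subset by blast
  then show ?thesis by (metis eq_iff_diff_eq_0)
qed

text \<open>
  The elements \<open>x\<close> and \<open>l\<close> turn out to be algebraically independent over the constants
  (\<open>ev_eq_0_iff\<close>): polynomials in \<open>x\<close> whose coefficients are polynomials in \<open>l\<close> are evaluated by \<open>ev\<close>, and
  \<open>shift\<close> is the action of \<open>\<sigma>\<close> on them.
\<close>
locale q_difference_field = i: ring_map i + \<sigma>: ring_map \<sigma>
  for i :: "'f::field \<Rightarrow> 'b::field" and \<sigma> :: "'b \<Rightarrow> 'b" +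
  fixes \<kappa> :: 'f and x l :: 'b
  assumes char_0: "of_nat (Suc n) \<noteq> (0::'f)"
    and \<sigma>_i: "\<sigma> (i a) = i a"
    and \<sigma>_x: "\<sigma> x = i \<kappa> * x"
    and \<sigma>_l: "\<sigma> l = l + 1"
    and \<kappa>_0: "\<kappa> \<noteq> 0"
    and not_root_of_unity: "\<kappa> ^ Suc n \<noteq> 1"
    and x_0: "x \<noteq> 0"
begin

definition ev_l :: "'f poly \<Rightarrow> 'b" where
  "ev_l f = poly (map_poly i f) l"

definition ev :: "'f poly poly \<Rightarrow> 'b" where
  "ev p = poly (map_poly ev_l p) x"

definition shift :: "'f poly poly \<Rightarrow> 'f poly poly" where
  "shift p = pcompose (map_poly (\<lambda>f. pcompose f [:1, 1:]) p) [:0, [:\<kappa>:]:]"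

sublocale ev_l: ring_map ev_l
  using i.poly_map_poly_ring_map[of l] by (simp add: ev_l_def[abs_def])

sublocale ev: ring_map ev
  using ev_l.poly_map_poly_ring_map[of x] by (simp add: ev_def[abs_def])

lemma ev_l_const [simp]: "ev_l [:c:] = i c"
  by (simp add: ev_l_def map_poly_pCons)

lemma ev_monom: "ev (Polynomial.monom f n) = ev_l f * x ^ n"
  by (simp add: ev_def map_poly_monom poly_monom)

lemma ev_smult: "ev (smult f p) = ev_l f * ev p"
  using ev.mult[of "[:f:]" p] by (simp add: ev_def map_poly_pCons)

lemma coeff_shift: "poly.coeff (shift p) k = smult (\<kappa> ^ k) (pcompose (poly.coeff p k) [:1, 1:])"
  by (simp add: shift_def coeff_pcompose_linear coeff_map_poly poly_const_pow)

lemma degree_shift: "degree (shift p) = degree p"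
proof -
  have "poly.coeff (shift p) k = 0 \<longleftrightarrow> poly.coeff p k = 0" for k
    using \<kappa>_0 by (simp add: coeff_shift pcompose_eq_0_iff)
  then show ?thesis
    by (metis (no_types, lifting) coeff_0 degree_le le_antisym coeff_eq_0 leI le_degree leading_coeff_0_iff)
qed

lemma ev_shift: "ev (shift p) = \<sigma> (ev p)"
proof -
  have 1: "ev_l (pcompose f [:1, 1:]) = \<sigma> (ev_l f)" for f
  proof -
    have "ev_l (pcompose f [:1, 1:]) = poly (map_poly i f) (1 + l)"
      by (simp add: ev_l_def i.map_poly_pcompose poly_pcompose map_poly_pCons)
    also have "map_poly i f = map_poly \<sigma> (map_poly i f)"
      by (simp add: map_poly_map_poly o_def \<sigma>_i)
    also have "poly \<dots> (1 + l) = \<sigma> (ev_l f)"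
      by (simp add: ev_l_def \<sigma>.ring_map_poly_eq \<sigma>_l add.commute)
    finally show ?thesis .
  qed
  have "ev (shift p) = poly (map_poly ev_l (map_poly (\<lambda>f. pcompose f [:1, 1:]) p)) (i \<kappa> * x)"
    by (simp add: ev_def shift_def ev_l.map_poly_pcompose poly_pcompose map_poly_pCons mult.commute)
  also have "map_poly ev_l (map_poly (\<lambda>f. pcompose f [:1, 1:]) p) = map_poly \<sigma> (map_poly ev_l p)"
    by (simp add: map_poly_map_poly o_def 1)
  finally show ?thesis by (simp add: ev_def \<sigma>.ring_map_poly_eq \<sigma>_x)
qed

lemma pow_inj: "\<kappa> ^ m = \<kappa> ^ n \<Longrightarrow> m = n"
proof (induction m n rule: linorder_wlog)
  case (le m n)
  show ?case
  proof (rule ccontr)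
    assume "m \<noteq> n"
    then obtain k where "n = m + Suc k" using le(1) less_imp_Suc_add[of m n] by auto
    then have "\<kappa> ^ m * 1 = \<kappa> ^ m * \<kappa> ^ Suc k" using le(2) by (metis mult_1_right power_add)
    then show False using \<kappa>_0 not_root_of_unity[of k] by (metis mult_left_cancel power_not_zero)
  qed
qed simp

lemma lead_coeff_shift1: "lead_coeff (pcompose f [:1, 1:]) = lead_coeff f" for f :: "'f poly"
  by (simp add: lead_coeff_comp)

lemma degree_shift1: "degree (pcompose f [:1, 1:]) = degree f" for f :: "'f poly"
  by (simp add: degree_pcompose)

text \<open>
  Leading coefficients in \<open>l\<close> exclude all powers of \<open>x\<close> but one, because the powers of \<open>\<kappa>\<close> are
  distinct; a polynomial invariant under \<open>l \<mapsto> l + 1\<close> is constant.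
\<close>
lemma shift_eigenvector:
  assumes "shift p = smult [:\<kappa> ^ n:] p"
  shows "\<exists>c. p = Polynomial.monom [:c:] n"
proof -
  have eq: "smult (\<kappa> ^ k) (pcompose (poly.coeff p k) [:1, 1:]) = smult (\<kappa> ^ n) (poly.coeff p k)" for k
    using arg_cong[OF assms, of "\<lambda>p. poly.coeff p k"] by (simp add: coeff_shift)
  have zero: "poly.coeff p k = 0" if "k \<noteq> n" for k
  proof (rule ccontr)
    assume nz: "poly.coeff p k \<noteq> 0"
    have "\<kappa> ^ k * lead_coeff (poly.coeff p k) = \<kappa> ^ n * lead_coeff (poly.coeff p k)"
      using arg_cong[OF eq[of k], of lead_coeff] \<kappa>_0 by (simp add: lead_coeff_shift1)
    then show False using nz pow_inj that by simp
  qed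
  have "pcompose (poly.coeff p n) [:1, 1:] = poly.coeff p n"
  proof -
    have "smult (inverse (\<kappa> ^ n)) (smult (\<kappa> ^ n) (pcompose (poly.coeff p n) [:1, 1:])) =
      smult (inverse (\<kappa> ^ n)) (smult (\<kappa> ^ n) (poly.coeff p n))"
      by (simp only: eq)
    then show ?thesis using \<kappa>_0 by simp
  qed
  then obtain c where "poly.coeff p n = [:c:]"
    using shift_invariant_const char_0 by blast
  then have "p = Polynomial.monom [:c:] n"
    using zero by (intro poly_eqI) (auto simp: coeff_monom)
  then show ?thesis by blast
qed

definition weight :: "'f poly \<Rightarrow> nat" where
  "weight f = (if f = 0 then 0 else Suc (degree f))"

lemma weight_le_iff: "weight f \<le> n \<longleftrightarrow> (\<forall>k\<ge>n. poly.coeff f k = 0)"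
proof
  show "weight f \<le> n \<Longrightarrow> \<forall>k\<ge>n. poly.coeff f k = 0"
    by (auto simp: weight_def coeff_eq_0 split: if_splits)
  assume "\<forall>k\<ge>n. poly.coeff f k = 0"
  then show "weight f \<le> n"
    by (metis Suc_leI leading_coeff_0_iff not_le weight_def zero_le)
qed

text \<open>
  Replacing \<open>p\<close> by \<open>shift p - \<kappa>\<^sup>n p\<close>, with \<open>n\<close> the degree of \<open>p\<close>, lowers the degree of the
  leading coefficient and raises no degree; only an eigenvector resists.
\<close>

lemma shift_stable_ideal:
  assumes "p \<in> V" "p \<noteq> 0"
    and add: "\<And>p q. p \<in> V \<Longrightarrow> q \<in> V \<Longrightarrow> p + q \<in> V"
    and smult: "\<And>p f. p \<in> V \<Longrightarrow> smult f p \<in> V"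
    and shift: "\<And>p. p \<in> V \<Longrightarrow> shift p \<in> V"
  shows "\<exists>n. Polynomial.monom 1 n \<in> V"
  using assms(1,2)
proof (induction "\<Sum>k\<le>degree p. weight (poly.coeff p k)" arbitrary: p rule: less_induct)
  case less
  define n where "n = degree p"
  define r where "r = shift p + smult [:- (\<kappa> ^ n):] p"
  have "r \<in> V" unfolding r_def by (intro add smult shift less.prems)
  show ?case
  proof (cases "r = 0")
    case True
    then have "shift p = smult [:\<kappa> ^ n:] p"
      using smult_minus_left[of "[:\<kappa> ^ n:]" p] by (simp add: r_def)
    then obtain c where c: "p = Polynomial.monom [:c:] n" using shift_eigenvector by blast
    then have "c \<noteq> 0" using less.prems(2) by auto
    then have "smult [:inverse c:] p = Polynomial.monom 1 n"
      by (simp add: c smult_monom one_pCons)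
    then show ?thesis using smult[OF less.prems(1), of "[:inverse c:]"] by metis
  next
    case False
    have coeff_r: "poly.coeff r k = smult (\<kappa> ^ k) (pcompose (poly.coeff p k) [:1, 1:])
        - smult (\<kappa> ^ n) (poly.coeff p k)" for k
      by (simp add: r_def coeff_shift)
    have w_le: "weight (poly.coeff r k) \<le> weight (poly.coeff p k)" for k
    proof -
      let ?f = "poly.coeff p k"
      have "weight (pcompose ?f [:1, 1:]) = weight ?f"
        by (simp add: weight_def degree_shift1 pcompose_eq_0_iff)
      then have "\<forall>j\<ge>weight ?f. poly.coeff (pcompose ?f [:1, 1:]) j = 0"
        using weight_le_iff by (metis order_refl)
      moreover have "\<forall>j\<ge>weight ?f. poly.coeff ?f j = 0"
        using weight_le_iff by (metis order_refl)
      ultimately show ?thesis unfolding weight_le_iff coeff_r by simp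
    qed
    have w_less: "weight (poly.coeff r n) < weight (poly.coeff p n)"
    proof -
      let ?f = "poly.coeff p n"
      have nz: "?f \<noteq> 0" using less.prems(2) by (simp add: n_def)
      have "poly.coeff (pcompose ?f [:1, 1:]) (degree ?f) = lead_coeff ?f"
        using lead_coeff_shift1[of ?f] by (simp add: degree_shift1)
      then have "poly.coeff (poly.coeff r n) (degree ?f) = 0" by (simp add: coeff_r)
      moreover have "\<forall>k\<ge>Suc (degree ?f). poly.coeff (poly.coeff r n) k = 0"
        using w_le[of n] nz weight_le_iff[of "poly.coeff r n" "Suc (degree ?f)"]
        by (simp add: weight_def[of ?f])
      ultimately have "weight (poly.coeff r n) \<le> degree ?f"
        unfolding weight_le_iff by (metis le_neq_implies_less Suc_leI)
      then show ?thesis using nz by (simp add: weight_def)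
    qed
    have deg: "degree r \<le> n"
      by (rule degree_le) (auto simp: coeff_r n_def coeff_eq_0)
    have "(\<Sum>k\<le>degree r. weight (poly.coeff r k)) \<le> (\<Sum>k\<le>n. weight (poly.coeff r k))"
      using deg by (intro sum_mono2) auto
    also have "\<dots> < (\<Sum>k\<le>n. weight (poly.coeff p k))"
      using w_le w_less by (intro sum_strict_mono_ex1) auto
    finally show ?thesis
      using less.hyps[OF _ \<open>r \<in> V\<close> False] by (simp add: n_def)
  qed
qed

lemma ev_eq_0_iff: "ev p = 0 \<longleftrightarrow> p = 0"
proof
  assume p: "ev p = 0"
  show "p = 0"
  proof (rule ccontr)
    assume "p \<noteq> 0"
    then have "\<exists>n. Polynomial.monom 1 n \<in> {p. ev p = 0}"
      using p by (intro shift_stable_ideal[of p]) (simp_all add: ev_smult ev_shift)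
    then show False using x_0 by (auto simp: ev_monom)
  qed
qed simp

lemma ev_inj: "p = q" if "ev p = ev q"
proof -
  have "ev (p - q) = 0" using that by simp
  then show ?thesis by (simp only: ev_eq_0_iff right_minus_eq)
qed

text \<open>
  The denominators of \<open>b\<close> form an ideal that is stable under \<open>shift\<close>, so a power of \<open>x\<close> is among them.
  Comparing degrees in \<open>x\<close> gives \<open>m = n\<close>, and the numerator is an eigenvector of \<open>shift\<close>.
\<close>
lemma eigenvector_in_constants:
  assumes eigen: "\<sigma> b * (i \<kappa> * x) ^ m = b * (i \<kappa> * x) ^ n"
    and fraction: "ev v \<noteq> 0" "b = ev u / ev v" and b: "b \<noteq> 0"
  shows "m = n \<and> b \<in> range i"
proof -
  have i\<kappa>: "i \<kappa> \<noteq> 0" using \<kappa>_0 ring_map_eq_0_iff[OF i.ring_map_axioms] by simp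
  have x_pow: "x ^ k = ev (Polynomial.monom 1 k)" for k
    by (simp add: ev_monom)
  define V where "V = {v. \<exists>u k. ev v * b * x ^ k = ev u}"
  have "\<exists>k. Polynomial.monom 1 k \<in> V"
  proof (rule shift_stable_ideal)
    show "v \<in> V"
      unfolding V_def using fraction by (intro CollectI exI[of _ u] exI[of _ 0]) simp
    show "v \<noteq> 0" using fraction(1) by auto
    fix p assume "p \<in> V"
    then obtain u k where p: "ev p * b * x ^ k = ev u" unfolding V_def by blast
    show "smult f p \<in> V" for f
      unfolding V_def
      by (intro CollectI exI[of _ "smult f u"] exI[of _ k]) (simp add: ev_smult mult.assoc flip: p)
    show "shift p \<in> V"
    proof -
      have "\<sigma> (ev p) * \<sigma> b * (i \<kappa> * x) ^ k = \<sigma> (ev u)"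
        by (simp add: \<sigma>_x \<sigma>_i flip: p)
      then have "ev (shift p) * (\<sigma> b * (i \<kappa> * x) ^ m) * (i \<kappa> * x) ^ k = ev (shift u) * (i \<kappa> * x) ^ m"
        by (simp add: ev_shift mult.assoc mult.left_commute)
      then have "ev (shift p) * b * x ^ (n + k) * i \<kappa> ^ (n + k) = ev (shift u) * i \<kappa> ^ m * x ^ m"
        unfolding eigen by (simp add: power_mult_distrib power_add mult_ac)
      then have "ev (shift p) * b * x ^ (n + k) = ev (shift u) * i \<kappa> ^ m * x ^ m * i (inverse \<kappa>) ^ (n + k)"
      proof -
        have "i \<kappa> ^ (n + k) * i (inverse \<kappa>) ^ (n + k) = 1"
          using i\<kappa> by (simp add: ring_map_inverse[OF i.ring_map_axioms] flip: power_mult_distrib)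
        moreover have "B * i (inverse \<kappa>) ^ (n + k) = A * (i \<kappa> ^ (n + k) * i (inverse \<kappa>) ^ (n + k))"
          if "A * i \<kappa> ^ (n + k) = B" for A B
          using that by (simp add: mult.assoc)
        ultimately show ?thesis
          using \<open>ev (shift p) * b * x ^ (n + k) * i \<kappa> ^ (n + k) = _\<close> by (metis mult_1_right)
      qed
      also have "\<dots> = ev (smult [:\<kappa> ^ m * inverse \<kappa> ^ (n + k):] (shift u * Polynomial.monom 1 m))"
        by (simp add: ev_smult ev_monom mult_ac)
      finally show ?thesis unfolding V_def by blast
    qed
    fix p' assume "p' \<in> V"
    then obtain u' k' where p': "ev p' * b * x ^ k' = ev u'" unfolding V_def by blast
    have "ev (p + p') * b * x ^ (k + k') = (ev p * b * x ^ k) * x ^ k' + (ev p' * b * x ^ k') * x ^ k"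
      by (simp add: algebra_simps power_add)
    also have "\<dots> = ev (u * Polynomial.monom 1 k' + u' * Polynomial.monom 1 k)"
      unfolding p p' by (simp add: x_pow)
    finally show "p + p' \<in> V" unfolding V_def by blast
  qed
  then obtain j u k where "x ^ j * b * x ^ k = ev u"
    unfolding V_def by (auto simp: ev_monom)
  then have u: "b * x ^ (j + k) = ev u" by (simp add: power_add mult_ac)
  define N where "N = j + k"
  have u0: "u \<noteq> 0" using u b x_0 by auto
  have "\<sigma> b * (i \<kappa> * x) ^ N = \<sigma> (ev u)"
    using arg_cong[OF u, of \<sigma>] by (simp add: \<sigma>_x N_def)
  then have "(\<sigma> b * (i \<kappa> * x) ^ m) * (i \<kappa> * x) ^ N = ev (shift u) * (i \<kappa> * x) ^ m"
    by (simp add: ev_shift mult_ac)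
  then have "(b * x ^ N) * i \<kappa> ^ (n + N) * x ^ n = ev (shift u) * i \<kappa> ^ m * x ^ m"
    unfolding eigen by (simp add: power_mult_distrib power_add mult_ac)
  then have "ev (smult [:\<kappa> ^ (n + N):] (u * Polynomial.monom 1 n)) =
      ev (smult [:\<kappa> ^ m:] (shift u * Polynomial.monom 1 m))"
    using u by (simp add: ev_smult ev_monom N_def mult_ac)
  then have eq: "smult [:\<kappa> ^ (n + N):] (u * Polynomial.monom 1 n) =
      smult [:\<kappa> ^ m:] (shift u * Polynomial.monom 1 m)"
    by (rule ev_inj)
  have "shift u \<noteq> 0"
    using u0 ev_eq_0_iff[of "shift u"] ev_eq_0_iff[of u] ring_map_eq_0_iff[OF \<sigma>.ring_map_axioms, of "ev u"]
    unfolding ev_shift by metis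
  moreover have "degree (smult [:c:] (r * Polynomial.monom 1 k)) = degree r + k"
    if "c \<noteq> 0" "r \<noteq> 0" for c k and r :: "'f poly poly"
  proof -
    have "[:c:] \<noteq> 0" "Polynomial.monom (1 :: 'f poly) k \<noteq> 0" using that by (simp_all add: monom_eq_0_iff)
    then show ?thesis using that by (simp add: degree_mult_eq degree_monom_eq)
  qed
  ultimately have "degree u + n = degree u + m"
    using arg_cong[OF eq, of degree] u0 \<kappa>_0 degree_shift[of u] by (metis power_not_zero)
  then have mn: "m = n" by simp
  have "smult [:\<kappa> ^ (n + N):] u * Polynomial.monom 1 n = smult [:\<kappa> ^ n:] (shift u) * Polynomial.monom 1 n"
    using eq mn by simp
  moreover have "Polynomial.monom (1 :: 'f poly) n \<noteq> 0" by (simp add: monom_eq_0_iff)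
  ultimately have "smult [:\<kappa> ^ (n + N):] u = smult [:\<kappa> ^ n:] (shift u)"
    using mult_right_cancel by blast
  then have "smult [:inverse \<kappa> ^ n:] (smult [:\<kappa> ^ (n + N):] u) = smult [:inverse \<kappa> ^ n:] (smult [:\<kappa> ^ n:] (shift u))"
    by simp
  moreover have "inverse \<kappa> ^ n * \<kappa> ^ (n + N) = \<kappa> ^ N" "inverse \<kappa> ^ n * \<kappa> ^ n = 1"
    using \<kappa>_0 by (simp_all add: power_add power_inverse)
  ultimately have "shift u = smult [:\<kappa> ^ N:] u"
    by (simp add: mult.commute flip: one_pCons)
  then obtain c where "u = Polynomial.monom [:c:] N" using shift_eigenvector by blast
  then have "b * x ^ N = i c * x ^ N" using u by (simp add: N_def ev_monom)
  then have "b = i c" using x_0 by simp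
  then show ?thesis using mn by blast
qed

end

section \<open>Picard-Vessiot rings of rank one\<close>

text \<open>
  In the application \<open>zi\<close> is inverse to \<open>z\<close>; two natural exponents stand for one integer exponent.
\<close>
inductive_set span ::
  "('b \<Rightarrow> 'l::comm_ring_1) \<Rightarrow> 'l \<Rightarrow> 'l \<Rightarrow> 'l set \<Rightarrow> 'l set" for \<eta> z zi V where
  zero: "0 \<in> span \<eta> z zi V"
| step: "s \<in> span \<eta> z zi V \<Longrightarrow> v \<in> V \<Longrightarrow> s + v * \<eta> b * z ^ m * zi ^ n \<in> span \<eta> z zi V"

lemma span_term: "v \<in> V \<Longrightarrow> v * \<eta> b * z ^ m * zi ^ n \<in> span \<eta> z zi V"
  using span.step[OF span.zero] by fastforce

lemma span_add: "s \<in> span \<eta> z zi V \<Longrightarrow> t \<in> span \<eta> z zi V \<Longrightarrow> s + t \<in> span \<eta> z zi V"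
proof -
  assume "s \<in> span \<eta> z zi V" "t \<in> span \<eta> z zi V"
  from this(2,1) show ?thesis
  proof (induction rule: span.induct)
    case (step t v b m n)
    then show ?case using span.step[of "s + t"] by (simp add: add.assoc)
  qed simp
qed

lemma span_mono: "V \<subseteq> W \<Longrightarrow> span \<eta> z zi V \<subseteq> span \<eta> z zi W"
proof
  fix s assume "V \<subseteq> W" "s \<in> span \<eta> z zi V"
  from this(2,1) show "s \<in> span \<eta> z zi W"
    by (induction rule: span.induct) (auto intro: span.intros)
qed

lemma span_mult:
  assumes "ring_map \<eta>" "\<And>v w. v \<in> V \<Longrightarrow> w \<in> W \<Longrightarrow> v * w \<in> U"
    and "s \<in> span \<eta> z zi V" "t \<in> span \<eta> z zi W"
  shows "s * t \<in> span \<eta> z zi U"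
  using assms(3)
proof (induction rule: span.induct)
  case (step s v b m n)
  interpret ring_map \<eta> by fact
  have "v * \<eta> b * z ^ m * zi ^ n * t \<in> span \<eta> z zi U"
    using assms(4)
  proof (induction rule: span.induct)
    case (step t w c k j)
    have "v * w * \<eta> (b * c) * z ^ (m + k) * zi ^ (n + j) \<in> span \<eta> z zi U"
      using assms(2) step.hyps \<open>v \<in> V\<close> by (intro span_term)
    from span_add[OF step.IH this] show ?case by (simp add: algebra_simps power_add)
  qed (simp add: span.zero)
  with step.IH show ?case by (simp add: distrib_right span_add)
qed (simp add: span.zero)

lemma span_minus: "- s \<in> span \<eta> z zi V" if "ring_map \<eta>" "s \<in> span \<eta> z zi V"
  using that(2)
proof (induction rule: span.induct)
  case (step s v b m n)
  then show ?case using span.step[OF step.IH \<open>v \<in> V\<close>, of "- b" m n] by (simp add: ring_map.minus[OF that(1)])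
qed (simp add: span.zero)

definition list_value :: "('b \<Rightarrow> 'l::comm_ring_1) \<Rightarrow> 'l \<Rightarrow> 'l \<Rightarrow> ('l \<times> 'b \<times> nat \<times> nat) list \<Rightarrow> 'l" where
  "list_value \<eta> z zi xs = (\<Sum>(v, b, m, n)\<leftarrow>xs. v * \<eta> b * z ^ m * zi ^ n)"

lemma span_list:
  assumes "s \<in> span \<eta> z zi V"
  shows "\<exists>xs. s = list_value \<eta> z zi xs \<and> fst ` set xs \<subseteq> V"
  using assms
proof (induction rule: span.induct)
  case zero
  show ?case by (rule exI[of _ "[]"]) (simp add: list_value_def)
next
  case (step s v b m n)
  then obtain xs where "s = list_value \<eta> z zi xs" "fst ` set xs \<subseteq> V" by blast
  then show ?case
    using step.hyps by (intro exI[of _ "(v, b, m, n) # xs"]) (simp add: list_value_def add.commute)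
qed

lemma ring_ring_on:
  assumes "1 \<in> S" "\<And>x y. x \<in> S \<Longrightarrow> y \<in> S \<Longrightarrow> x + y \<in> S"
    "\<And>x y. x \<in> S \<Longrightarrow> y \<in> S \<Longrightarrow> x * y \<in> S" "\<And>x. x \<in> S \<Longrightarrow> - x \<in> S"
  shows "ring (ring_on S)"
proof -
  have 0: "0 \<in> S" using assms(2)[OF assms(1) assms(4)[OF assms(1)]] by simp
  show ?thesis
  proof (rule ringI)
    show "abelian_group (ring_on S)"
    proof (rule abelian_groupI)
      fix x assume "x \<in> carrier (ring_on S)"
      then show "\<exists>y\<in>carrier (ring_on S). y \<oplus>\<^bsub>ring_on S\<^esub> x = \<zero>\<^bsub>ring_on S\<^esub>"
        using assms(4) by (intro bexI[of _ "- x"]) (simp_all add: ring_on_def)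
    qed (use assms 0 in \<open>simp_all add: ring_on_def algebra_simps\<close>)
    show "monoid (ring_on S)"
      by (rule monoidI) (use assms in \<open>simp_all add: ring_on_def algebra_simps\<close>)
  qed (use assms in \<open>simp_all add: ring_on_def algebra_simps\<close>)
qed

lemma ideal_ring_on:
  assumes "ring (ring_on S)" "I \<subseteq> S" "0 \<in> I" "\<And>x y. x \<in> I \<Longrightarrow> y \<in> I \<Longrightarrow> x + y \<in> I"
    "\<And>x. x \<in> I \<Longrightarrow> - x \<in> I" "\<And>x a. x \<in> I \<Longrightarrow> a \<in> S \<Longrightarrow> a * x \<in> I"
  shows "ideal I (ring_on S)"
proof (rule idealI)
  interpret ring "ring_on S" by fact
  show "subgroup I (add_monoid (ring_on S))"
  proof (rule add.subgroupI)
    show "I \<subseteq> carrier (ring_on S)" "I \<noteq> {}" using assms(2,3) by (auto simp: ring_on_def)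
    fix a assume a: "a \<in> I"
    have "\<ominus>\<^bsub>ring_on S\<^esub> a = - a"
      using minus_equality[of "- a" a] a assms(2) assms(5)[OF a] by (auto simp: ring_on_def)
    then show "\<ominus>\<^bsub>ring_on S\<^esub> a \<in> I" using assms(5)[OF a] by simp
    show "a \<oplus>\<^bsub>ring_on S\<^esub> b \<in> I" if "b \<in> I" for b
      using a that assms(4) by (simp add: ring_on_def)
  qed
qed (use assms in \<open>auto simp: ring_on_def mult.commute\<close>)

lemma full_ring_ops:
  fixes a b :: "'a::comm_ring_1"
  shows "\<one>\<^bsub>full_ring\<^esub> = (1::'a)" "\<zero>\<^bsub>full_ring\<^esub> = (0::'a)" "a \<oplus>\<^bsub>full_ring\<^esub> b = a + b"
    "a \<otimes>\<^bsub>full_ring\<^esub> b = a * b" "\<ominus>\<^bsub>full_ring\<^esub> a = - a"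
proof -
  interpret ring "full_ring :: 'a ring" by (rule ring_ring_on) simp_all
  show "\<ominus>\<^bsub>full_ring\<^esub> a = - a" using minus_equality[of "- a" a] by (simp add: ring_on_def)
qed (simp_all add: ring_on_def)

lemma subring_full_ring:
  "subring S full_ring \<longleftrightarrow> 1 \<in> S \<and> (\<forall>x\<in>S. \<forall>y\<in>S. x + y \<in> S \<and> x * y \<in> S \<and> - x \<in> S)"
  for S :: "'a::comm_ring_1 set"
proof -
  interpret ring "full_ring :: 'a ring" by (rule ring_ring_on) simp_all
  have neg: "\<ominus>\<^bsub>full_ring\<^esub> a = - a" for a :: 'a
    by (rule full_ring_ops)
  show ?thesis
  proof
    assume S: "subring S full_ring"
    show "1 \<in> S \<and> (\<forall>x\<in>S. \<forall>y\<in>S. x + y \<in> S \<and> x * y \<in> S \<and> - x \<in> S)"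
      using subringE(3,5,6,7)[OF S] by (simp add: neg) (simp add: ring_on_def)
  next
    assume "1 \<in> S \<and> (\<forall>x\<in>S. \<forall>y\<in>S. x + y \<in> S \<and> x * y \<in> S \<and> - x \<in> S)"
    then show "subring S full_ring"
      by (intro subringI) (auto simp: neg, auto simp: ring_on_def)
  qed
qed

locale rank_one_extension =
  q_difference_field i \<sigma>B \<kappa> x l + rank_one_picard_vessiot \<sigma>B dB "i \<kappa> * x" \<eta> R \<sigma>L dL z zi
  for i :: "'f::field \<Rightarrow> 'b::field" and \<sigma>B dB :: "'b \<Rightarrow> 'b" and \<kappa> x l
    and \<eta> :: "'b \<Rightarrow> 'l::comm_ring_1" and R \<sigma>L dL z zi +
  fixes D :: "'f \<Rightarrow> 'f"
  assumes D: "ring_deriv D" and dB: "ring_deriv dB"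
    and dB_i: "dB (i a) = i (D a)"
    and dB_solution: "dB (i \<kappa> * x) = (l + 1) * (i \<kappa> * x)"
    and fractions_B: "\<exists>u v. ev v \<noteq> 0 \<and> b = ev u / ev v"
begin

definition a where "a = i \<kappa> * x"

definition y where "y = dL z * zi"

text \<open>
  Both \<open>y\<close> and \<open>(l\<^sup>2 + l) / 2\<close> solve \<open>\<sigma>(u) = u + l + 1\<close>, so \<open>w\<close> is invariant.
\<close>
definition w where "w = 2 * y - \<eta> (l\<^sup>2 + l)"

sublocale \<eta>: ring_map \<eta> using \<eta>_hom by (simp add: ring_map_iff)
sublocale \<sigma>L: ring_map \<sigma>L using \<sigma>L_hom by (simp add: ring_map_iff)
sublocale dL: ring_deriv dL using dL_derivation by (simp add: deriv_iff)
sublocale dB: ring_deriv dB by (rule dB)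
sublocale D: ring_deriv D by (rule D)

lemma a_0: "a \<noteq> 0"
  using \<kappa>_0 x_0 ring_map_eq_0_iff[OF i.ring_map_axioms] by (simp add: a_def)

lemma zi_z: "zi * z = 1"
  using z_inverse by (simp add: mult.commute)

lemma \<eta>_inverse: "b \<noteq> 0 \<Longrightarrow> \<eta> b * \<eta> (inverse b) = 1"
  by (simp flip: \<eta>.mult)

lemma \<sigma>L_z: "\<sigma>L z = \<eta> a * z"
  using z_solution by (simp add: a_def)

lemma \<sigma>L_zi: "\<sigma>L zi = \<eta> (inverse a) * zi"
proof -
  have "\<eta> a * z * \<sigma>L zi = 1"
    using arg_cong[OF z_inverse, of \<sigma>L] by (simp add: \<sigma>L_z)
  then have "\<eta> (inverse a) * zi * (\<eta> a * z * \<sigma>L zi) = \<eta> (inverse a) * zi" by simp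
  moreover have "\<eta> (inverse a) * zi * (\<eta> a * z * \<sigma>L zi) = (\<eta> a * \<eta> (inverse a)) * (z * zi) * \<sigma>L zi"
    by (simp add: mult_ac)
  ultimately show ?thesis by (simp add: \<eta>_inverse[OF a_0] z_inverse)
qed

lemma \<sigma>L_constant: "\<sigma>L (\<eta> (i c)) = \<eta> (i c)"
  by (simp add: \<sigma>L_\<eta> \<sigma>_i)

lemma dL_z: "dL z = y * z"
  using zi_z by (simp add: y_def mult.assoc)

lemma dL_zi: "dL zi = - y * zi"
  using dL.inverse_unit[OF z_inverse] by (simp add: y_def)

lemma dL_power: "dL (z ^ m) = of_nat m * y * z ^ m" "dL (zi ^ m) = - of_nat m * y * zi ^ m"
  by (induction m) (simp_all add: dL_z dL_zi algebra_simps)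

lemma \<sigma>L_y: "\<sigma>L y = y + \<eta> (l + 1)"
proof -
  have "\<sigma>L y = dL (\<eta> a * z) * (\<eta> (inverse a) * zi)"
    by (simp add: y_def \<sigma>L_dL \<sigma>L_z \<sigma>L_zi)
  also have "dL (\<eta> a) = \<eta> (l + 1) * \<eta> a"
  proof -
    have "dL (\<eta> a) = \<eta> (dB a)" by (rule dL_\<eta>)
    also have "dB a = (l + 1) * a" unfolding a_def by (rule dB_solution)
    finally show ?thesis by (simp only: \<eta>.mult)
  qed
  then have "dL (\<eta> a * z) = (\<eta> a * z) * (\<eta> (l + 1) + y)"
    by (simp add: dL_z algebra_simps)
  also have "(\<eta> a * z) * (\<eta> (l + 1) + y) * (\<eta> (inverse a) * zi) =
      (\<eta> a * \<eta> (inverse a)) * (z * zi) * (\<eta> (l + 1) + y)"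
    by (simp only: mult_ac)
  finally show ?thesis by (simp add: \<eta>_inverse[OF a_0] z_inverse)
qed

lemma \<sigma>L_w: "\<sigma>L w = w"
  by (simp add: w_def \<sigma>L_y \<sigma>L_\<eta> \<sigma>_l power2_eq_square algebra_simps)

text \<open>
  If some coefficient of the sum \<open>c\<close> below is not \<open>\<sigma>\<close>-invariant, the equation
  \<open>\<sigma>(c) - c = 0\<close> expresses one of its terms by the others and the sum can be shortened.
\<close>

lemma invariant_in_span:
  assumes V: "0 \<in> V" "\<And>u v. u \<in> V \<Longrightarrow> v \<in> V \<Longrightarrow> u + v \<in> V" "\<And>f v. v \<in> V \<Longrightarrow> \<eta> (i f) * v \<in> V"
    "\<And>v. v \<in> V \<Longrightarrow> \<sigma>L v = v"
    and c: "\<sigma>L c = c" "c \<in> span \<eta> z zi V"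
  shows "c \<in> V"
proof -
  let ?val = "list_value \<eta> z zi"
  have "c \<in> V" if "c = ?val xs" "fst ` set xs \<subseteq> V" for xs
    using that
  proof (induction "length xs" arbitrary: xs rule: less_induct)
    case less
    \<comment> \<open>the coefficient of the term of \<open>\<sigma>(c) - c\<close> that comes from \<open>v b z\<^sup>m zi\<^sup>n\<close>\<close>
    define \<beta> where "\<beta> b m n = \<sigma>B b * a ^ m * inverse a ^ n - b" for b m n
    have shift: "?val (map (\<lambda>(v, b, m, n). (v, \<beta> b m n, m, n)) ys) = \<sigma>L (?val ys) - ?val ys"
      if "fst ` set ys \<subseteq> V" for ys
      using that
      by (induction ys) (auto simp: list_value_def \<beta>_def V(4) \<sigma>L_\<eta> \<sigma>L_z \<sigma>L_zi power_mult_distrib algebra_simps)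
    show ?case
    proof (cases "\<exists>(v, b, m, n)\<in>set xs. \<beta> b m n \<noteq> 0")
      case False
      have "v * \<eta> b * z ^ m * zi ^ n \<in> V" if "(v, b, m, n) \<in> set xs" for v b m n
      proof (cases "b = 0")
        case nz: False
        have "\<beta> b m n = 0" using False that by blast
        then have "\<sigma>B b * a ^ m * inverse a ^ n = b" by (simp add: \<beta>_def)
        then have "\<sigma>B b * a ^ m * (inverse a ^ n * a ^ n) = b * a ^ n" by (metis mult.assoc)
        then have "\<sigma>B b * (i \<kappa> * x) ^ m = b * (i \<kappa> * x) ^ n"
          using a_0 unfolding a_def[symmetric] by (simp add: power_inverse)
        moreover obtain p p' where "ev p \<noteq> 0" "b = ev p' / ev p" using fractions_B by blast
        ultimately have "m = n" "b \<in> range i" using eigenvector_in_constants nz by blast+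
        then obtain f where "b = i f" "m = n" by blast
        then have "v * \<eta> b * z ^ m * zi ^ n = \<eta> (i f) * v * (z ^ n * zi ^ n)"
          by (simp only: mult_ac)
        also have "z ^ n * zi ^ n = 1" by (simp add: z_inverse flip: power_mult_distrib)
        finally have "v * \<eta> b * z ^ m * zi ^ n = \<eta> (i f) * v" by (simp only: mult_1_right)
        then show ?thesis using V(3) that less.prems(2) by force
      qed (simp add: V(1))
      then have "?val xs \<in> V"
        unfolding list_value_def using V(1,2) by (induction xs) auto
      then show ?thesis using less.prems(1) by simp
    next
      case True
      then obtain v0 b0 m0 n0 where e: "(v0, b0, m0, n0) \<in> set xs" "\<beta> b0 m0 n0 \<noteq> 0" by blast
      then obtain as bs where xs: "xs = as @ (v0, b0, m0, n0) # bs" by (meson split_list)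
      define \<beta>0 where "\<beta>0 = \<beta> b0 m0 n0"
      define T where "T = v0 * z ^ m0 * zi ^ n0"
      let ?B = "\<lambda>ys. ?val (map (\<lambda>(v, b, m, n). (v, \<beta> b m n, m, n)) ys)"
      have val_append: "?val (ys @ zs) = ?val ys + ?val zs" for ys zs
        by (simp add: list_value_def)
      have "?B xs = 0" using shift[OF less.prems(2)] c(1) less.prems(1) by simp
      then have rel: "?B (as @ bs) + \<eta> \<beta>0 * T = 0"
        by (simp add: xs val_append T_def \<beta>0_def) (simp add: list_value_def algebra_simps)
      have T: "T = - \<eta> (inverse \<beta>0) * ?B (as @ bs)"
      proof -
        have "\<eta> (inverse \<beta>0) * (?B (as @ bs) + \<eta> \<beta>0 * T) = 0" by (simp only: rel mult_zero_right)
        then have "\<eta> (inverse \<beta>0) * ?B (as @ bs) + (\<eta> \<beta>0 * \<eta> (inverse \<beta>0)) * T = 0"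
          by (simp only: distrib_left mult_ac)
        then have "\<eta> (inverse \<beta>0) * ?B (as @ bs) + T = 0"
          using e(2) by (simp add: \<eta>_inverse \<beta>0_def)
        then show ?thesis by (simp add: eq_neg_iff_add_eq_0 add.commute)
      qed
      define ys where "ys = map (\<lambda>(v, b, m, n). (v, b - b0 * inverse \<beta>0 * \<beta> b m n, m, n)) (as @ bs)"
      have "?val (map (\<lambda>(v, b, m, n). (v, b - b0 * inverse \<beta>0 * \<beta> b m n, m, n)) us) =
          ?val us - \<eta> b0 * \<eta> (inverse \<beta>0) * ?B us" for us
        by (induction us) (auto simp: list_value_def algebra_simps)
      note sub = this
      have "?val ys = ?val (as @ bs) + \<eta> b0 * T"
        unfolding ys_def sub T
        by (simp only: mult_minus_left mult_minus_right mult.assoc diff_conv_add_uminus)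
      also have "\<dots> = c"
        by (simp add: less.prems(1) xs val_append) (simp add: T_def list_value_def algebra_simps)
      finally have "c = ?val ys" by simp
      moreover have "fst ` set ys \<subseteq> V" using less.prems(2) unfolding xs ys_def by auto
      moreover have "length ys < length xs" by (simp add: xs ys_def)
      ultimately show ?thesis using less.hyps by blast
    qed
  qed
  then show ?thesis using span_list[OF c(2)] by blast
qed

lemma y_eq: "y = \<eta> (inverse 2) * w + \<eta> ((l\<^sup>2 + l) / 2)"
proof -
  have "i (of_nat (Suc 1)) \<noteq> 0"
    using char_0[of 1] ring_map_eq_0_iff[OF i.ring_map_axioms] by blast
  then have two: "(2::'b) \<noteq> 0" by simp
  have "\<eta> (inverse 2) * w = \<eta> (inverse 2) * \<eta> 2 * y - \<eta> (inverse 2 * (l\<^sup>2 + l))"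
    unfolding \<eta>.mult w_def by (simp add: algebra_simps)
  also have "\<eta> (inverse 2) * \<eta> 2 = 1" using \<eta>_inverse[OF two] by (simp only: mult.commute)
  finally have "\<eta> (inverse 2) * w = y - \<eta> (inverse 2 * (l\<^sup>2 + l))" by simp
  then show ?thesis
    by (simp only: divide_inverse mult.commute[of "l\<^sup>2 + l"] diff_add_cancel)
qed

lemma dL_span:
  assumes V: "\<And>v. v \<in> V \<Longrightarrow> dL v \<in> V" "\<And>v. v \<in> V \<Longrightarrow> w * v \<in> V"
    and s: "s \<in> span \<eta> z zi V"
  shows "dL s \<in> span \<eta> z zi V"
  using s
proof (induction rule: span.induct)
  case (step s v b m n)
  define k :: 'b where "k = of_nat m - of_nat n"
  have "dL (v * \<eta> b * z ^ m * zi ^ n) =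
      dL v * \<eta> b * z ^ m * zi ^ n + v * \<eta> (dB b) * z ^ m * zi ^ n + v * \<eta> (b * k) * y * z ^ m * zi ^ n"
    by (simp add: dL_power dL_\<eta> k_def algebra_simps)
  also have "v * \<eta> (b * k) * y * z ^ m * zi ^ n =
      (w * v) * \<eta> (b * k * inverse 2) * z ^ m * zi ^ n
      + v * \<eta> (b * k * ((l\<^sup>2 + l) / 2)) * z ^ m * zi ^ n"
    unfolding y_eq \<eta>.mult by (simp only: distrib_left distrib_right mult_ac)
  finally have "dL (v * \<eta> b * z ^ m * zi ^ n) \<in> span \<eta> z zi V"
    using V[OF \<open>v \<in> V\<close>] \<open>v \<in> V\<close> by (simp only:) (intro span_add span_term)
  then show ?case using step.IH by (simp add: span_add)
qed (simp add: span.zero)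

lemma R_subring: "1 \<in> R" "u \<in> R \<Longrightarrow> v \<in> R \<Longrightarrow> u + v \<in> R" "u \<in> R \<Longrightarrow> v \<in> R \<Longrightarrow> u * v \<in> R"
  "u \<in> R \<Longrightarrow> - u \<in> R" "\<eta> b \<in> R" "z \<in> R" "zi \<in> R" "u \<in> R \<Longrightarrow> dL u \<in> R" "u \<in> R \<Longrightarrow> \<sigma>L u \<in> R"
proof -
  have "subring R full_ring" using fractions unfolding total_ring_of_fractions_def by blast
  then show "1 \<in> R" "u \<in> R \<Longrightarrow> v \<in> R \<Longrightarrow> u + v \<in> R" "u \<in> R \<Longrightarrow> v \<in> R \<Longrightarrow> u * v \<in> R"
    "u \<in> R \<Longrightarrow> - u \<in> R" for u v
    unfolding subring_full_ring by blast+
  show "\<eta> b \<in> R" "z \<in> R" "zi \<in> R" by (subst R_generated, rule InterI, auto)+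
  show "u \<in> R \<Longrightarrow> dL u \<in> R" "u \<in> R \<Longrightarrow> \<sigma>L u \<in> R" for u using R_stable by blast+
qed

lemma ring_R: "ring (ring_on R)"
  by (rule ring_ring_on) (auto intro: R_subring)

lemma R_pow: "u \<in> R \<Longrightarrow> u ^ n \<in> R"
  by (induction n) (auto intro: R_subring)

lemma w_R: "w \<in> R"
proof -
  have "y \<in> R" unfolding y_def by (intro R_subring)
  then have "y + y + - \<eta> (l\<^sup>2 + l) \<in> R" by (intro R_subring)
  moreover have "w = y + y + - \<eta> (l\<^sup>2 + l)"
    unfolding w_def mult_2 by (rule diff_conv_add_uminus)
  ultimately show ?thesis by (simp only:)
qed

lemma span_R: "V \<subseteq> R \<Longrightarrow> span \<eta> z zi V \<subseteq> R"
proof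
  fix s assume "V \<subseteq> R" "s \<in> span \<eta> z zi V"
  from this(2,1) show "s \<in> R"
  proof (induction rule: span.induct)
    case zero
    show ?case using R_subring(2)[OF R_subring(1) R_subring(4)[OF R_subring(1)]] by simp
  next
    case (step s v b m n)
    then show ?case by (intro R_subring R_pow) auto
  qed
qed

definition W where "W = range (peval (\<lambda>f. \<eta> (i f)) (\<lambda>n. (dL ^^ n) w))"

lemma ring_map_\<eta>i: "ring_map (\<lambda>f. \<eta> (i f))"
  by (rule ring_map_comp[OF \<eta>.ring_map_axioms i.ring_map_axioms])

lemma W_closed: "u \<in> W \<Longrightarrow> v \<in> W \<Longrightarrow> u + v \<in> W" "u \<in> W \<Longrightarrow> v \<in> W \<Longrightarrow> u * v \<in> W"
  "\<eta> (i f) \<in> W" "w \<in> W" "u \<in> W \<Longrightarrow> dL u \<in> W"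
proof -
  let ?ev = "peval (\<lambda>f. \<eta> (i f)) (\<lambda>n. (dL ^^ n) w)"
  have I: "?ev t \<in> W" for t unfolding W_def by blast
  show "u + v \<in> W" "u * v \<in> W" if "u \<in> W" "v \<in> W"
  proof -
    from that obtain s t where "u = ?ev s" "v = ?ev t" unfolding W_def by blast
    then show "u + v \<in> W" "u * v \<in> W" using I[of "PAdd s t"] I[of "PMult s t"] by simp_all
  qed
  show "\<eta> (i f) \<in> W" "w \<in> W" using I[of "PConst f"] I[of "PVar 0"] by simp_all
  show "dL u \<in> W" if "u \<in> W"
  proof -
    from that obtain t where "u = ?ev t" unfolding W_def by blast
    moreover have "?ev (pdiff D t) = dL (?ev t)"
      by (rule peval_pdiff) (simp_all add: dL.ring_deriv_axioms dL_\<eta> dB_i)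
    ultimately show ?thesis using I by metis
  qed
qed

lemma W_properties: "u \<in> W \<Longrightarrow> \<sigma>L u = u" "u \<in> W \<Longrightarrow> u \<in> R"
proof -
  have "\<sigma>L ((dL ^^ n) w) = (dL ^^ n) w" "(dL ^^ n) w \<in> R" for n
    by (induction n) (simp_all add: \<sigma>L_w \<sigma>L_dL w_R R_subring)
  then have "\<sigma>L (peval (\<lambda>f. \<eta> (i f)) (\<lambda>n. (dL ^^ n) w) t) = peval (\<lambda>f. \<eta> (i f)) (\<lambda>n. (dL ^^ n) w) t"
    "peval (\<lambda>f. \<eta> (i f)) (\<lambda>n. (dL ^^ n) w) t \<in> R" for t
    by (induction t) (simp_all add: \<sigma>L_constant R_subring)
  then show "u \<in> W \<Longrightarrow> \<sigma>L u = u" "u \<in> W \<Longrightarrow> u \<in> R" unfolding W_def by blast+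
qed

lemma R_span_W: "R \<subseteq> span \<eta> z zi W"
proof -
  have one: "1 \<in> W" using W_closed(3)[of 1] by simp
  have tm: "\<eta> b * z ^ m * zi ^ n \<in> span \<eta> z zi W" for b m n
    using span_term[OF one, of \<eta> b z m zi n] by simp
  have "subring (span \<eta> z zi W) full_ring"
    unfolding subring_full_ring
  proof (intro conjI ballI)
    show "1 \<in> span \<eta> z zi W" using tm[of 1 0 0] by simp
    fix s t assume "s \<in> span \<eta> z zi W" "t \<in> span \<eta> z zi W"
    then show "s + t \<in> span \<eta> z zi W" "s * t \<in> span \<eta> z zi W" "- s \<in> span \<eta> z zi W"
      using span_mult[OF \<eta>.ring_map_axioms W_closed(2)] span_minus[OF \<eta>.ring_map_axioms]
      by (auto intro: span_add)
  qed
  moreover have "range \<eta> \<union> {z, zi} \<subseteq> span \<eta> z zi W"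
    using tm[of _ 0 0] tm[of 1 1 0] tm[of 1 0 1] by auto
  moreover have "dL ` span \<eta> z zi W \<subseteq> span \<eta> z zi W"
    using dL_span[of W] W_closed by blast
  ultimately show ?thesis by (subst R_generated) (rule Inter_lower, simp)
qed

lemma \<sigma>L_span:
  assumes "\<And>v. v \<in> V \<Longrightarrow> \<sigma>L v = v" "s \<in> span \<eta> z zi V"
  shows "\<sigma>L s \<in> span \<eta> z zi V"
  using assms(2)
proof (induction rule: span.induct)
  case (step s v b m n)
  have "\<sigma>L s + v * \<eta> (\<sigma>B b * a ^ m * inverse a ^ n) * z ^ m * zi ^ n \<in> span \<eta> z zi V"
    using step by (intro span.step)
  then show ?case
    using assms(1)[OF \<open>v \<in> V\<close>] by (simp add: \<sigma>L_\<eta> \<sigma>L_z \<sigma>L_zi power_mult_distrib mult_ac)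
qed (simp add: span.zero)

text \<open>
  A differential ideal \<open>J\<close> of \<open>W\<close> spans an ideal of \<open>R\<close> that is stable under \<open>\<sigma>\<close> and \<open>\<delta>\<close>. If it contained
  the invariant \<open>1\<close>, then so would \<open>J\<close>, by \<open>invariant_in_span\<close>.
\<close>
lemma simple_W: "simple_differential_extension (\<lambda>f. \<eta> (i f)) D dL w"
proof (intro simple_differential_extension.intro simple_differential_extension_axioms.intro)
  show "ring_map (\<lambda>f. \<eta> (i f))" "ring_deriv D" "ring_deriv dL"
    by (rule ring_map_\<eta>i D dL.ring_deriv_axioms)+
  show "of_nat (Suc n) \<noteq> (0::'f)" for n by (rule char_0)
  show "dL (\<eta> (i f)) = \<eta> (i (D f))" for f by (simp add: dL_\<eta> dB_i)
  fix J
  assume J: "0 \<in> J" "J \<subseteq> range (peval (\<lambda>f. \<eta> (i f)) (\<lambda>n. (dL ^^ n) w))"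
    "\<And>u v. u \<in> J \<Longrightarrow> v \<in> J \<Longrightarrow> u + v \<in> J"
    "\<And>u t. u \<in> J \<Longrightarrow> peval (\<lambda>f. \<eta> (i f)) (\<lambda>n. (dL ^^ n) w) t * u \<in> J"
    "\<And>u. u \<in> J \<Longrightarrow> dL u \<in> J" "1 \<notin> J"
  have JW: "J \<subseteq> W" "\<And>u v. u \<in> W \<Longrightarrow> v \<in> J \<Longrightarrow> u * v \<in> J"
    using J(2,4) unfolding W_def by auto
  have "ideal (span \<eta> z zi J) (ring_on R)"
  proof (rule ideal_ring_on[OF ring_R])
    show "span \<eta> z zi J \<subseteq> R" using JW(1) W_properties(2) by (intro span_R) blast
    show "r * s \<in> span \<eta> z zi J" if "s \<in> span \<eta> z zi J" "r \<in> R" for r s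
    proof -
      have "r \<in> span \<eta> z zi W" using R_span_W that(2) by blast
      from span_mult[OF \<eta>.ring_map_axioms JW(2) this that(1)] show ?thesis .
    qed
  qed (auto intro: span.zero span_add span_minus[OF \<eta>.ring_map_axioms])
  moreover have "\<sigma>L ` span \<eta> z zi J \<subseteq> span \<eta> z zi J"
    using \<sigma>L_span[of J] JW(1) W_properties(1) by blast
  moreover have "dL ` span \<eta> z zi J \<subseteq> span \<eta> z zi J"
    using dL_span[of J, OF J(5) JW(2)[OF W_closed(4)]] by blast
  ultimately have "span \<eta> z zi J = {0} \<or> span \<eta> z zi J = R" by (rule R_simple)
  moreover have "1 \<notin> span \<eta> z zi J"
  proof
    assume "1 \<in> span \<eta> z zi J"
    then have "1 \<in> J"
    proof (rule invariant_in_span[rotated 5])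
      show "\<sigma>L v = v" if "v \<in> J" for v using that JW(1) W_properties(1) by blast
      show "\<eta> (i f) * v \<in> J" if "v \<in> J" for f v using that JW(2)[OF W_closed(3)] by blast
    qed (use J in auto)
    then show False using J(6) by simp
  qed
  moreover have "J \<subseteq> span \<eta> z zi J"
    using span_term[of _ J \<eta> 1 z 0 zi 0] by auto
  ultimately show "J = {0}" using R_subring(1) J(1) by blast
qed

text \<open>
  Because \<open>w\<close> is a constant, \<open>y\<close> belongs to the base field and is fixed by \<open>\<phi>\<close>. So \<open>z\<close> and \<open>\<phi> z\<close> have the
  same logarithmic derivative, and \<open>g = \<phi> z / z\<close> has derivative \<open>0\<close>.
\<close>
theorem galois_group:
  assumes F: "diff2_closed (diff2_on UNIV D1 D c)"
  shows "rank_one_galois_group \<eta> \<sigma>L dL z zi \<subseteq> (\<lambda>c. \<eta> (i c)) ` {c. c \<noteq> 0 \<and> D c / c = 0}"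
proof
  fix g assume "g \<in> rank_one_galois_group \<eta> \<sigma>L dL z zi"
  then obtain \<phi> where g: "g = \<phi> z * zi" and \<phi>: "ring_map \<phi>" "\<And>b. \<phi> (\<eta> b) = \<eta> b"
    "\<And>u. \<phi> (\<sigma>L u) = \<sigma>L (\<phi> u)" "\<And>u. \<phi> (dL u) = dL (\<phi> u)"
    unfolding rank_one_galois_group_def difference_differential_automorphisms_def
    by (auto simp: ring_iso_def ring_map_iff)
  interpret \<phi>: ring_map \<phi> by fact
  interpret W: simple_differential_extension "\<lambda>f. \<eta> (i f)" D dL w by (rule simple_W)
  obtain f where f: "w = \<eta> (i f)"
    using W.generator_in_differentially_closed_base[OF F] by blast
  have y: "\<phi> y = y"
    unfolding y_eq f by (simp add: \<phi>(2))
  have W: "W \<subseteq> range (\<lambda>f. \<eta> (i f))"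
  proof -
    have iter: "(dL ^^ n) w = \<eta> (i ((D ^^ n) f))" for n
      by (induction n) (simp_all add: f dL_\<eta> dB_i)
    have "peval (\<lambda>f. \<eta> (i f)) (\<lambda>n. (dL ^^ n) w) t = \<eta> (i (peval (\<lambda>f. f) (\<lambda>n. (D ^^ n) f) t))" for t
      by (induction t) (simp_all add: iter)
    then show ?thesis unfolding W_def by blast
  qed
  have dL_g: "dL g = 0"
  proof -
    have "dL (\<phi> z) = y * \<phi> z" using \<phi>(4)[of z] by (simp add: dL_z y)
    then show ?thesis by (simp add: g dL_zi algebra_simps)
  qed
  have \<sigma>L_g: "\<sigma>L g = g"
  proof -
    have "\<sigma>L (\<phi> z) = \<eta> a * \<phi> z" using \<phi>(3)[of z] by (simp add: \<sigma>L_z \<phi>(2))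
    then have "\<sigma>L g = (\<eta> a * \<eta> (inverse a)) * (\<phi> z * zi)" by (simp add: g \<sigma>L_zi mult_ac)
    then show ?thesis by (simp add: \<eta>_inverse[OF a_0] g)
  qed
  \<comment> \<open>The denominators of \<open>g\<close> form an ideal, which is stable because \<open>g\<close> is invariant with derivative \<open>0\<close>.\<close>
  define V where "V = {v \<in> R. v * g \<in> R}"
  have "ideal V (ring_on R)"
    unfolding V_def
  proof (rule ideal_ring_on[OF ring_R])
    have "0 \<in> R" using R_subring(5)[of 0] by simp
    then show "0 \<in> {v \<in> R. v * g \<in> R}" by simp
  qed (auto simp: distrib_right mult.assoc intro: R_subring)
  moreover have "\<sigma>L ` V \<subseteq> V"
  proof clarify
    fix v assume v: "v \<in> V"
    then have "\<sigma>L (v * g) \<in> R" unfolding V_def by (blast intro: R_subring)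
    then show "\<sigma>L v \<in> V" using v by (simp add: V_def \<sigma>L_g R_subring)
  qed
  moreover have "dL ` V \<subseteq> V"
  proof clarify
    fix v assume v: "v \<in> V"
    then have "dL (v * g) \<in> R" unfolding V_def by (blast intro: R_subring)
    then show "dL v \<in> V" using v by (simp add: V_def dL_g R_subring)
  qed
  ultimately have "V = {0} \<or> V = R" by (rule R_simple)
  moreover have "V \<noteq> {0}"
  proof -
    obtain s t where st: "s \<in> R" "t \<in> R" "t dvd 1" "g * t = s"
      using fractions unfolding total_ring_of_fractions_def by blast
    then have "t \<in> V" by (simp add: V_def mult.commute)
    moreover have "t \<noteq> 0" using st(3) by auto
    ultimately show ?thesis by blast
  qed
  ultimately have "1 \<in> V" using R_subring(1) by blast
  then have "g \<in> R" by (simp add: V_def)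
  then have "g \<in> span \<eta> z zi (range (\<lambda>f. \<eta> (i f)))"
    using R_span_W span_mono[OF W] by blast
  have "g \<in> range (\<lambda>f. \<eta> (i f))"
  proof (rule invariant_in_span[OF _ _ _ _ \<sigma>L_g])
    show "0 \<in> range (\<lambda>f. \<eta> (i f))" by (rule range_eqI[of _ _ 0]) simp
    show "u + v \<in> range (\<lambda>f. \<eta> (i f))" if "u \<in> range (\<lambda>f. \<eta> (i f))" "v \<in> range (\<lambda>f. \<eta> (i f))" for u v
    proof -
      from that obtain p r where "u = \<eta> (i p)" "v = \<eta> (i r)" by blast
      then have "u + v = \<eta> (i (p + r))" by simp
      then show ?thesis by blast
    qed
    show "\<eta> (i f) * v \<in> range (\<lambda>f. \<eta> (i f))" if "v \<in> range (\<lambda>f. \<eta> (i f))" for f v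
    proof -
      from that obtain r where "v = \<eta> (i r)" by blast
      then have "\<eta> (i f) * v = \<eta> (i (f * r))" by simp
      then show ?thesis by blast
    qed
    show "\<sigma>L v = v" if "v \<in> range (\<lambda>f. \<eta> (i f))" for v
      using that \<sigma>L_constant by auto
  qed fact
  then obtain c where c: "g = \<eta> (i c)" by blast
  have "\<phi> z * \<phi> zi = 1" using arg_cong[OF z_inverse, of \<phi>] by simp
  then have "g * (z * \<phi> zi) = 1" using z_inverse by (simp add: g mult_ac)
  then have "c \<noteq> 0" using c by auto
  moreover have "D c = 0"
    using dL_g ring_map_eq_0_iff[OF ring_map_\<eta>i, of "D c"] by (simp add: c dL_\<eta> dB_i)
  ultimately show "g \<in> (\<lambda>c. \<eta> (i c)) ` {c. c \<noteq> 0 \<and> D c / c = 0}" using c by auto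
qed

end

section \<open>Summation over a complete non-archimedean field\<close>

lemma vabs_sum_less:
  fixes f :: "'i \<Rightarrow> 'c::nonarch_field"
  assumes "0 < e" "\<And>n. n \<in> A \<Longrightarrow> vabs (f n) < e"
  shows "vabs (sum f A) < e"
  using assms(2)
proof (induction A rule: infinite_finite_induct)
  case (insert n A)
  then have "max (vabs (f n)) (vabs (sum f A)) < e" by simp
  from le_less_trans[OF vabs_add this] show ?case using insert.hyps by simp
qed (use assms(1) vabs_eq_0_iff[of "0::'c"] in simp_all)

lemma dist_sum_vabs:
  fixes f :: "'i \<Rightarrow> 'c::nonarch_field"
  assumes "finite F" "G \<subseteq> F" "0 < e" "\<And>n. n \<in> F - G \<Longrightarrow> vabs (f n) < e"
  shows "dist (sum f F) (sum f G) < e"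
proof -
  have "sum f F - sum f G = sum f (F - G)"
    using assms(1,2) by (simp add: sum_diff finite_subset)
  then show ?thesis using vabs_sum_less[of e "F - G" f] assms(3,4) by (simp add: dist_vabs)
qed

text \<open>
  By the ultrametric inequality two partial sums differ by no more than the largest term that
  occurs in only one of them.
\<close>
theorem summable_on_iff_null:
  fixes f :: "'i \<Rightarrow> 'c::{nonarch_field,complete_space}"
  shows "f summable_on UNIV \<longleftrightarrow> (\<forall>e>0. finite {n. e \<le> vabs (f n)})"
proof
  assume "f summable_on UNIV"
  then obtain s where s: "(f has_sum s) UNIV" by (auto simp: summable_on_def)
  show "\<forall>e>0. finite {n. e \<le> vabs (f n)}"
  proof (intro allI impI)
    fix e :: real assume "0 < e"
    then have "0 < e / 2" by simp
    then have "eventually (\<lambda>F. dist (sum f F) s < e / 2) (finite_subsets_at_top UNIV)"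
      using s unfolding has_sum_def tendsto_iff by blast
    then obtain F where F: "finite F" "\<And>G. finite G \<Longrightarrow> F \<subseteq> G \<Longrightarrow> dist (sum f G) s < e / 2"
      unfolding eventually_finite_subsets_at_top by auto
    have "vabs (f n) < e" if "n \<notin> F" for n
    proof -
      have "dist (sum f (insert n F)) (sum f F) < e"
      proof (rule dist_triangle_half_r)
        show "dist s (sum f (insert n F)) < e / 2" "dist s (sum f F) < e / 2"
          using F(2)[of "insert n F"] F(2)[of F] F(1) unfolding dist_commute[of s] by blast+
      qed
      then show ?thesis using F(1) that by (simp add: dist_vabs)
    qed
    then have "{n. e \<le> vabs (f n)} \<subseteq> F" by force
    then show "finite {n. e \<le> vabs (f n)}" using F(1) finite_subset by blast
  qed
next
  assume null: "\<forall>e>0. finite {n. e \<le> vabs (f n)}"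
  define S where "S N = {n. inverse (real (Suc N)) \<le> vabs (f n)}" for N
  have fin: "finite (S N)" for N using null by (simp add: S_def)
  have close: "dist (sum f F) (sum f (S N)) < inverse (real (Suc N))" if "finite F" "S N \<subseteq> F" for F N
    using that by (intro dist_sum_vabs) (auto simp: S_def)
  have mono: "S N \<subseteq> S M" if "N \<le> M" for N M
  proof -
    have "inverse (real (Suc M)) \<le> inverse (real (Suc N))" using that by (simp add: le_imp_inverse_le)
    then show ?thesis unfolding S_def by (blast intro: order_trans)
  qed
  have "Cauchy (\<lambda>N. sum f (S N))"
  proof (rule metric_CauchyI)
    fix e :: real assume "0 < e"
    then obtain N where N: "inverse (real (Suc N)) < e / 2" using reals_Archimedean[of "e / 2"] by auto
    have "dist (sum f (S m)) (sum f (S N)) < e / 2" if "m \<ge> N" for m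
      using close[OF fin mono[OF that]] N by simp
    then show "\<exists>M. \<forall>m\<ge>M. \<forall>n\<ge>M. dist (sum f (S m)) (sum f (S n)) < e"
      by (intro exI[of _ N] allI impI) (metis dist_commute dist_triangle_half_l)
  qed
  then obtain s where s: "(\<lambda>N. sum f (S N)) \<longlonglongrightarrow> s"
    using Cauchy_convergent convergent_def by blast
  have "(f has_sum s) UNIV"
    unfolding has_sum_def
  proof (rule tendstoI)
    fix e :: real assume e: "0 < e"
    obtain N1 where N1: "inverse (real (Suc N1)) < e / 2" using reals_Archimedean[of "e / 2"] e by auto
    obtain N2 where N2: "\<And>n. n \<ge> N2 \<Longrightarrow> dist (sum f (S n)) s < e / 2"
      using s e unfolding lim_sequentially by (meson half_gt_zero)
    define N where "N = max N1 N2"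
    have "inverse (real (Suc N)) \<le> inverse (real (Suc N1))"
      by (simp add: N_def le_imp_inverse_le)
    then have N: "inverse (real (Suc N)) < e / 2" using N1 by (rule le_less_trans)
    have "dist (sum f F) s < e" if "finite F" "S N \<subseteq> F" for F
    proof (rule dist_triangle_half_r)
      show "dist (sum f (S N)) (sum f F) < e / 2"
        using less_trans[OF close[OF that] N] by (simp only: dist_commute)
      show "dist (sum f (S N)) s < e / 2" using N2[of N] by (simp add: N_def)
    qed
    then show "eventually (\<lambda>F. dist (sum f F) s < e) (finite_subsets_at_top UNIV)"
      unfolding eventually_finite_subsets_at_top using fin[of N] by blast
  qed
  then show "f summable_on UNIV" by (auto simp: summable_on_def)
qed

lemma has_sum_cmult_vabs:
  fixes f :: "'i \<Rightarrow> 'c::nonarch_field"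
  assumes "(f has_sum s) A"
  shows "((\<lambda>n. c * f n) has_sum c * s) A"
  unfolding has_sum_def
proof (rule tendstoI)
  fix e :: real assume e: "0 < e"
  define r where "r = e / (vabs c + 1)"
  have c: "0 \<le> vabs c" by (rule vabs_nonneg)
  have r: "0 < r" using e c by (simp add: r_def)
  have "eventually (\<lambda>F. dist (sum f F) s < r) (finite_subsets_at_top A)"
    using assms r unfolding has_sum_def tendsto_iff by simp
  then show "eventually (\<lambda>F. dist (sum (\<lambda>n. c * f n) F) (c * s) < e) (finite_subsets_at_top A)"
  proof (rule eventually_mono)
    fix F assume F: "dist (sum f F) s < r"
    have "dist (sum (\<lambda>n. c * f n) F) (c * s) = vabs c * dist (sum f F) s"
      by (simp add: dist_vabs vabs_mult flip: sum_distrib_left right_diff_distrib)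
    also have "\<dots> \<le> vabs c * r" using F c by (intro mult_left_mono) auto
    also have "\<dots> < e" using e c by (simp add: r_def field_simps)
    finally show "dist (sum (\<lambda>n. c * f n) F) (c * s) < e" .
  qed
qed

lemma vabs_one [simp]: "vabs (1::'c::nonarch_field) = 1"
proof -
  have "vabs (1::'c) * vabs (1::'c) = vabs (1 * 1 :: 'c)" by (rule vabs_mult[symmetric])
  then show ?thesis using vabs_eq_0_iff[of "1::'c"] by simp
qed

lemma vabs_inverse: "vabs (inverse x) = inverse (vabs x)" for x :: "'c::nonarch_field"
proof (cases "x = 0")
  case False
  then have "vabs x * vabs (inverse x) = 1" by (simp flip: vabs_mult)
  then show ?thesis by (metis inverse_unique)
next
  case True
  then show ?thesis using vabs_eq_0_iff[of "0::'c"] by simp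
qed

lemma vabs_power: "vabs (x ^ n) = vabs x ^ n" for x :: "'c::nonarch_field"
  by (induction n) (simp_all add: vabs_mult)

lemma vabs_power_int: "vabs (x powi n) = vabs x powi n" for x :: "'c::nonarch_field"
  by (simp add: power_int_def vabs_power vabs_inverse)

lemma vabs_of_int_le: "vabs (of_int n :: 'c::nonarch_field) \<le> 1"
proof -
  have nat: "vabs (of_nat n :: 'c) \<le> 1" for n
  proof (induction n)
    case (Suc n)
    then show ?case using vabs_add[of 1 "of_nat n :: 'c"] by simp
  qed (use vabs_eq_0_iff[of "0::'c"] in simp)
  show ?thesis
    by (cases n) (use nat vabs_minus in \<open>metis of_int_of_nat_eq\<close>, use nat vabs_minus in \<open>metis of_int_of_nat_eq of_int_minus\<close>)
qed

section \<open>Laurent expansions\<close>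

lemma laurent_expansion_infsum:
  assumes "\<And>x. x \<noteq> 0 \<Longrightarrow> (\<lambda>n. u n * x powi n) summable_on UNIV"
  shows "laurent_expansion u (\<lambda>x. \<Sum>\<^sub>\<infinity>n. u n * x powi n)"
  using assms has_sum_infsum unfolding laurent_expansion_def by blast

lemma laurent_expansion_of_int_mult:
  fixes u :: "int \<Rightarrow> 'c::{nonarch_field,complete_space}"
  assumes "laurent_expansion u f"
  shows "laurent_expansion (\<lambda>n. of_int (k n) * u n) (\<lambda>x. \<Sum>\<^sub>\<infinity>n. (of_int (k n) * u n) * x powi n)"
proof (rule laurent_expansion_infsum)
  fix x :: 'c assume "x \<noteq> 0"
  then have "(\<lambda>n. u n * x powi n) summable_on UNIV"
    using assms by (auto simp: laurent_expansion_def summable_on_def)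
  then have null: "finite {n. e \<le> vabs (u n * x powi n)}" if "0 < e" for e
    using that by (simp add: summable_on_iff_null)
  have "vabs (of_int (k n) * u n * x powi n) \<le> vabs (u n * x powi n)" for n
    using mult_right_mono[OF vabs_of_int_le vabs_nonneg, of "k n" "u n * x powi n"]
    by (simp add: vabs_mult mult.assoc)
  then have "finite {n. e \<le> vabs (of_int (k n) * u n * x powi n)}" if "0 < e" for e
    by (intro finite_subset[OF _ null[OF that]]) (auto intro: order_trans)
  then show "(\<lambda>n. of_int (k n) * u n * x powi n) summable_on UNIV"
    by (simp add: summable_on_iff_null)
qed

lemma has_sum_monomial:
  "((\<lambda>n. (if n = k then c else 0) * x powi n) has_sum c * x powi k) UNIV"
  for c x :: "'c::nonarch_field"
proof -
  have "((\<lambda>n. (if n = k then c else 0) * x powi n) has_sum (\<Sum>n\<in>{k}. (if n = k then c else 0) * x powi n)) {k}"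
    by (rule has_sum_finite) simp
  then have "((\<lambda>n. (if n = k then c else 0) * x powi n) has_sum c * x powi k) {k}" by simp
  then show ?thesis by (rule has_sum_cong_neutral[THEN iffD1, rotated -1]) auto
qed

lemma laurent_expansion_monomial:
  "laurent_expansion (\<lambda>n. if n = k then c else 0) (\<lambda>x. c * x powi k)"
  using has_sum_monomial unfolding laurent_expansion_def by blast

lemma infsum_monomial: "(\<Sum>\<^sub>\<infinity>n. (if n = k then c else 0) * x powi n) = c * x powi k"
  for c x :: "'c::nonarch_field"
  using has_sum_monomial by (rule infsumI)

lemma laurent_expansion_dilate:
  assumes "laurent_expansion u f" "q \<noteq> 0"
  shows "laurent_expansion (\<lambda>n. u n * q powi n) (\<lambda>x. f (q * x))"
  unfolding laurent_expansion_def
proof (intro allI impI)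
  fix x :: 'a assume "x \<noteq> 0"
  then have "((\<lambda>n. u n * (q * x) powi n) has_sum f (q * x)) UNIV"
    using assms unfolding laurent_expansion_def by simp
  then show "((\<lambda>n. u n * q powi n * x powi n) has_sum f (q * x)) UNIV"
    by (simp add: power_int_mult_distrib mult.assoc)
qed

lemma laurent_expansion_cong:
  "laurent_expansion u f \<Longrightarrow> (\<And>x. x \<noteq> 0 \<Longrightarrow> f x = g x) \<Longrightarrow> laurent_expansion u g"
  unfolding laurent_expansion_def by simp

section \<open>The theta function\<close>

definition theta_coeff :: "'c::nonarch_field \<Rightarrow> int \<Rightarrow> 'c" where
  "theta_coeff q n = q powi (- (n * (n - 1) div 2))"

text \<open>
  The left-hand side is the negative of the logarithm of the absolute value of the \<open>n\<close>-th term of the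
  theta series, with \<open>L = log |q|\<close> and \<open>r = log |x|\<close>.
\<close>
lemma finite_quadratic_le:
  fixes L r C :: real
  assumes "0 < L"
  shows "finite {n::int. of_int (n * (n - 1) div 2) * L - of_int n * r \<le> C}"
proof -
  define B where "B = \<bar>L / 2 + r\<bar>"
  define K where "K = max 1 (2 * (\<bar>C\<bar> + B) / L)"
  have "\<bar>real_of_int n\<bar> \<le> K" if n: "of_int (n * (n - 1) div 2) * L - of_int n * r \<le> C" for n
  proof (cases "\<bar>n\<bar> \<le> 1")
    case True
    then have "real_of_int \<bar>n\<bar> \<le> 1" by linarith
    then show ?thesis by (simp add: K_def le_max_iff_disj)
  next
    case False
    define N where "N = \<bar>real_of_int n\<bar>"
    have N: "1 \<le> N" using False by (simp add: N_def)
    have "even (n * (n - 1))" by simp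
    then have half: "real_of_int (n * (n - 1) div 2) = real_of_int n * (real_of_int n - 1) / 2"
      by (simp add: real_of_int_div)
    have sq: "(real_of_int n)\<^sup>2 = N * N" by (simp add: N_def power2_eq_square)
    have "(real_of_int n)\<^sup>2 * L / 2 - real_of_int n * (L / 2 + r) \<le> C"
      using n unfolding half by (simp add: power2_eq_square field_simps)
    moreover have "real_of_int n * (L / 2 + r) \<le> N * B"
      unfolding N_def B_def by (metis abs_ge_self abs_mult)
    ultimately have "N * N * L / 2 \<le> \<bar>C\<bar> + N * B"
      unfolding sq using abs_ge_self[of C] by linarith
    also have "\<bar>C\<bar> \<le> N * \<bar>C\<bar>" using N mult_right_mono[of 1 N "\<bar>C\<bar>"] by simp
    finally have "N * (N * L / 2) \<le> N * (\<bar>C\<bar> + B)" by (simp add: algebra_simps)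
    then have "N * L / 2 \<le> \<bar>C\<bar> + B" using N by (simp add: mult_le_cancel_left)
    then have "N \<le> 2 * (\<bar>C\<bar> + B) / L" using assms by (simp add: field_simps)
    then show ?thesis by (simp add: K_def N_def)
  qed
  note bound = this
  have "{n::int. of_int (n * (n - 1) div 2) * L - of_int n * r \<le> C} \<subseteq> {- \<lceil>K\<rceil>..\<lceil>K\<rceil>}"
  proof
    fix n :: int
    assume "n \<in> {n. of_int (n * (n - 1) div 2) * L - of_int n * r \<le> C}"
    then have "\<bar>real_of_int n\<bar> \<le> K" using bound by blast
    then have "\<bar>real_of_int n\<bar> \<le> real_of_int \<lceil>K\<rceil>" using le_of_int_ceiling[of K] by linarith
    then have "n \<le> \<lceil>K\<rceil>" "- n \<le> \<lceil>K\<rceil>" by linarith+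
    then show "n \<in> {- \<lceil>K\<rceil>..\<lceil>K\<rceil>}" by simp
  qed
  then show ?thesis using finite_subset by blast
qed

lemma theta_expansion:
  fixes q :: "'c::{nonarch_field,complete_space}"
  assumes q: "1 < vabs q"
  shows "laurent_expansion (theta_coeff q) (theta_fun q)"
proof -
  have "(\<lambda>n. theta_coeff q n * x powi n) summable_on UNIV" if x: "x \<noteq> 0" for x :: 'c
    unfolding summable_on_iff_null
  proof (intro allI impI)
    fix e :: real assume e: "0 < e"
    have vx: "0 < vabs x" using x vabs_nonneg[of x] by (simp add: vabs_eq_0_iff less_le)
    have ln_powi: "ln (t powi n) = of_int n * ln t" "0 < t powi n" if "0 < t" for t :: real and n
      using that by (simp_all add: ln_powr flip: powr_real_of_int')
    have "of_int (n * (n - 1) div 2) * ln (vabs q) - of_int n * ln (vabs x) \<le> - ln e"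
      if "e \<le> vabs (theta_coeff q n * x powi n)" for n
    proof -
      have "vabs (theta_coeff q n * x powi n) = vabs q powi (- (n * (n - 1) div 2)) * vabs x powi n"
        by (simp add: theta_coeff_def vabs_mult vabs_power_int)
      then have "ln e \<le> ln (vabs q powi (- (n * (n - 1) div 2)) * vabs x powi n)"
        using that e by simp
      also have "\<dots> = of_int (- (n * (n - 1) div 2)) * ln (vabs q) + of_int n * ln (vabs x)"
        using q vx ln_powi by (subst ln_mult_pos) auto
      finally show ?thesis by simp
    qed
    then show "finite {n. e \<le> vabs (theta_coeff q n * x powi n)}"
      using q by (intro finite_subset[OF _ finite_quadratic_le]) (auto simp: ln_gt_zero)
  qed
  then show ?thesis
    unfolding theta_fun_def theta_coeff_def by (rule laurent_expansion_infsum)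
qed

lemma theta_functional_equation:
  fixes q :: "'c::{nonarch_field,complete_space}"
  assumes q: "1 < vabs q" and x: "x \<noteq> 0"
  shows "theta_fun q (q * x) = q * x * theta_fun q x"
proof -
  have q0: "q \<noteq> 0" using q vabs_eq_0_iff[of q] by auto
  have rec: "theta_coeff q n * (q * x) powi n = q * x * (theta_coeff q (n - 1) * x powi (n - 1))" for n
  proof -
    have "- (n * (n - 1) div 2) + n = 1 + - ((n - 1) * (n - 1 - 1) div 2)"
    proof -
      have "n * (n - 1) = (n - 1) * (n - 1 - 1) + 2 * (n - 1)" by (simp add: algebra_simps)
      then have "n * (n - 1) div 2 = (n - 1) * (n - 1 - 1) div 2 + (n - 1)" by simp
      then show ?thesis by simp
    qed
    then have "q powi (- (n * (n - 1) div 2)) * q powi n = q * q powi (- ((n - 1) * (n - 1 - 1) div 2))"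
      using q0 by (metis power_int_add power_int_1_right)
    moreover have "x powi n = x * x powi (n - 1)"
      using x power_int_add[of x 1 "n - 1"] by simp
    ultimately show ?thesis
      by (simp add: theta_coeff_def power_int_mult_distrib mult_ac)
  qed
  have "((\<lambda>n. theta_coeff q n * x powi n) has_sum theta_fun q x) UNIV"
    using theta_expansion[OF q] x by (simp add: laurent_expansion_def)
  then have "((\<lambda>n. theta_coeff q (n - 1) * x powi (n - 1)) has_sum theta_fun q x) UNIV"
    by (subst has_sum_reindex_bij_betw[where g = "\<lambda>n. n - 1" and f = "\<lambda>n. theta_coeff q n * x powi n"])
       (auto intro!: bij_betwI[where g = "\<lambda>n. n + 1"])
  from has_sum_cmult_vabs[OF this, of "q * x"]
  have "((\<lambda>n. theta_coeff q n * (q * x) powi n) has_sum q * x * theta_fun q x) UNIV"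
    by (simp add: rec)
  moreover have "((\<lambda>n. theta_coeff q n * (q * x) powi n) has_sum theta_fun q (q * x)) UNIV"
    using theta_expansion[OF q] x q0 by (simp add: laurent_expansion_def)
  ultimately show ?thesis by (metis has_sum_unique)
qed

text \<open>At \<open>x = 1\<close> the terms of index \<open>0\<close> and \<open>1\<close> add up to the unit \<open>2\<close>, and the others are smaller.\<close>

lemma theta_nonzero:
  fixes q :: "'c::{nonarch_field,complete_space}"
  assumes q: "1 < vabs q" and two: "vabs (2::'c) = 1"
  shows "theta_fun q 1 \<noteq> 0"
proof
  assume zero: "theta_fun q 1 = 0"
  have "(theta_coeff q has_sum theta_fun q 1) UNIV"
    using theta_expansion[OF q, unfolded laurent_expansion_def, THEN spec[of _ 1]] by simp
  then have "eventually (\<lambda>F. dist (sum (theta_coeff q) F) 0 < 1) (finite_subsets_at_top UNIV)"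
    unfolding has_sum_def tendsto_iff zero by simp
  then obtain F where F: "finite F" "\<And>G. finite G \<Longrightarrow> F \<subseteq> G \<Longrightarrow> vabs (sum (theta_coeff q) G) < 1"
    unfolding eventually_finite_subsets_at_top by (auto simp: dist_vabs)
  define G where "G = F \<union> {0, 1}"
  have G: "finite G" "F \<subseteq> G" using F(1) by (auto simp: G_def)
  have "dist (sum (theta_coeff q) G) (sum (theta_coeff q) {0, 1}) < 1"
  proof (rule dist_sum_vabs)
    fix n assume "n \<in> G - {0, 1}"
    then have n: "n < 0 \<or> 2 \<le> n" by auto
    then have "2 \<le> n * (n - 1)"
    proof
      assume "n < 0"
      then have "(- n) * (1 - n) \<ge> 1 * 2" by (intro mult_mono) auto
      then show ?thesis by (simp add: algebra_simps)
    next
      assume "2 \<le> n"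
      then have "n * (n - 1) \<ge> 2 * 1" by (intro mult_mono) auto
      then show ?thesis by simp
    qed
    then have "1 \<le> n * (n - 1) div 2" by simp
    then have "vabs q powi (- (n * (n - 1) div 2)) < vabs q powi 0"
      using q by (intro power_int_strict_increasing) auto
    then show "vabs (theta_coeff q n) < 1" by (simp add: theta_coeff_def vabs_power_int)
  qed (use G in \<open>auto simp: G_def\<close>)
  moreover have "sum (theta_coeff q) {0, 1} = 2" by (simp add: theta_coeff_def)
  ultimately have "vabs (sum (theta_coeff q) G - 2) < 1" by (simp add: dist_vabs)
  moreover have "vabs (sum (theta_coeff q) G) < 1" by (rule F(2)[OF G])
  moreover have "vabs (2::'c) \<le> max (vabs (sum (theta_coeff q) G)) (vabs (sum (theta_coeff q) G - 2))"
    using vabs_add[of "sum (theta_coeff q) G" "- (sum (theta_coeff q) G - 2)"]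
    unfolding vabs_minus by simp
  ultimately show False using two by simp
qed

section \<open>Elliptic functions and the Galois group\<close>

context q_setting
begin

lemma \<iota>_ring_map: "ring_map \<iota>"
  using hom by (simp add: ring_map_iff)

lemma \<sigma>_ring_map: "ring_map \<sigma>"
  using \<sigma>(1) by (simp add: ring_map_iff)

lemma dx_deriv: "ring_deriv dx"
  using dx(1) by (simp add: deriv_iff)

lemma dq_deriv: "ring_deriv dq"
  using dq(1) by (simp add: deriv_iff)

lemma dqC_deriv: "ring_deriv dqC"
  using dqC(1) by (simp add: deriv_iff)

lemma vabs_q_gt_1: "1 < vabs q"
  using vabs_q by (simp add: q_def)

lemma q_nonzero: "q \<noteq> 0"
  using vabs_q_gt_1 vabs_eq_0_iff[of q] by auto

lemma vabs_of_nat_Suc: "vabs (of_nat (Suc n) :: 'c) = 1"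
proof -
  interpret ring_map \<iota> by (rule \<iota>_ring_map)
  have "(of_nat (Suc n) :: 'k poly) \<noteq> 0" by (simp del: of_nat_Suc)
  then have "vabs (\<iota> (Fract (of_nat (Suc n)) 1)) = 1"
    using q_inverse_adic[of "of_nat (Suc n)" 1] by (simp del: of_nat_Suc)
  also have "Fract (of_nat (Suc n)) 1 = (of_nat (Suc n) :: 'k poly fract)"
    by (rule Fract_of_nat_eq)
  finally show ?thesis by (simp only: of_nat)
qed

lemma dqC_q_powi: "dqC (q powi n) = of_int n * q powi n"
proof -
  interpret ring_deriv dqC by (rule dqC_deriv)
  have q: "dqC q = q"
  proof -
    have "dqC (\<iota> (Fract [:0, 1:] 1)) = \<iota> (Fract ([:0, 1:] * (pderiv [:0, 1:] * 1 - [:0, 1:] * pderiv 1)) (1 * 1))"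
      by (rule dqC(3)) simp
    then show ?thesis by (simp add: q_def pderiv_pCons pderiv_1)
  qed
  have nat: "dqC (q ^ n) = of_nat n * q ^ n" for n
    by (induction n) (simp_all add: q algebra_simps)
  show ?thesis
  proof (cases "0 \<le> n")
    case True
    then show ?thesis using nat[of "nat n"] by (simp add: power_int_def)
  next
    case False
    define m where "m = nat (- n)"
    have "q ^ m * inverse q ^ m = 1" using q_nonzero by (simp flip: power_mult_distrib)
    from inverse_unit[OF this] have "dqC (inverse q ^ m) = - of_nat m * (q ^ m * inverse q ^ m) * inverse q ^ m"
      by (simp add: nat mult_ac)
    then have "dqC (inverse q ^ m) = - of_nat m * inverse q ^ m"
      using \<open>q ^ m * inverse q ^ m = 1\<close> by simp
    moreover have "n = - int m" using False by (simp add: m_def)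
    ultimately show ?thesis by (simp add: power_int_def power_inverse)
  qed
qed

lemma analyticI: "laurent_expansion u f \<Longrightarrow> analytic_on_punctured f"
  by (auto simp: analytic_on_punctured_def)

lemma analytic_monomial: "analytic_on_punctured (\<lambda>x. c * x powi k)"
  using laurent_expansion_monomial by (rule analyticI)

lemma analytic_const: "analytic_on_punctured (\<lambda>x. c)"
  using analytic_monomial[of c 0] by simp

lemma analytic_linear: "analytic_on_punctured (\<lambda>x. c * x)"
  using analytic_monomial[of c 1] by simp

abbreviation "Q \<equiv> mk (\<lambda>t. q)"
abbreviation "X \<equiv> mk (\<lambda>t. t)"
definition A where "A = mk (\<lambda>t. q * t)"
abbreviation "\<Theta> \<equiv> mk (theta_fun q)"

lemma A_eq: "A = Q * X"
  using mk_mult[OF analytic_const[of q] analytic_linear[of 1]] by (simp add: A_def)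

lemma mk_zero: "mk (\<lambda>x. 0) = 0"
proof -
  have "mk (\<lambda>x. 0) + 0 = mk (\<lambda>x. 0) + mk (\<lambda>x. 0)"
    using mk_add[OF analytic_const[of 0] analytic_const[of 0]] by (simp only: add_0_right)
  then show ?thesis by (simp only: add_left_cancel)
qed

lemma mk_of_nat: "mk (\<lambda>x. of_nat n) = of_nat n"
proof (induction n)
  case (Suc n)
  then show ?case
    using mk_add[OF analytic_const[of 1] analytic_const[of "of_nat n"]] by (simp add: mk_one)
qed (simp add: mk_zero)

lemma mk_eq_0_iff: "analytic_on_punctured f \<Longrightarrow> mk f = 0 \<longleftrightarrow> (\<forall>x. x \<noteq> 0 \<longrightarrow> f x = 0)"
  using mk_eq_iff[OF _ analytic_const[of 0], of f] by (simp add: mk_zero)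

lemma of_nat_Suc_M: "of_nat (Suc n) \<noteq> (0::'m)"
proof -
  have "(of_nat (Suc n) :: 'c) \<noteq> 0"
    using vabs_of_nat_Suc[of n] vabs_eq_0_iff[of "of_nat (Suc n) :: 'c"] by force
  then show ?thesis
    using mk_eq_0_iff[OF analytic_const, of "of_nat (Suc n)"] mk_of_nat[of "Suc n"]
    by (metis one_neq_zero)
qed

lemma A_nonzero: "A \<noteq> 0"
  using mk_eq_0_iff[OF analytic_linear, of q] q_nonzero unfolding A_def by (metis mult_eq_0_iff one_neq_zero)

lemma X_nonzero: "X \<noteq> 0"
  using A_nonzero by (auto simp: A_eq)

lemma Q_power: "Q ^ n = mk (\<lambda>x. q ^ n)"
  by (induction n) (simp_all add: mk_one mk_mult analytic_const)

lemma Q_nonzero: "Q \<noteq> 0"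
  using A_nonzero by (auto simp: A_eq)

lemma Q_power_neq_1: "Q ^ Suc n \<noteq> 1"
proof
  assume "Q ^ Suc n = 1"
  then have "mk (\<lambda>x. q ^ Suc n) = mk (\<lambda>x. 1)" by (simp only: Q_power mk_one)
  then have "q ^ Suc n = 1"
    using mk_eq_iff[OF analytic_const analytic_const, of "q ^ Suc n" 1] by (metis one_neq_zero)
  then have "vabs q ^ Suc n = 1" by (metis vabs_one vabs_power)
  then show False using one_less_power[OF vabs_q_gt_1, of "Suc n"] by simp
qed

lemma \<sigma>_Q: "\<sigma> Q = Q"
  using \<sigma>(2)[OF analytic_const] .

lemma \<sigma>_X: "\<sigma> X = A"
  using \<sigma>(2)[OF analytic_linear, of 1] by (simp add: A_def)

lemma dx_A: "dx A = A"
proof -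
  have "laurent_expansion (\<lambda>n. if n = 1 then q else 0) (\<lambda>x. q * x)"
    using laurent_expansion_monomial[of 1 q] by simp
  from dx(2)[OF this] have "dx (mk (\<lambda>x. q * x)) = mk (\<lambda>x. \<Sum>\<^sub>\<infinity>n. (of_int n * (if n = 1 then q else 0)) * x powi n)" .
  also have "(\<lambda>n. of_int n * (if n = 1 then q else 0)) = (\<lambda>n::int. if n = 1 then q else 0)"
    by auto
  then have "(\<lambda>x. \<Sum>\<^sub>\<infinity>n. (of_int n * (if n = 1 then q else 0)) * x powi n) =
      (\<lambda>x. \<Sum>\<^sub>\<infinity>n. (if n = 1 then q else 0) * x powi n)"
    by metis
  also have "\<dots> = (\<lambda>x. q * x)" by (simp add: infsum_monomial)
  finally show ?thesis by (simp only: A_def)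
qed

lemma dq_A: "dq A = A"
proof -
  have "laurent_expansion (\<lambda>n. if n = 1 then q else 0) (\<lambda>x. q * x)"
    using laurent_expansion_monomial[of 1 q] by simp
  from dq(2)[OF this] have "dq (mk (\<lambda>x. q * x)) = mk (\<lambda>x. \<Sum>\<^sub>\<infinity>n. dqC (if n = 1 then q else 0) * x powi n)" .
  also have "(\<lambda>n. dqC (if n = 1 then q else 0)) = (\<lambda>n::int. if n = 1 then q else 0)"
    using dqC_q_powi[of 1] ring_deriv.zero[OF dqC_deriv] by auto
  then have "(\<lambda>x. \<Sum>\<^sub>\<infinity>n. dqC (if n = 1 then q else 0) * x powi n) =
      (\<lambda>x. \<Sum>\<^sub>\<infinity>n. (if n = 1 then q else 0) * x powi n)"
    by metis
  also have "\<dots> = (\<lambda>x. q * x)" by (simp add: infsum_monomial)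
  finally show ?thesis by (simp only: A_def)
qed

lemmas \<theta>_expansion = theta_expansion[OF vabs_q_gt_1]

lemma \<Theta>_nonzero: "\<Theta> \<noteq> 0"
proof -
  have "vabs (2::'c) = 1" using vabs_of_nat_Suc[of 1] by simp
  then have "theta_fun q 1 \<noteq> 0" by (rule theta_nonzero[OF vabs_q_gt_1])
  then show ?thesis using mk_eq_0_iff[OF analyticI[OF \<theta>_expansion]] by (metis one_neq_zero)
qed

lemma \<sigma>_\<Theta>_dilate: "\<sigma> \<Theta> = mk (\<lambda>x. theta_fun q (q * x))"
  by (rule \<sigma>(2)[OF analyticI[OF \<theta>_expansion]])

lemma \<sigma>_\<Theta>: "\<sigma> \<Theta> = A * \<Theta>"
proof -
  have expansion: "laurent_expansion (\<lambda>n. theta_coeff q n * q powi n) (\<lambda>x. theta_fun q (q * x))"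
    by (rule laurent_expansion_dilate[OF \<theta>_expansion q_nonzero])
  have eq: "theta_fun q (q * x) = q * x * theta_fun q x" if "x \<noteq> 0" for x
    by (rule theta_functional_equation[OF vabs_q_gt_1 that])
  have "mk (\<lambda>x. theta_fun q (q * x)) = mk (\<lambda>x. q * x * theta_fun q x)"
    using mk_eq_iff[OF analyticI[OF expansion] analyticI[OF laurent_expansion_cong[OF expansion eq]]] eq
    by blast
  also have "\<dots> = A * \<Theta>"
    unfolding A_def by (rule mk_mult[OF analytic_linear analyticI[OF \<theta>_expansion]])
  finally show ?thesis unfolding \<sigma>_\<Theta>_dilate .
qed

text \<open>
  The coefficients of \<open>\<theta>\<close> are powers of \<open>q\<close>, so both derivations multiply its terms by integers, and the
  convergence of the derivatives is immediate.
\<close>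
definition twisted_theta :: "(int \<Rightarrow> int) \<Rightarrow> 'c \<Rightarrow> 'c" where
  "twisted_theta k x = (\<Sum>\<^sub>\<infinity>n. (of_int (k n) * theta_coeff q n) * x powi n)"

lemma twisted_theta: "laurent_expansion (\<lambda>n. of_int (k n) * theta_coeff q n) (twisted_theta k)"
  unfolding twisted_theta_def[abs_def] by (rule laurent_expansion_of_int_mult[OF \<theta>_expansion])

abbreviation "theta_exponent n \<equiv> - (n * (n - 1) div 2 :: int)"

lemma derivatives_\<Theta>:
  "dx \<Theta> = mk (twisted_theta (\<lambda>n. n))" "dq \<Theta> = mk (twisted_theta theta_exponent)"
  using dx(2)[OF \<theta>_expansion] dq(2)[OF \<theta>_expansion]
  by (simp_all add: twisted_theta_def[abs_def] theta_coeff_def dqC_q_powi)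

lemma derivatives_\<sigma>_\<Theta>:
  "dx (\<sigma> \<Theta>) = mk (\<lambda>x. twisted_theta (\<lambda>n. n) (q * x))"
  "dq (\<sigma> \<Theta>) = mk (\<lambda>x. twisted_theta (\<lambda>n. theta_exponent n + n) (q * x))"
proof -
  have expansion: "laurent_expansion (\<lambda>n. theta_coeff q n * q powi n) (\<lambda>x. theta_fun q (q * x))"
    by (rule laurent_expansion_dilate[OF \<theta>_expansion q_nonzero])
  show "dx (\<sigma> \<Theta>) = mk (\<lambda>x. twisted_theta (\<lambda>n. n) (q * x))"
    unfolding \<sigma>_\<Theta>_dilate dx(2)[OF expansion]
    by (simp add: twisted_theta_def power_int_mult_distrib mult.assoc)
  have "dqC (theta_coeff q n * q powi n) = of_int (theta_exponent n + n) * (theta_coeff q n * q powi n)" for n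
  proof -
    have "theta_coeff q n * q powi n = q powi (theta_exponent n + n)"
      unfolding theta_coeff_def using q_nonzero by (intro power_int_add[symmetric]) simp
    then show ?thesis by (simp only: dqC_q_powi)
  qed
  then show "dq (\<sigma> \<Theta>) = mk (\<lambda>x. twisted_theta (\<lambda>n. theta_exponent n + n) (q * x))"
    unfolding \<sigma>_\<Theta>_dilate dq(2)[OF expansion]
    by (simp only:) (simp add: twisted_theta_def power_int_mult_distrib mult.assoc)
qed

lemma \<sigma>_dx_\<Theta>: "\<sigma> (dx \<Theta>) = dx (\<sigma> \<Theta>)"
  unfolding derivatives_\<Theta> derivatives_\<sigma>_\<Theta> by (rule \<sigma>(2)[OF analyticI[OF twisted_theta]])

lemma dq_\<sigma>_\<Theta>: "dq (\<sigma> \<Theta>) = \<sigma> (dq \<Theta>) + dx (\<sigma> \<Theta>)"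
proof -
  have an: "analytic_on_punctured (\<lambda>x. twisted_theta k (q * x))" for k
    by (rule analyticI[OF laurent_expansion_dilate[OF twisted_theta q_nonzero]])
  have sum: "twisted_theta (\<lambda>n. k n + r n) x = twisted_theta k x + twisted_theta r x" if "x \<noteq> 0" for k r x
  proof -
    have has_sum: "((\<lambda>n. of_int (k n) * theta_coeff q n * x powi n) has_sum twisted_theta k x) UNIV" for k
      using twisted_theta[of k] that unfolding laurent_expansion_def by blast
    have "((\<lambda>n. of_int (k n + r n) * theta_coeff q n * x powi n) has_sum
        twisted_theta k x + twisted_theta r x) UNIV"
      using has_sum_add[OF has_sum[of k] has_sum[of r]] by (simp add: algebra_simps)
    with has_sum[of "\<lambda>n. k n + r n"] show ?thesis by (rule has_sum_unique)
  qed
  have eq: "twisted_theta (\<lambda>n. theta_exponent n + n) (q * x) =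
      twisted_theta theta_exponent (q * x) + twisted_theta (\<lambda>n. n) (q * x)" if "x \<noteq> 0" for x
    by (rule sum[where k = theta_exponent and r = "\<lambda>n. n" and x = "q * x"]) (use that q_nonzero in simp)
  have an_sum: "analytic_on_punctured (\<lambda>x. twisted_theta theta_exponent (q * x) + twisted_theta (\<lambda>n. n) (q * x))"
    by (rule analyticI, rule laurent_expansion_cong[OF laurent_expansion_dilate[OF twisted_theta q_nonzero] eq])
  have "dq (\<sigma> \<Theta>) = mk (\<lambda>x. twisted_theta theta_exponent (q * x) + twisted_theta (\<lambda>n. n) (q * x))"
    unfolding derivatives_\<sigma>_\<Theta> using mk_eq_iff[OF an an_sum] eq by blast
  also have "\<dots> = mk (\<lambda>x. twisted_theta theta_exponent (q * x)) + dx (\<sigma> \<Theta>)"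
    unfolding derivatives_\<sigma>_\<Theta> by (rule mk_add[OF an an])
  also have "mk (\<lambda>x. twisted_theta theta_exponent (q * x)) = \<sigma> (dq \<Theta>)"
    unfolding derivatives_\<Theta> by (rule \<sigma>(2)[OF analyticI[OF twisted_theta], symmetric])
  finally show ?thesis .
qed

abbreviation "ell \<equiv> dx \<Theta> / \<Theta>"
abbreviation "\<delta> f \<equiv> ell * dx f + dq f"

lemma \<sigma>_ell: "\<sigma> ell = ell + 1"
proof -
  interpret dx: ring_deriv dx by (rule dx_deriv)
  have "\<sigma> ell = dx (A * \<Theta>) / (A * \<Theta>)"
    by (simp add: ring_map_divide[OF \<sigma>_ring_map] \<sigma>_dx_\<Theta> flip: \<sigma>_\<Theta>)
  also have "dx (A * \<Theta>) = A * (\<Theta> + dx \<Theta>)" by (simp add: dx_A algebra_simps)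
  finally show ?thesis using A_nonzero \<Theta>_nonzero by (simp add: add_divide_distrib)
qed

lemma \<delta>_A: "\<delta> A = (ell + 1) * A"
  by (simp add: dx_A dq_A algebra_simps)

text \<open>
  The operator \<open>\<sigma>\<close> adds \<open>ell + 1\<close> to \<open>\<delta> \<Theta> / \<Theta>\<close> and \<open>2 (ell + 1)\<close> to \<open>ell\<^sup>2 + ell\<close>.
\<close>
lemma elliptic_expression:
  "\<sigma> (2 * (\<delta> \<Theta> / \<Theta>) - (ell\<^sup>2 + ell)) = 2 * (\<delta> \<Theta> / \<Theta>) - (ell\<^sup>2 + ell)"
proof -
  interpret \<sigma>: ring_map \<sigma> by (rule \<sigma>_ring_map)
  interpret dx: ring_deriv dx by (rule dx_deriv)
  interpret dq: ring_deriv dq by (rule dq_deriv)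
  have "\<sigma> (\<delta> \<Theta>) = \<sigma> ell * dx (\<sigma> \<Theta>) + (dq (\<sigma> \<Theta>) - dx (\<sigma> \<Theta>))"
    by (simp only: \<sigma>.add \<sigma>.mult \<sigma>_dx_\<Theta> dq_\<sigma>_\<Theta> add_diff_cancel_right')
  also have "\<dots> = \<delta> (A * \<Theta>)"
    unfolding \<sigma>_ell unfolding \<sigma>_\<Theta> by (simp add: algebra_simps)
  also have "\<dots> = \<delta> A * \<Theta> + A * \<delta> \<Theta>" by (simp only: dx.mult dq.mult) (simp only: algebra_simps)
  also have "\<dots> = A * \<Theta> * (\<delta> \<Theta> / \<Theta> + ell + 1)"
  proof -
    have "(l + 1) * a * t + a * d = a * t * (d / t + l + 1)" if "t \<noteq> 0" for l a t d :: 'm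
      using that by (simp add: field_simps)
    from this[OF \<Theta>_nonzero] show ?thesis unfolding \<delta>_A .
  qed
  finally have "\<sigma> (\<delta> \<Theta> / \<Theta>) = \<delta> \<Theta> / \<Theta> + ell + 1"
    unfolding ring_map_divide[OF \<sigma>_ring_map] \<sigma>_\<Theta> using A_nonzero \<Theta>_nonzero by simp
  then show ?thesis
    by (simp only: \<sigma>.diff \<sigma>.mult \<sigma>.add \<sigma>.power \<sigma>.numeral \<sigma>_ell)
       (simp only: power2_eq_square algebra_simps, simp)
qed

end

lemma inv_full_ring: "inv\<^bsub>full_ring\<^esub> h = inverse h" if "h \<noteq> 0" for h :: "'a::field"
proof -
  interpret ring "full_ring :: 'a ring" by (rule ring_ring_on) simp_all
  show ?thesis
    by (rule inv_char) (use that in \<open>simp_all add: ring_on_def\<close>)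
qed

lemma generate_field_closed:
  fixes S :: "'a::field set"
  defines "G \<equiv> generate_field full_ring S"
  shows "1 \<in> G" "x \<in> G \<Longrightarrow> y \<in> G \<Longrightarrow> x + y \<in> G" "x \<in> G \<Longrightarrow> y \<in> G \<Longrightarrow> x * y \<in> G"
    "x \<in> G \<Longrightarrow> - x \<in> G" "x \<in> G \<Longrightarrow> inverse x \<in> G"
proof -
  show "1 \<in> G" using generate_field.one[of full_ring S] by (simp add: G_def full_ring_ops)
  show "x + y \<in> G" "x * y \<in> G" if "x \<in> G" "y \<in> G" for x y
    using generate_field.eng_add[of x full_ring S y] generate_field.eng_mult[of x full_ring S y] that
    by (simp_all add: G_def full_ring_ops)
  show "- x \<in> G" if "x \<in> G" for x
    using generate_field.a_inv[of x full_ring S] that by (simp add: G_def full_ring_ops)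
  show "inverse x \<in> G" if "x \<in> G" for x
    using generate_field.m_inv[of x full_ring S] that
    by (cases "x = 0") (simp_all add: G_def full_ring_ops inv_full_ring)
qed

lemma generate_field_inductive:
  fixes S :: "'a::field set"
  assumes g: "g \<in> generate_field full_ring S"
    and P: "P 1" "\<And>x. x \<in> S \<Longrightarrow> P x"
      "\<And>x y. x \<in> generate_field full_ring S \<Longrightarrow> y \<in> generate_field full_ring S \<Longrightarrow> P x \<Longrightarrow> P y \<Longrightarrow> P (x + y)"
      "\<And>x y. x \<in> generate_field full_ring S \<Longrightarrow> y \<in> generate_field full_ring S \<Longrightarrow> P x \<Longrightarrow> P y \<Longrightarrow> P (x * y)"
      "\<And>x. x \<in> generate_field full_ring S \<Longrightarrow> P x \<Longrightarrow> P (- x)"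
      "\<And>x. x \<in> generate_field full_ring S \<Longrightarrow> x \<noteq> 0 \<Longrightarrow> P x \<Longrightarrow> P (inverse x)"
  shows "P g"
proof -
  show ?thesis
    using g by (induction rule: generate_field.induct) (simp_all add: full_ring_ops inv_full_ring P)
qed

context q_difference_field
begin

definition fractions_field :: "'b set" where
  "fractions_field = {ev p / ev r |p r. ev r \<noteq> 0}"

lemma fractions_field_ev: "ev p \<in> fractions_field"
  unfolding fractions_field_def by (rule CollectI, rule exI[of _ p], rule exI[of _ 1]) simp

lemma fractions_field_generators: "i f \<in> fractions_field" "x \<in> fractions_field" "l \<in> fractions_field"
proof -
  have "ev [:[:f:]:] = i f" "ev (Polynomial.monom 1 1) = x" "ev [:[:0, 1:]:] = l"
    by (simp_all add: ev_def ev_l_def map_poly_pCons poly_monom map_poly_monom)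
  then show "i f \<in> fractions_field" "x \<in> fractions_field" "l \<in> fractions_field"
    using fractions_field_ev by metis+
qed

lemma fractions_field_closed:
  assumes "b \<in> fractions_field" "c \<in> fractions_field"
  shows "b + c \<in> fractions_field" "b * c \<in> fractions_field" "- b \<in> fractions_field"
    "inverse b \<in> fractions_field" "b / c \<in> fractions_field"
proof -
  have I: "ev p / ev r \<in> fractions_field" if "ev r \<noteq> 0" for p r
    using that unfolding fractions_field_def by blast
  have inv: "inverse b \<in> fractions_field" if "b \<in> fractions_field" for b
  proof -
    from that obtain p r where b: "b = ev p / ev r" "ev r \<noteq> 0" unfolding fractions_field_def by blast
    show ?thesis
    proof (cases "ev p = 0")
      case True
      then show ?thesis using fractions_field_ev[of 0] by (simp add: b)
    next
      case False
      then show ?thesis using I[of p r] by (simp add: b)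
    qed
  qed
  have mult: "b * c \<in> fractions_field" if "b \<in> fractions_field" "c \<in> fractions_field" for b c
  proof -
    from that obtain p r p' r' where "b = ev p / ev r" "ev r \<noteq> 0" "c = ev p' / ev r'" "ev r' \<noteq> 0"
      unfolding fractions_field_def by blast
    then show ?thesis using I[of "r * r'" "p * p'"] by simp
  qed
  from assms obtain p r p' r' where bc: "b = ev p / ev r" "ev r \<noteq> 0" "c = ev p' / ev r'" "ev r' \<noteq> 0"
    unfolding fractions_field_def by blast
  show "b + c \<in> fractions_field"
    using I[of "r * r'" "p * r' + p' * r"] bc by (simp add: add_frac_eq mult.commute)
  show "- b \<in> fractions_field" using I[of r "- p"] bc by simp
  show "b * c \<in> fractions_field" "inverse b \<in> fractions_field" "b / c \<in> fractions_field"
    using assms by (simp_all add: divide_inverse mult inv)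
qed

end

context q_setting
begin

text \<open>
  The hypotheses of the locale \<open>rank_one_extension\<close> hold with \<open>\<kappa> = e Q\<close>: the map \<open>e\<close> is injective on the
  field of elliptic functions, and \<open>|q| > 1\<close> prevents \<open>q\<close> from being a root of unity.
\<close>
lemma galois_group_inclusion:
  fixes e :: "'m \<Rightarrow> 'f::field" and i :: "'f \<Rightarrow> 'b::field" and \<eta> :: "'b \<Rightarrow> 'l::comm_ring_1"
  defines "CE \<equiv> {f. \<sigma> f = f}"
  defines "CExl \<equiv> generate_field full_ring (CE \<union> {X, ell})"
  assumes closure: "diff2_closure (diff2_on CE dx (\<lambda>f. \<delta> f) c) e (diff2_on UNIV D1 D2 (e c))"
    and extension: "constants_extension CE CExl \<sigma> (\<lambda>f. \<delta> f) e D2 i j \<sigma>B dB"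
    and pv: "rank_one_picard_vessiot \<sigma>B dB (j A) \<eta> R \<sigma>L dL z zi"
  shows "rank_one_galois_group \<eta> \<sigma>L dL z zi \<subseteq> (\<lambda>c. \<eta> (i c)) ` {c. c \<noteq> 0 \<and> D2 c / c = 0}"
proof -
  interpret ext: constants_extension CE CExl \<sigma> "\<lambda>f. \<delta> f" e D2 i j \<sigma>B dB by (rule extension)
  interpret \<sigma>: ring_map \<sigma> by (rule \<sigma>_ring_map)
  interpret i: ring_map i using ext.i_hom by (simp add: ring_map_iff)
  interpret \<sigma>B: ring_map \<sigma>B using ext.\<sigma>B_hom by (simp add: ring_map_iff)
  have F: "diff2_closed (diff2_on UNIV D1 D2 (e c))"
    using closure by (simp add: diff2_closure_def)
  have D2: "ring_deriv D2"
    using F diff2_field_full(2) unfolding diff2_closed_def by blast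
  have CE: "1 \<in> CE" "Q \<in> CE" "f \<in> CE \<Longrightarrow> g \<in> CE \<Longrightarrow> f + g \<in> CE" "f \<in> CE \<Longrightarrow> g \<in> CE \<Longrightarrow> f * g \<in> CE"
    "f \<in> CE \<Longrightarrow> inverse f \<in> CE" "f \<in> CE \<Longrightarrow> - f \<in> CE" for f g
    by (simp_all add: CE_def \<sigma>_Q ring_map_inverse[OF \<sigma>_ring_map])
  have e: "e 1 = 1" "f \<in> CE \<Longrightarrow> g \<in> CE \<Longrightarrow> e (f + g) = e f + e g" "f \<in> CE \<Longrightarrow> g \<in> CE \<Longrightarrow> e (f * g) = e f * e g" for f g
    using closure unfolding diff2_closure_def diff2_hom_def ring_hom_def
    by (auto simp: diff2_on_def)
  have e_0: "f = 0" if "f \<in> CE" "e f = 0" for f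
  proof (rule ccontr)
    assume "f \<noteq> 0"
    then have "e f * e (inverse f) = 1" using e(1) e(3)[OF that(1) CE(5)[OF that(1)]] by simp
    then show False using that(2) by simp
  qed
  have e_of_nat: "of_nat n \<in> CE \<and> e (of_nat n) = of_nat n" for n
  proof (induction n)
    case 0
    have "0 \<in> CE" by (simp add: CE_def)
    then have "e 0 + 0 = e 0 + e 0" using e(2)[of 0 0] by (simp only: add_0_right)
    then have "e 0 = 0" by (simp only: add_left_cancel)
    then show ?case using \<open>0 \<in> CE\<close> by simp
  qed (use e CE in simp)
  have e_power: "Q ^ n \<in> CE \<and> e (Q ^ n) = e Q ^ n" for n
    by (induction n) (use e CE in simp_all)
  have gen: "CE \<subseteq> CExl" "X \<in> CExl" "ell \<in> CExl"
    unfolding CExl_def by (auto intro: generate_field.incl)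
  note closed = generate_field_closed[where S = "CE \<union> {X, ell}", folded CExl_def]
  have A_mem: "A \<in> CExl" unfolding A_eq using closed(3) gen CE(2) by blast
  have j: "j 1 = 1" "f \<in> CExl \<Longrightarrow> g \<in> CExl \<Longrightarrow> j (f + g) = j f + j g"
    "f \<in> CExl \<Longrightarrow> g \<in> CExl \<Longrightarrow> j (f * g) = j f * j g" for f g
    using ext.j_hom by (auto simp: ring_hom_def ring_on_def)
  have j_minus: "j (- f) = - j f" if "f \<in> CExl" for f
  proof -
    have "0 \<in> CExl" using closed(2)[OF that closed(4)[OF that]] by simp
    then have "j 0 + 0 = j 0 + j 0" using j(2)[of 0 0] by (simp only: add_0_right)
    then have "j 0 = 0" by (simp only: add_left_cancel)
    moreover have "j (f + - f) = j f + j (- f)" by (rule j(2)[OF that closed(4)[OF that]])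
    ultimately show ?thesis by (simp add: eq_neg_iff_add_eq_0 add.commute)
  qed
  have j_inverse: "j (inverse f) = inverse (j f)" and j_nonzero: "j f \<noteq> 0" if "f \<in> CExl" "f \<noteq> 0" for f
  proof -
    have "j f * j (inverse f) = 1" using j(1) j(3)[OF that(1) closed(5)[OF that(1)]] that(2) by simp
    then show "j (inverse f) = inverse (j f)" "j f \<noteq> 0" by (auto simp: inverse_unique)
  qed
  have jQ: "j Q = i (e Q)" using ext.compatible[OF CE(2)] by simp
  have jA: "j A = i (e Q) * j X" unfolding A_eq using j(3) gen CE(2) jQ by auto
  interpret q_difference_field i \<sigma>B "e Q" "j X" "j ell"
  proof
    show "of_nat (Suc n) \<noteq> (0::'f)" for n
      using e_of_nat[of "Suc n"] e_0[of "of_nat (Suc n)"] of_nat_Suc_M[of n] by metis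
    show "\<sigma>B (i a) = i a" for a by (rule ext.\<sigma>B_i)
    show "\<sigma>B (j X) = i (e Q) * j X" using ext.\<sigma>B_j[OF gen(2)] by (simp add: \<sigma>_X jA)
    have "\<sigma>B (j ell) = j (\<sigma> ell)" by (rule ext.\<sigma>B_j[OF gen(3)])
    also have "\<dots> = j ell + 1" unfolding \<sigma>_ell using j(2)[OF gen(3) closed(1)] j(1) by simp
    finally show "\<sigma>B (j ell) = j ell + 1" .
    show "e Q \<noteq> 0" using e_0[OF CE(2)] Q_nonzero by blast
    show "e Q ^ Suc n \<noteq> 1" for n
    proof
      assume "e Q ^ Suc n = 1"
      then have "e (Q ^ Suc n + - 1) = 1 + e (- 1)"
        using e_power[of "Suc n"] e(2)[OF _ CE(6)[OF CE(1)]] by metis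
      also have "\<dots> = e (1 + - 1)" using e(2)[OF CE(1) CE(6)[OF CE(1)]] e(1) by simp
      also have "\<dots> = 0" using e_of_nat[of 0] by simp
      finally have "Q ^ Suc n + - 1 = 0"
        using e_0 e_power[of "Suc n"] CE(3)[OF _ CE(6)[OF CE(1)]] by blast
      then show False using Q_power_neq_1[of n] by simp
    qed
    show "j X \<noteq> 0" by (rule j_nonzero[OF gen(2) X_nonzero])
  qed
  have j_fraction: "j g \<in> fractions_field" if "g \<in> CExl" for g
    using that
  proof (rule generate_field_inductive[where S = "CE \<union> {X, ell}", folded CExl_def])
    show "j 1 \<in> fractions_field" using fractions_field_ev[of 1] j(1) by simp
    show "j g \<in> fractions_field" if "g \<in> CE \<union> {X, ell}" for g
    proof -
      from that consider "g \<in> CE" | "g = X" | "g = ell" by blast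
      then show ?thesis
      proof cases
        case 1
        then show ?thesis using fractions_field_generators(1)[of "e g"] ext.compatible[of g] by simp
      qed (simp_all only: fractions_field_generators)
    qed
  qed (simp_all add: j j_minus j_inverse fractions_field_closed)
  have tensor_fraction: "tensor_value i j xs \<in> fractions_field" if "set xs \<subseteq> UNIV \<times> CExl" for xs
    using that
  proof (induction xs)
    case Nil
    show ?case using fractions_field_ev[of 0] by (simp add: tensor_value_def)
  next
    case (Cons p xs)
    obtain a g where p: "p = (a, g)" "g \<in> CExl" using Cons.prems by (cases p) auto
    then have "i a * j g + tensor_value i j xs \<in> fractions_field"
      using Cons fractions_field_generators(1) j_fraction by (intro fractions_field_closed) auto
    then show ?case by (simp add: tensor_value_def p)
  qed
  have all_fractions: "b \<in> fractions_field" for b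
  proof -
    obtain xs ys where "set xs \<subseteq> UNIV \<times> CExl" "set ys \<subseteq> UNIV \<times> CExl"
      "b = tensor_value i j xs / tensor_value i j ys"
      using ext.fraction by blast
    then show ?thesis using tensor_fraction fractions_field_closed(5) by blast
  qed
  interpret pv: rank_one_picard_vessiot \<sigma>B dB "i (e Q) * j X" \<eta> R \<sigma>L dL z zi
    using pv unfolding jA .
  interpret rank_one_extension i \<sigma>B dB "e Q" "j X" "j ell" \<eta> R \<sigma>L dL z zi D2
  proof (intro rank_one_extension.intro rank_one_extension_axioms.intro)
    show "q_difference_field i \<sigma>B (e Q) (j X) (j ell)" by unfold_locales
    show "rank_one_picard_vessiot \<sigma>B dB (i (e Q) * j X) \<eta> R \<sigma>L dL z zi" by unfold_locales
    show "ring_deriv D2" "ring_deriv dB" using D2 ext.dB_derivation by (simp_all add: deriv_iff)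
    show "dB (i a) = i (D2 a)" for a by (rule ext.dB_i)
    have "dB (j A) = j (\<delta> A)" by (rule ext.dB_j[OF A_mem])
    also have "\<dots> = j ((ell + 1) * A)" by (simp only: \<delta>_A)
    also have "\<dots> = (j ell + 1) * j A"
      using j(3)[OF closed(2)[OF gen(3) closed(1)] A_mem] j(2)[OF gen(3) closed(1)] j(1) by simp
    finally show "dB (i (e Q) * j X) = (j ell + 1) * (i (e Q) * j X)" unfolding jA .
    show "\<exists>u v. ev v \<noteq> 0 \<and> b = ev u / ev v" for b
      using all_fractions[of b] unfolding fractions_field_def by blast
  qed
  show ?thesis by (rule galois_group[OF F])
qed

end

theorem mainTheorem9:
  fixes \<iota> :: "'k::field_char_0 poly fract \<Rightarrow> 'c::{alg_closed_field,nonarch_field,complete_space}"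
    and K :: "'c set"
    and mk :: "('c \<Rightarrow> 'c) \<Rightarrow> 'm::field"
    and q :: 'c
    and dqC :: "'c \<Rightarrow> 'c"
    and \<sigma> dx dq \<delta> :: "'m \<Rightarrow> 'm"
    and X \<theta> ell :: 'm
    and CE CExl :: "'m set"
  assumes setting: "q_setting \<iota> K mk q dqC \<sigma> dx dq"
    and X: "X = mk (\<lambda>t. t)"
    and \<theta>: "\<theta> = mk (theta_fun q)"
    and ell: "ell = dx \<theta> / \<theta>"
    and \<delta>: "\<delta> = (\<lambda>f. ell * dx f + dq f)"
    and CE: "CE = {f. \<sigma> f = f}"
    and CExl: "CExl = generate_field full_ring (CE \<union> {X, ell})"
  shows "2 * (\<delta> \<theta> / \<theta>) - (ell\<^sup>2 + ell) = 2 * (dq \<theta> / \<theta>) + ell\<^sup>2 - ell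
    \<and> 2 * (\<delta> \<theta> / \<theta>) - (ell\<^sup>2 + ell) \<in> CE
    \<and> (\<forall>(e :: 'm \<Rightarrow> 'f::field) D1 D2 (i :: 'f \<Rightarrow> 'b::field) j \<sigma>B dB
         (\<eta> :: 'b \<Rightarrow> 'l::comm_ring_1) R \<sigma>L dL z zi.
         diff2_closure (diff2_on CE dx \<delta> (dx ell)) e (diff2_on UNIV D1 D2 (e (dx ell))) \<and>
         constants_extension CE CExl \<sigma> \<delta> e D2 i j \<sigma>B dB \<and>
         rank_one_picard_vessiot \<sigma>B dB (j (mk (\<lambda>t. q * t))) \<eta> R \<sigma>L dL z zi
         \<longrightarrow> rank_one_galois_group \<eta> \<sigma>L dL z zi
               \<subseteq> (\<lambda>c. \<eta> (i c)) ` {c. c \<noteq> 0 \<and> D2 c / c = 0})"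
proof (intro conjI allI impI)
  interpret q_setting \<iota> K mk q dqC \<sigma> dx dq by (rule setting)
  have "\<delta> \<theta> / \<theta> = ell\<^sup>2 + dq \<theta> / \<theta>"
    by (simp add: \<delta> ell add_divide_distrib power2_eq_square)
  then show "2 * (\<delta> \<theta> / \<theta>) - (ell\<^sup>2 + ell) = 2 * (dq \<theta> / \<theta>) + ell\<^sup>2 - ell"
    by (simp only:) (simp add: algebra_simps)
  show "2 * (\<delta> \<theta> / \<theta>) - (ell\<^sup>2 + ell) \<in> CE"
    using elliptic_expression unfolding CE \<delta> ell \<theta> by simp
  fix e :: "'m \<Rightarrow> 'f::field" and D1 D2 and i :: "'f \<Rightarrow> 'b::field" and j \<sigma>B dB
    and \<eta> :: "'b \<Rightarrow> 'l::comm_ring_1" and R \<sigma>L dL z zi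
  assume "diff2_closure (diff2_on CE dx \<delta> (dx ell)) e (diff2_on UNIV D1 D2 (e (dx ell))) \<and>
    constants_extension CE CExl \<sigma> \<delta> e D2 i j \<sigma>B dB \<and>
    rank_one_picard_vessiot \<sigma>B dB (j (mk (\<lambda>t. q * t))) \<eta> R \<sigma>L dL z zi"
  then show "rank_one_galois_group \<eta> \<sigma>L dL z zi \<subseteq> (\<lambda>c. \<eta> (i c)) ` {c. c \<noteq> 0 \<and> D2 c / c = 0}"
    unfolding CExl CE \<delta> ell \<theta> X A_def[symmetric]
    by (elim conjE) (rule galois_group_inclusion)
qed

end
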